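(* Let $\mathcal{H}$ be finite-dimensional with $\dim\mathcal{H}>1$, and let $\omega$ be the constant sequence $\frac{1}{\dim\mathcal{H}}$. For each unitary $U$ on $\mathcal{H}$ there is a unique automorphism $\Psi_U$ of the von Neumann algebra $H^\infty_{\dim\mathcal{H}}$ that takes $r_\xi$ to $r_{U\xi}$ for all $\xi\in\mathcal{H}$. Further, the correspondence $U\mapsto\Psi_U$ from the unitary group $\mathcal{U}(\mathcal{H})$ of $\mathcal{H}$ to the automorphism group $\mathrm{Aut}(H^\infty_{\dim\mathcal{H}})$ is an injective group homomorphism.
   Context: $\mathcal{H}$ is a complex Hilbert space of finite dimension $n>1$ with orthonormal basis $\{e_1,\dots,e_n\}$. $\mathcal{F}(\mathcal{H})=\bigoplus_{k\ge 0}\mathcal{H}^{\otimes k}$ is the full Fock space, with $\mathcal{H}^{\otimes 0}=\mathbb{C}\Omega$, $\Omega$ the unit vacuum vector. For $\xi\in\mathcal{H}$ the left and right creation operators are $l_\xi(\eta)=\xi\otimes\eta$ and $r_\xi(\eta)=\eta\otimes\xi$ ($\eta\in\mathcal{F}(\mathcal{H})$; $l_\xi\Omega=r_\xi\Omega=\xi$), and $l_i:=l_{e_i}$. With $\omega$ the constant sequence $\frac1n$, the Markov operator is $P_\omega(x)=\frac1n\sum_{i=1}^n l_i^*xl_i$ for $x\in B(\mathcal{F}(\mathcal{H}))$. $H^\infty_{\dim\mathcal{H}}=\{x\in B(\mathcal{F}(\mathcal{H})):P_\omega(x)=x\}$. This $\sigma$-weakly closed operator system is a von Neumann algebra (abstractly)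 with the inherited linear structure, norm, adjoint, unit and $\sigma$-weak topology, and with the Choi-Effros product $x\circ y=\text{SOT-}\lim_{k\to\infty}P_\omega^k(xy)$ (this limit exists). Every $r_\xi$ belongs to $H^\infty_{\dim\mathcal{H}}$. An automorphism of $H^\infty_{\dim\mathcal{H}}$ is a $*$-algebra automorphism with respect to $\circ$. *)

theory Defs
  imports "HOL-Analysis.Analysis" "HOL-Algebra.Bij"
begin

section \<open>Complex inner product spaces\<close>

text \<open>
  The underlying real structure (and with it norm and topology) is that of \<^class>\<open>real_inner\<close>;
  the Hermitian form is conjugate linear in the first and linear in the second argument.
\<close>

class complex_inner = real_inner +
  fixes scaleC :: "complex \<Rightarrow> 'a \<Rightarrow> 'a" (infixr "*\<^sub>C" 75)
    and cinner :: "'a \<Rightarrow> 'a \<Rightarrow> complex"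
  assumes scaleC_add_right: "c *\<^sub>C (x + y) = c *\<^sub>C x + c *\<^sub>C y"
    and scaleC_add_left: "(c + d) *\<^sub>C x = c *\<^sub>C x + d *\<^sub>C x"
    and scaleC_scaleC: "c *\<^sub>C d *\<^sub>C x = (c * d) *\<^sub>C x"
    and scaleC_of_real: "complex_of_real a *\<^sub>C x = a *\<^sub>R x"
    and cinner_commute: "cinner x y = cnj (cinner y x)"
    and cinner_add_right: "cinner x (y + z) = cinner x y + cinner x z"
    and cinner_scaleC_right: "cinner x (c *\<^sub>C y) = c * cinner x y"
    and inner_eq_Re_cinner: "inner x y = Re (cinner x y)"

lemma cinner_scaleC_left: "cinner (c *\<^sub>C x) y = cnj c * cinner x y"
  by (metis cinner_commute cinner_scaleC_right complex_cnj_mult)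

lemma cinner_self: "cinner x x = complex_of_real ((norm x)\<^sup>2)"
proof -
  have "Im (cinner x x) = 0"
    using arg_cong[OF cinner_commute[of x x], of Im] by simp
  then show ?thesis
    by (simp add: complex_eq_iff power2_norm_eq_inner inner_eq_Re_cinner)
qed

lemma norm_scaleC: "norm (c *\<^sub>C x) = cmod c * norm x"
proof -
  have "cinner (c *\<^sub>C x) (c *\<^sub>C x) = (c * cnj c) * cinner x x"
    by (simp add: cinner_scaleC_left cinner_scaleC_right)
  also have "\<dots> = complex_of_real ((cmod c)\<^sup>2 * (norm x)\<^sup>2)"
    by (simp only: complex_norm_square[symmetric] cinner_self of_real_mult)
  finally have "(norm (c *\<^sub>C x))\<^sup>2 = (cmod c * norm x)\<^sup>2"
    by (simp only: cinner_self of_real_eq_iff power_mult_distrib)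
  then show ?thesis
    by (simp add: power2_eq_iff_nonneg)
qed

lemma scaleC_scaleR: "c *\<^sub>C (a *\<^sub>R x) = a *\<^sub>R (c *\<^sub>C x)"
  by (simp only: scaleC_of_real[symmetric] scaleC_scaleC mult.commute)

lemma bounded_linear_scaleC: "bounded_linear ((*\<^sub>C) c)"
  by (rule bounded_linear_intro[where K = "cmod c"])
    (simp_all add: scaleC_add_right scaleC_scaleR norm_scaleC mult.commute)

definition orthonormal_basis :: "('n::finite \<Rightarrow> 'h::complex_inner) \<Rightarrow> bool" where
  "orthonormal_basis e \<longleftrightarrow>
     (\<forall>i j. cinner (e i) (e j) = (if i = j then 1 else 0)) \<and>
     (\<forall>x. \<exists>c. x = (\<Sum>i\<in>UNIV. c i *\<^sub>C e i))"

definition unitary :: "('h::complex_inner \<Rightarrow> 'h) \<Rightarrow> bool" where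
  "unitary U \<longleftrightarrow>
     (\<forall>x y. U (x + y) = U x + U y) \<and> (\<forall>c x. U (c *\<^sub>C x) = c *\<^sub>C U x) \<and>
     (\<forall>x y. cinner (U x) (U y) = cinner x y) \<and> surj U"

definition unitary_group :: "('h::complex_inner \<Rightarrow> 'h) monoid" where
  "unitary_group = \<lparr>carrier = {U. unitary U}, mult = (\<circ>), one = id\<rparr>"


section \<open>Bounded operators\<close>

text \<open>
  The type of bounded linear functions of the library only asks for real linearity, so the
  algebra of bounded operators is a proper subset of it.
\<close>

definition cbounded_ops :: "('a::complex_inner \<Rightarrow>\<^sub>L 'a) set" where
  "cbounded_ops = {x. \<forall>c \<eta>. blinfun_apply x (c *\<^sub>C \<eta>) = c *\<^sub>C blinfun_apply x \<eta>}"

definition op_scaleC :: "complex \<Rightarrow> ('a::complex_inner \<Rightarrow>\<^sub>L 'a) \<Rightarrow> 'a \<Rightarrow>\<^sub>L 'a" where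
  "op_scaleC c x = Blinfun (\<lambda>\<eta>. c *\<^sub>C blinfun_apply x \<eta>)"

lemma op_scaleC_apply [simp]: "op_scaleC c x \<eta> = c *\<^sub>C x \<eta>"
  unfolding op_scaleC_def
  by (subst bounded_linear_Blinfun_apply)
    (auto intro: bounded_linear_compose[OF bounded_linear_scaleC blinfun.bounded_linear_right])

definition adj :: "('a::complex_inner \<Rightarrow>\<^sub>L 'a) \<Rightarrow> 'a \<Rightarrow>\<^sub>L 'a" where
  "adj x = (THE y. \<forall>f g. cinner (blinfun_apply y f) g = cinner f (blinfun_apply x g))"


section \<open>The full Fock space\<close>

text \<open>
  Let \<open>e\<close> be an orthonormal basis of \<open>H\<close> indexed by the finite type \<open>'n\<close>. The tensors
  \<open>e i\<^sub>1 \<otimes> \<dots> \<otimes> e i\<^sub>k\<close> form an orthonormal basis of the \<open>k\<close>-th tensor power of \<open>H\<close>, so that the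
  Hilbert space direct sum of all tensor powers is the space of square summable families of
  coefficients indexed by words \<open>[i\<^sub>1, \<dots>, i\<^sub>k]\<close>; the vacuum vector is the basis vector of the
  empty word. See \<open>simple_tensor\<close> below for the embedding of elementary tensors.
\<close>

typedef 'n fock = "{f :: 'n::finite list \<Rightarrow> complex. (\<lambda>w. (cmod (f w))\<^sup>2) summable_on UNIV}"
  morphisms coeff Abs_fock
  by (rule exI[of _ "\<lambda>_. 0"]) simp

setup_lifting type_definition_fock

lemma coeff_summable: "(\<lambda>w. (cmod (coeff f w))\<^sup>2) summable_on UNIV"
  using coeff[of f] by simp

lemma fock_eqI: "(\<And>w. coeff f w = coeff g w) \<Longrightarrow> f = g"
  by (metis coeff_inject ext)

lemma square_summable_add:
  fixes f g :: "'a \<Rightarrow> complex"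
  assumes "(\<lambda>w. (cmod (f w))\<^sup>2) summable_on A" "(\<lambda>w. (cmod (g w))\<^sup>2) summable_on A"
  shows "(\<lambda>w. (cmod (f w + g w))\<^sup>2) summable_on A"
proof -
  have le: "(cmod (f w + g w))\<^sup>2 \<le> 2 * (cmod (f w))\<^sup>2 + 2 * (cmod (g w))\<^sup>2" for w
  proof -
    have "(cmod (f w + g w))\<^sup>2 \<le> (cmod (f w) + cmod (g w))\<^sup>2"
      by (intro power_mono norm_triangle_ineq) simp
    also have "\<dots> \<le> 2 * (cmod (f w))\<^sup>2 + 2 * (cmod (g w))\<^sup>2"
      using sum_squares_bound[of "cmod (f w)" "cmod (g w)"] by (simp add: power2_sum)
    finally show ?thesis .
  qed
  have "(\<lambda>w. 2 * (cmod (f w))\<^sup>2 + 2 * (cmod (g w))\<^sup>2) summable_on A"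
    by (intro summable_on_add summable_on_cmult_right assms)
  then show ?thesis
    by (rule summable_on_comparison_test) (use le in auto)
qed

lemma square_summable_mult:
  fixes f g :: "'a \<Rightarrow> complex"
  assumes "(\<lambda>w. (cmod (f w))\<^sup>2) summable_on A" "(\<lambda>w. (cmod (g w))\<^sup>2) summable_on A"
  shows "(\<lambda>w. cnj (f w) * g w) summable_on A"
proof (rule abs_summable_summable)
  have le: "cmod (cnj (f w) * g w) \<le> (cmod (f w))\<^sup>2 + (cmod (g w))\<^sup>2" for w
  proof -
    have "cmod (f w) * cmod (g w) * 2 \<le> (cmod (f w))\<^sup>2 + (cmod (g w))\<^sup>2"
      using sum_squares_bound[of "cmod (f w)" "cmod (g w)"] by simp
    moreover have "0 \<le> cmod (f w) * cmod (g w)" by simp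
    ultimately have "cmod (f w) * cmod (g w) \<le> (cmod (f w))\<^sup>2 + (cmod (g w))\<^sup>2" by linarith
    then show ?thesis by (simp add: norm_mult)
  qed
  have "(\<lambda>w. (cmod (f w))\<^sup>2 + (cmod (g w))\<^sup>2) summable_on A"
    by (intro summable_on_add assms)
  then show "(\<lambda>w. norm (cnj (f w) * g w)) summable_on A"
    by (rule summable_on_comparison_test) (use le in auto)
qed

lemma coeff_mult_summable: "(\<lambda>w. cnj (coeff f w) * coeff g w) summable_on UNIV"
  by (intro square_summable_mult coeff_summable)

instantiation fock :: (finite) complex_inner
begin

lift_definition zero_fock :: "'a fock" is "\<lambda>_. 0"
  by simp

lift_definition plus_fock :: "'a fock \<Rightarrow> 'a fock \<Rightarrow> 'a fock" is "\<lambda>f g w. f w + g w"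
  by (rule square_summable_add)

lift_definition scaleC_fock :: "complex \<Rightarrow> 'a fock \<Rightarrow> 'a fock" is "\<lambda>c f w. c * f w"
  by (simp add: norm_mult power_mult_distrib summable_on_cmult_right)

lift_definition uminus_fock :: "'a fock \<Rightarrow> 'a fock" is "\<lambda>f w. - f w"
  by simp

definition minus_fock :: "'a fock \<Rightarrow> 'a fock \<Rightarrow> 'a fock" where
  "f - g = f + - (g :: 'a fock)"

definition scaleR_fock :: "real \<Rightarrow> 'a fock \<Rightarrow> 'a fock" where
  "a *\<^sub>R f = complex_of_real a *\<^sub>C (f :: 'a fock)"

definition cinner_fock :: "'a fock \<Rightarrow> 'a fock \<Rightarrow> complex" where
  "cinner f g = (\<Sum>\<^sub>\<infinity>w. cnj (coeff f w) * coeff g w)"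

definition inner_fock :: "'a fock \<Rightarrow> 'a fock \<Rightarrow> real" where
  "inner f g = Re (cinner f (g :: 'a fock))"

definition norm_fock :: "'a fock \<Rightarrow> real" where
  "norm f = sqrt (inner f (f :: 'a fock))"

definition dist_fock :: "'a fock \<Rightarrow> 'a fock \<Rightarrow> real" where
  "dist f g = norm (f - g :: 'a fock)"

definition sgn_fock :: "'a fock \<Rightarrow> 'a fock" where
  "sgn f = inverse (norm f) *\<^sub>R (f :: 'a fock)"

definition uniformity_fock :: "('a fock \<times> 'a fock) filter" where
  "uniformity_fock = (INF e\<in>{0<..}. principal {(x, y :: 'a fock). dist x y < e})"

definition open_fock :: "'a fock set \<Rightarrow> bool" where
  "open_fock S = (\<forall>x\<in>S. \<forall>\<^sub>F (x', y) in uniformity. x' = x \<longrightarrow> (y :: 'a fock) \<in> S)"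

lemma cinner_fock_commute: "cinner f g = cnj (cinner g (f :: 'a fock))"
  unfolding cinner_fock_def infsum_cnj[symmetric] by (simp add: mult.commute)

lemma cinner_fock_add: "cinner f (g + h) = cinner f g + cinner f (h :: 'a fock)"
  unfolding cinner_fock_def
  by (simp add: plus_fock.rep_eq distrib_left infsum_add coeff_mult_summable)

lemma cinner_fock_scaleC: "cinner f (c *\<^sub>C g) = c * cinner f (g :: 'a fock)"
proof -
  have "cinner f (c *\<^sub>C g) = (\<Sum>\<^sub>\<infinity>w. c * (cnj (coeff f w) * coeff g w))"
    unfolding cinner_fock_def by (simp add: scaleC_fock.rep_eq mult_ac)
  then show ?thesis
    unfolding cinner_fock_def by (simp add: infsum_cmult_right')
qed

lemma cinner_fock_self: "cinner f (f :: 'a fock) = complex_of_real (\<Sum>\<^sub>\<infinity>w. (cmod (coeff f w))\<^sup>2)"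
proof -
  have "cnj z * z = complex_of_real ((cmod z)\<^sup>2)" for z
    unfolding complex_norm_square by (rule mult.commute)
  then have "cinner f f = (\<Sum>\<^sub>\<infinity>w. complex_of_real ((cmod (coeff f w))\<^sup>2))"
    unfolding cinner_fock_def by simp
  also have "\<dots> = complex_of_real (\<Sum>\<^sub>\<infinity>w. (cmod (coeff f w))\<^sup>2)"
    by (intro infsumI has_sum_of_real has_sum_infsum coeff_summable)
  finally show ?thesis .
qed

instance
proof
  fix f g h :: "'a fock" and a b :: real and c d :: complex
  show "f + g + h = f + (g + h)" "f + g = g + f" "0 + f = f" "- f + f = 0"
    by (rule fock_eqI, simp add: plus_fock.rep_eq zero_fock.rep_eq uminus_fock.rep_eq)+
  show "f - g = f + - g"
    by (rule minus_fock_def)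
  show C: "c *\<^sub>C (f + g) = c *\<^sub>C f + c *\<^sub>C g" "(c + d) *\<^sub>C f = c *\<^sub>C f + d *\<^sub>C f"
    "c *\<^sub>C d *\<^sub>C f = (c * d) *\<^sub>C f" for c d and f g :: "'a fock"
    by (rule fock_eqI, simp add: plus_fock.rep_eq scaleC_fock.rep_eq algebra_simps)+
  show "complex_of_real a *\<^sub>C f = a *\<^sub>R f"
    by (simp add: scaleR_fock_def)
  show "a *\<^sub>R (f + g) = a *\<^sub>R f + a *\<^sub>R g" "(a + b) *\<^sub>R f = a *\<^sub>R f + b *\<^sub>R f"
    "a *\<^sub>R b *\<^sub>R f = (a * b) *\<^sub>R f"
    by (simp_all add: scaleR_fock_def C)
  show "1 *\<^sub>R f = f"
    by (rule fock_eqI) (simp add: scaleR_fock_def scaleC_fock.rep_eq)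
  show "dist f g = norm (f - g)" "sgn f = inverse (norm f) *\<^sub>R f" "norm f = sqrt (inner f f)"
    "inner f g = Re (cinner f g)"
    by (simp_all only: dist_fock_def sgn_fock_def norm_fock_def inner_fock_def)
  show "uniformity = (INF e\<in>{0<..}. principal {(x, y :: 'a fock). dist x y < e})"
    by (rule uniformity_fock_def)
  show "open S = (\<forall>x\<in>S. \<forall>\<^sub>F (x', y) in uniformity. x' = x \<longrightarrow> y \<in> S)" for S :: "'a fock set"
    by (rule open_fock_def)
  show "cinner f g = cnj (cinner g f)" "cinner f (g + h) = cinner f g + cinner f h"
    "cinner f (c *\<^sub>C g) = c * cinner f g"
    by (rule cinner_fock_commute cinner_fock_add cinner_fock_scaleC)+
  show *: "inner f g = inner g f" for f g :: "'a fock"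
    using arg_cong[OF cinner_fock_commute[of f g], of Re] by (simp only: inner_fock_def cnj.simps)
  have add: "inner f (g + h) = inner f g + inner f h" for f g h :: "'a fock"
    unfolding inner_fock_def by (simp add: cinner_fock_add)
  have scale: "inner f (a *\<^sub>R g) = a * inner f g" for a and f g :: "'a fock"
    unfolding inner_fock_def by (simp add: cinner_fock_scaleC scaleR_fock_def)
  show "inner (f + g) h = inner f h + inner g h"
    unfolding *[of _ h] by (rule add)
  show "inner (a *\<^sub>R f) g = a * inner f g"
    unfolding *[of _ g] by (rule scale)
  show "0 \<le> inner f f"
    unfolding inner_fock_def by (simp add: cinner_fock_self infsum_nonneg)
  show "inner f f = 0 \<longleftrightarrow> f = 0"
  proof
    assume "inner f f = 0"
    then have "(\<Sum>\<^sub>\<infinity>w. (cmod (coeff f w))\<^sup>2) = 0"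
      by (simp add: inner_fock_def cinner_fock_self)
    then have "(cmod (coeff f w))\<^sup>2 = 0" for w
      using nonneg_infsum_le_0D[of "\<lambda>w. (cmod (coeff f w))\<^sup>2" UNIV w] coeff_summable[of f] by simp
    then show "f = 0"
      by (intro fock_eqI) (simp add: zero_fock.rep_eq)
  next
    assume "f = 0"
    then show "inner f f = 0"
      by (simp add: inner_fock_def cinner_fock_self zero_fock.rep_eq)
  qed
qed

end

lemma norm_fock_square: "(norm f)\<^sup>2 = (\<Sum>\<^sub>\<infinity>w. (cmod (coeff f w))\<^sup>2)" for f :: "'n::finite fock"
  by (simp add: power2_norm_eq_inner inner_fock_def cinner_fock_self)

lemma norm_fock_has_sum: "((\<lambda>w. (cmod (coeff f w))\<^sup>2) has_sum (norm f)\<^sup>2) UNIV"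
  for f :: "'n::finite fock"
  unfolding norm_fock_square by (intro has_sum_infsum coeff_summable)

lift_definition vacuum :: "'n::finite fock" ("\<Omega>") is "\<lambda>w. if w = [] then 1 else 0"
proof -
  have "(\<lambda>w :: 'n list. (cmod (if w = [] then 1 else 0))\<^sup>2) summable_on {[]}"
    by simp
  then show "(\<lambda>w :: 'n list. (cmod (if w = [] then 1 else 0))\<^sup>2) summable_on UNIV"
    by (rule summable_on_cong_neutral[THEN iffD1, rotated -1]) auto
qed

text \<open>
  The elementary tensor of a list of vectors, by its coordinates in the product basis.
\<close>

lift_definition simple_tensor :: "('n::finite \<Rightarrow> 'h::complex_inner) \<Rightarrow> 'h list \<Rightarrow> 'n fock" is
  "\<lambda>e xs w. if length w = length xs then \<Prod>j<length xs. cinner (e (w ! j)) (xs ! j) else 0"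
proof -
  fix e :: "'n \<Rightarrow> 'h" and xs :: "'h list"
  let ?f = "\<lambda>w. (cmod (if length w = length xs
    then \<Prod>j<length xs. cinner (e (w ! j)) (xs ! j) else 0))\<^sup>2"
  have "finite {w :: 'n list. length w = length xs}"
    using finite_lists_length_eq[of "UNIV :: 'n set"] by simp
  then have "?f summable_on {w. length w = length xs}"
    by (rule summable_on_finite)
  then show "?f summable_on UNIV"
    by (rule summable_on_cong_neutral[THEN iffD1, rotated -1]) auto
qed

lemma simple_tensor_Nil: "simple_tensor e [] = \<Omega>"
  by (rule fock_eqI) (simp add: simple_tensor.rep_eq vacuum.rep_eq)


section \<open>Creation operators\<close>

lemma has_sum_branches:
  fixes a :: "'n::finite \<Rightarrow> 'b::real_normed_field" and \<phi> :: "'n \<Rightarrow> 'v \<Rightarrow> 'w"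
  assumes inj: "\<And>i j v w. \<phi> i v = \<phi> j w \<Longrightarrow> i = j \<and> v = w"
    and img: "\<And>i v. f (\<phi> i v) = a i * g v"
    and out: "\<And>w. (\<And>i v. w \<noteq> \<phi> i v) \<Longrightarrow> f w = 0"
    and g: "(g has_sum s) UNIV"
  shows "(f has_sum (\<Sum>i\<in>UNIV. a i) * s) UNIV"
proof -
  have part: "(f has_sum a i * s) (range (\<phi> i))" for i
  proof -
    have "inj (\<phi> i)"
      using inj by (auto intro: injI)
    moreover have "((f \<circ> \<phi> i) has_sum a i * s) UNIV"
      unfolding comp_def img by (intro has_sum_cmult_right g)
    ultimately show ?thesis
      by (simp add: has_sum_reindex)
  qed
  have "(f has_sum (\<Sum>i\<in>I. a i * s)) (\<Union>i\<in>I. range (\<phi> i))" for I :: "'n set"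
  proof (induction I rule: finite_induct[OF finite])
    case (2 i I)
    have "range (\<phi> i) \<inter> (\<Union>i\<in>I. range (\<phi> i)) = {}"
      using 2 inj by auto
    then show ?case
      using has_sum_Un_disjoint[OF part[of i] 2(3)] 2 by simp
  qed simp
  from this[of UNIV] have "(f has_sum (\<Sum>i\<in>UNIV. a i) * s) (\<Union>i. range (\<phi> i))"
    by (simp add: sum_distrib_right)
  moreover have out': "f w = 0" if "w \<notin> (\<Union>i. range (\<phi> i))" for w
    using that by (intro out) auto
  ultimately show ?thesis
    using has_sum_cong_neutral[of UNIV "\<Union>i. range (\<phi> i)" f f] by simp
qed

lemma creation_has_sum:
  fixes a :: "'n::finite \<Rightarrow> complex" and \<phi> :: "'n \<Rightarrow> 'n list \<Rightarrow> 'n list" and \<eta> :: "'n fock"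
  assumes inj: "\<And>i j v w. \<phi> i v = \<phi> j w \<Longrightarrow> i = j \<and> v = w"
    and img: "\<And>i v. f (\<phi> i v) = a i * coeff \<eta> v"
    and out: "\<And>w. (\<And>i v. w \<noteq> \<phi> i v) \<Longrightarrow> f w = 0"
  shows "((\<lambda>w. (cmod (f w))\<^sup>2) has_sum (\<Sum>i\<in>UNIV. (cmod (a i))\<^sup>2) * (norm \<eta>)\<^sup>2) UNIV"
proof (rule has_sum_branches[OF inj _ _ norm_fock_has_sum])
  show "(cmod (f (\<phi> i v)))\<^sup>2 = (cmod (a i))\<^sup>2 * (cmod (coeff \<eta> v))\<^sup>2" for i v
    by (simp add: img norm_mult power_mult_distrib)
  show "(cmod (f w))\<^sup>2 = 0" if "\<And>i v. w \<noteq> \<phi> i v" for w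
    using out[OF that] by simp
qed assumption

text \<open>
  In coordinates, \<open>\<xi> \<otimes> \<eta>\<close> and \<open>\<eta> \<otimes> \<xi>\<close> for \<open>\<xi>\<close> in \<open>H\<close> and \<open>\<eta>\<close> in the Fock space.
\<close>

lift_definition tensor_left :: "('n::finite \<Rightarrow> 'h::complex_inner) \<Rightarrow> 'h \<Rightarrow> 'n fock \<Rightarrow> 'n fock" is
  "\<lambda>e \<xi> \<eta> w. case w of [] \<Rightarrow> 0 | i # v \<Rightarrow> cinner (e i) \<xi> * \<eta> v"
  subgoal premises prems for e \<xi> \<eta>
    by (rule has_sum_imp_summable, rule creation_has_sum[where \<phi> = "\<lambda>i v. i # v"
          and a = "\<lambda>i. cinner (e i) \<xi>" and \<eta> = "Abs_fock \<eta>"])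
      (use prems in \<open>auto simp: Abs_fock_inverse split: list.split\<close>)
  done

lift_definition tensor_right :: "('n::finite \<Rightarrow> 'h::complex_inner) \<Rightarrow> 'n fock \<Rightarrow> 'h \<Rightarrow> 'n fock" is
  "\<lambda>e \<eta> \<xi> w. if w = [] then 0 else \<eta> (butlast w) * cinner (e (last w)) \<xi>"
  subgoal premises prems for e \<eta> \<xi>
    by (rule has_sum_imp_summable, rule creation_has_sum[where \<phi> = "\<lambda>i v. v @ [i]"
          and a = "\<lambda>i. cinner (e i) \<xi>" and \<eta> = "Abs_fock \<eta>"])
      (use prems in \<open>auto simp: Abs_fock_inverse, metis append_butlast_last_id\<close>)
  done

lemma norm_tensor_left:
  "norm (tensor_left e \<xi> \<eta>) = sqrt (\<Sum>i\<in>UNIV. (cmod (cinner (e i) \<xi>))\<^sup>2) * norm \<eta>"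
proof -
  have "((\<lambda>w. (cmod (coeff (tensor_left e \<xi> \<eta>) w))\<^sup>2) has_sum
      (\<Sum>i\<in>UNIV. (cmod (cinner (e i) \<xi>))\<^sup>2) * (norm \<eta>)\<^sup>2) UNIV"
    by (rule creation_has_sum[where \<phi> = "\<lambda>i v. i # v"])
      (auto simp: tensor_left.rep_eq split: list.split)
  then have "(norm (tensor_left e \<xi> \<eta>))\<^sup>2 = (\<Sum>i\<in>UNIV. (cmod (cinner (e i) \<xi>))\<^sup>2) * (norm \<eta>)\<^sup>2"
    using infsumI norm_fock_square by metis
  then show ?thesis
    by (metis abs_norm_cancel real_sqrt_abs real_sqrt_mult)
qed

lemma norm_tensor_right:
  "norm (tensor_right e \<eta> \<xi>) = sqrt (\<Sum>i\<in>UNIV. (cmod (cinner (e i) \<xi>))\<^sup>2) * norm \<eta>"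
proof -
  have "((\<lambda>w. (cmod (coeff (tensor_right e \<eta> \<xi>) w))\<^sup>2) has_sum
      (\<Sum>i\<in>UNIV. (cmod (cinner (e i) \<xi>))\<^sup>2) * (norm \<eta>)\<^sup>2) UNIV"
    by (rule creation_has_sum[where \<phi> = "\<lambda>i v. v @ [i]"])
      (auto simp: tensor_right.rep_eq, metis append_butlast_last_id)
  then have "(norm (tensor_right e \<eta> \<xi>))\<^sup>2 = (\<Sum>i\<in>UNIV. (cmod (cinner (e i) \<xi>))\<^sup>2) * (norm \<eta>)\<^sup>2"
    using infsumI norm_fock_square by metis
  then show ?thesis
    by (metis abs_norm_cancel real_sqrt_abs real_sqrt_mult)
qed

lemma bounded_linear_tensor_left: "bounded_linear (tensor_left e \<xi>)"
  by (rule bounded_linear_intro[where K = "sqrt (\<Sum>i\<in>UNIV. (cmod (cinner (e i) \<xi>))\<^sup>2)"])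
    (auto intro!: fock_eqI simp: tensor_left.rep_eq plus_fock.rep_eq scaleC_fock.rep_eq
      scaleR_fock_def norm_tensor_left algebra_simps split: list.split)

lemma bounded_linear_tensor_right: "bounded_linear (\<lambda>\<eta>. tensor_right e \<eta> \<xi>)"
  by (rule bounded_linear_intro[where K = "sqrt (\<Sum>i\<in>UNIV. (cmod (cinner (e i) \<xi>))\<^sup>2)"])
    (auto intro!: fock_eqI simp: tensor_right.rep_eq plus_fock.rep_eq scaleC_fock.rep_eq
      scaleR_fock_def norm_tensor_right algebra_simps)

definition left_creation :: "('n::finite \<Rightarrow> 'h::complex_inner) \<Rightarrow> 'h \<Rightarrow> 'n fock \<Rightarrow>\<^sub>L 'n fock" where
  "left_creation e \<xi> = Blinfun (\<lambda>\<eta>. tensor_left e \<xi> \<eta>)"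

definition right_creation :: "('n::finite \<Rightarrow> 'h::complex_inner) \<Rightarrow> 'h \<Rightarrow> 'n fock \<Rightarrow>\<^sub>L 'n fock" where
  "right_creation e \<xi> = Blinfun (\<lambda>\<eta>. tensor_right e \<eta> \<xi>)"

lemma left_creation_apply: "left_creation e \<xi> \<eta> = tensor_left e \<xi> \<eta>"
  by (simp add: left_creation_def bounded_linear_Blinfun_apply bounded_linear_tensor_left)

lemma right_creation_apply: "right_creation e \<xi> \<eta> = tensor_right e \<eta> \<xi>"
  by (simp add: right_creation_def bounded_linear_Blinfun_apply bounded_linear_tensor_right)

lemma left_creation_simple_tensor:
  "left_creation e \<xi> (simple_tensor e xs) = simple_tensor e (\<xi> # xs)"
  by (rule fock_eqI) (auto simp: left_creation_apply tensor_left.rep_eq simple_tensor.rep_eq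
      prod.lessThan_Suc_shift simp del: prod.lessThan_Suc split: list.split)

lemma right_creation_simple_tensor:
  "right_creation e \<xi> (simple_tensor e xs) = simple_tensor e (xs @ [\<xi>])"
proof (rule fock_eqI)
  fix w
  show "coeff (right_creation e \<xi> (simple_tensor e xs)) w = coeff (simple_tensor e (xs @ [\<xi>])) w"
    by (cases w rule: rev_cases)
      (auto simp: right_creation_apply tensor_right.rep_eq simple_tensor.rep_eq nth_append
        intro!: prod.cong)
qed


lemma cinner_expansion:
  fixes e :: "'n::finite \<Rightarrow> 'h::complex_inner"
  assumes "orthonormal_basis e"
  shows "cinner \<xi> \<zeta> = (\<Sum>i\<in>UNIV. cnj (cinner (e i) \<xi>) * cinner (e i) \<zeta>)"
proof -
  have cinner_sum_right: "cinner x (\<Sum>i\<in>A. g i) = (\<Sum>i\<in>A. cinner x (g i))"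
    for A :: "'n set" and x :: 'h and g
  proof (induction A rule: finite_induct[OF finite])
    case 1
    show ?case using cinner_scaleC_right[of x 0 0] cinner_add_right[of x 0 0] by simp
  qed (simp add: cinner_add_right)
  obtain c where c: "\<zeta> = (\<Sum>i\<in>UNIV. c i *\<^sub>C e i)"
    using assms unfolding orthonormal_basis_def by blast
  have ortho: "cinner (e i) (e j) = (if i = j then 1 else 0)" for i j
    using assms unfolding orthonormal_basis_def by blast
  have "cinner (e j) \<zeta> = (\<Sum>i\<in>UNIV. c i * (if j = i then 1 else 0))" for j
    unfolding c cinner_sum_right cinner_scaleC_right ortho ..
  then have coef: "cinner (e j) \<zeta> = c j" for j
    by (simp add: if_distrib cong: if_cong)
  have "cinner \<xi> \<zeta> = (\<Sum>i\<in>UNIV. c i * cinner \<xi> (e i))"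
    by (subst c) (simp only: cinner_sum_right cinner_scaleC_right)
  also have "\<dots> = (\<Sum>i\<in>UNIV. cnj (cinner (e i) \<xi>) * cinner (e i) \<zeta>)"
    unfolding coef cinner_commute[of \<xi>] by (simp add: mult.commute)
  finally show ?thesis .
qed

lemma cinner_tensor_left:
  assumes "orthonormal_basis e"
  shows "cinner (tensor_left e \<xi> f) (tensor_left e \<zeta> g) = cinner \<xi> \<zeta> * cinner f g"
proof -
  have "((\<lambda>w. cnj (coeff (tensor_left e \<xi> f) w) * coeff (tensor_left e \<zeta> g) w) has_sum
      (\<Sum>i\<in>UNIV. cnj (cinner (e i) \<xi>) * cinner (e i) \<zeta>) * cinner f g) UNIV"
    unfolding cinner_fock_def
    by (rule has_sum_branches[where \<phi> = "\<lambda>i v. i # v", OF _ _ _ has_sum_infsum])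
      (auto simp: tensor_left.rep_eq coeff_mult_summable split: list.split)
  then show ?thesis
    unfolding cinner_expansion[OF assms, of \<xi> \<zeta>] cinner_fock_def[of "tensor_left e \<xi> f"]
    by (rule infsumI)
qed

text \<open>
  The inner product of the Fock space is that of the tensor powers of \<open>H\<close>.
\<close>

lemma cinner_simple_tensor:
  assumes "orthonormal_basis e" and "length xs = length ys"
  shows "cinner (simple_tensor e xs) (simple_tensor e ys) = (\<Prod>j<length xs. cinner (xs ! j) (ys ! j))"
  using assms(2)
proof (induction xs ys rule: list_induct2)
  case Nil
  have "((\<lambda>w :: 'a list. cnj (coeff \<Omega> w) * coeff \<Omega> w) has_sum 1) {[]}"
    by (rule has_sum_finiteI) (auto simp: vacuum.rep_eq)
  then have "((\<lambda>w :: 'a list. cnj (coeff \<Omega> w) * coeff \<Omega> w) has_sum 1) UNIV"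
    by (rule has_sum_cong_neutral[THEN iffD1, rotated -1]) (auto simp: vacuum.rep_eq)
  then show ?case
    by (simp add: simple_tensor_Nil cinner_fock_def infsumI)
next
  case (Cons x xs y ys)
  then show ?case
    by (simp add: left_creation_apply cinner_tensor_left[OF assms(1)] prod.lessThan_Suc_shift
        del: prod.lessThan_Suc flip: left_creation_simple_tensor)
qed

lemma cinner_simple_tensor_orthogonal:
  assumes "length xs \<noteq> length ys"
  shows "cinner (simple_tensor e xs) (simple_tensor e ys) = 0"
  unfolding cinner_fock_def by (rule infsum_0) (use assms in \<open>auto simp: simple_tensor.rep_eq\<close>)


section \<open>The noncommutative Poisson boundary\<close>

definition markov :: "('n::finite \<Rightarrow> 'h::complex_inner) \<Rightarrow> ('n fock \<Rightarrow>\<^sub>L 'n fock) \<Rightarrow> 'n fock \<Rightarrow>\<^sub>L 'n fock"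
  where
  "markov e x = (1 / real CARD('n)) *\<^sub>R
     (\<Sum>i\<in>UNIV. adj (left_creation e (e i)) o\<^sub>L x o\<^sub>L left_creation e (e i))"

definition H_infty :: "('n::finite \<Rightarrow> 'h::complex_inner) \<Rightarrow> ('n fock \<Rightarrow>\<^sub>L 'n fock) set" where
  "H_infty e = {x \<in> cbounded_ops. markov e x = x}"

definition choi_effros ::
  "('n::finite \<Rightarrow> 'h::complex_inner) \<Rightarrow> ('n fock \<Rightarrow>\<^sub>L 'n fock) \<Rightarrow> ('n fock \<Rightarrow>\<^sub>L 'n fock) \<Rightarrow> 'n fock \<Rightarrow>\<^sub>L 'n fock"
  where
  "choi_effros e x y =
     (THE z. limitin strong_operator_topology (\<lambda>k. (markov e ^^ k) (x o\<^sub>L y)) z sequentially)"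

text \<open>
  As in \<^const>\<open>BijGroup\<close>, automorphisms are represented by extensional functions.
\<close>

definition H_infty_auto ::
  "('n::finite \<Rightarrow> 'h::complex_inner) \<Rightarrow> (('n fock \<Rightarrow>\<^sub>L 'n fock) \<Rightarrow> 'n fock \<Rightarrow>\<^sub>L 'n fock) set" where
  "H_infty_auto e = {\<theta> \<in> Bij (H_infty e).
     (\<forall>x\<in>H_infty e. \<forall>y\<in>H_infty e. \<theta> (x + y) = \<theta> x + \<theta> y) \<and>
     (\<forall>c. \<forall>x\<in>H_infty e. \<theta> (op_scaleC c x) = op_scaleC c (\<theta> x)) \<and>
     (\<forall>x\<in>H_infty e. \<forall>y\<in>H_infty e. \<theta> (choi_effros e x y) = choi_effros e (\<theta> x) (\<theta> y)) \<and>
     (\<forall>x\<in>H_infty e. \<theta> (adj x) = adj (\<theta> x))}"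

definition H_infty_Aut ::
  "('n::finite \<Rightarrow> 'h::complex_inner) \<Rightarrow> (('n fock \<Rightarrow>\<^sub>L 'n fock) \<Rightarrow> 'n fock \<Rightarrow>\<^sub>L 'n fock) monoid" where
  "H_infty_Aut e = BijGroup (H_infty e) \<lparr>carrier := H_infty_auto e\<rparr>"

definition Psi ::
  "('n::finite \<Rightarrow> 'h::complex_inner) \<Rightarrow> ('h \<Rightarrow> 'h) \<Rightarrow> ('n fock \<Rightarrow>\<^sub>L 'n fock) \<Rightarrow> 'n fock \<Rightarrow>\<^sub>L 'n fock" where
  "Psi e U = (THE \<theta>. \<theta> \<in> carrier (H_infty_Aut e) \<and>
     (\<forall>\<xi>. \<theta> (right_creation e \<xi>) = right_creation e (U \<xi>)))"

end

theory Submission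
  imports Defs
begin

text \<open>
  Existence is second quantisation. A unitary \<open>U\<close> of \<open>H\<close> acts on every tensor power, hence by a unitary
  \<open>\<Gamma>\<close> on the Fock space. Conjugation by \<open>\<Gamma>\<close> carries \<open>r\<^sub>\<xi>\<close> to \<open>r\<^sub>U\<^sub>\<xi>\<close>, and it changes the left creation
  operators only by a change of orthonormal basis, which the average in the Markov operator \<open>P\<close> does not see.
  It therefore preserves the harmonic operators and the Choi-Effros product (\<open>Ad_automorphism\<close>).

  Uniqueness says that an automorphism \<open>\<theta>\<close> fixing all \<open>r\<^sub>\<xi>\<close> is the identity (\<open>fixed_identity\<close>). The entries
  of a harmonic operator \<open>x\<close> in the word basis are the vacuum expectations of the operators \<open>r\<^sub>v\<^sup>* x r\<^sub>w\<close>,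
  where \<open>r\<^sub>w\<close> is a product of right creation operators. These are again harmonic, and they are Choi-Effros
  products. So it is enough that \<open>\<theta>\<close> preserves the vacuum state \<open>\<phi>\<close> (\<open>vac_fixed\<close>).

  Since \<open>\<theta>\<close> is not assumed to be continuous, agreement on the algebra generated by the \<open>r\<^sub>\<xi>\<close> does not settle
  this. Instead consider \<open>E x = (1/n) (\<Sum>i. r\<^sub>i\<^sup>* x r\<^sub>i)\<close> (\<open>avg R\<close> below), which commutes with \<open>\<theta>\<close> and leaves \<open>\<phi>\<close> invariant. It is
  mean ergodic: \<open>E\<^sup>k x\<close> tends to the scalar \<open>\<phi> x\<close> in the norm given by \<open>\<phi>\<close> (\<open>mean_ergodic\<close>). For
  \<open>h = E\<^sup>k x - \<phi> x\<close> the number \<open>\<phi> (h \<circ> h)\<close> is thus as small as desired, whereas \<open>\<phi> (\<theta> h) = \<phi> (\<theta> x) - \<phi> x\<close>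
  is the same for all \<open>k\<close>. As \<open>\<bar>\<phi> (\<theta> h)\<bar>\<^sup>2 \<le> \<phi> (\<theta> (h \<circ> h))\<close>, it remains to see that \<open>\<phi> \<circ> \<theta>\<close> is small along a
  bounded sequence of positive elements whose \<open>\<phi>\<close> tends to zero fast.

  Up to adding a small scalar, positive harmonic operators are squares for the Choi-Effros product, so
  automorphisms and their inverses preserve the order, and hence the infimum of a decreasing sequence
  (\<open>auto_preserves_null_sequences\<close>). The sequence of the \<open>h \<circ> h\<close> need not decrease, but it is dominated
  by a decreasing sequence of harmonic operators with small vacuum expectation (\<open>harmonic_majorants\<close>).

  The homomorphism property of \<open>\<Psi>\<close> is a formal consequence of uniqueness, and \<open>\<Psi>\<close> is injective because
  \<open>\<xi>\<close> can be read off from \<open>r\<^sub>\<xi>\<close>.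
\<close>

section \<open>The Hermitian form\<close>

lemma cinner_le_norm: "cmod (cinner f g) \<le> norm f * norm (g :: 'a::complex_inner)"
proof (cases "cinner f g = 0")
  case False
  \<comment> \<open>Rotate \<open>g\<close> so that the form becomes real and the real Cauchy-Schwarz inequality applies.\<close>
  define c where "c = cnj (cinner f g) / complex_of_real (cmod (cinner f g))"
  have "cmod c = 1"
    using False by (simp add: c_def norm_divide)
  have "cinner f (c *\<^sub>C g) = complex_of_real (cmod (cinner f g))"
    using False complex_norm_square[of "cinner f g"]
    by (simp add: c_def cinner_scaleC_right field_simps power2_eq_square)
  then have "cmod (cinner f g) = inner f (c *\<^sub>C g)"
    by (simp add: inner_eq_Re_cinner)
  also have "\<dots> \<le> norm f * norm (c *\<^sub>C g)"
    by (rule norm_cauchy_schwarz)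
  finally show ?thesis
    by (simp add: norm_scaleC \<open>cmod c = 1\<close>)
qed simp

lemma cinner_scaleR_right: "cinner f (a *\<^sub>R g) = a *\<^sub>R cinner f (g :: 'a::complex_inner)"
  by (simp add: scaleC_of_real[symmetric] cinner_scaleC_right scaleR_conv_of_real)

lemma cinner_scaleR_left: "cinner (a *\<^sub>R f) g = a *\<^sub>R cinner f (g :: 'a::complex_inner)"
  by (simp add: scaleC_of_real[symmetric] cinner_scaleC_left scaleR_conv_of_real)

lemma cinner_add_left: "cinner (f + g) h = cinner f h + cinner g (h :: 'a::complex_inner)"
  by (metis cinner_commute cinner_add_right complex_cnj_add)

interpretation cinner: bounded_bilinear "cinner :: 'a::complex_inner \<Rightarrow> 'a \<Rightarrow> complex"
proof
  show "\<exists>K. \<forall>f g :: 'a. norm (cinner f g) \<le> norm f * norm g * K"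
    using cinner_le_norm by (intro exI[of _ 1]) auto
qed (simp_all add: cinner_add_left cinner_add_right cinner_scaleR_left cinner_scaleR_right)

interpretation scaleC: bounded_bilinear "scaleC :: complex \<Rightarrow> 'a::complex_inner \<Rightarrow> 'a"
proof
  show "\<exists>K. \<forall>c (f :: 'a). norm (c *\<^sub>C f) \<le> norm c * norm f * K"
    by (intro exI[of _ 1]) (simp add: norm_scaleC)
  show "(a *\<^sub>R c) *\<^sub>C f = a *\<^sub>R c *\<^sub>C f" for a c and f :: 'a
    by (simp add: scaleC_of_real[symmetric] scaleC_scaleC scaleR_conv_of_real)
qed (simp_all add: scaleC_add_left scaleC_add_right scaleC_scaleR)

lemmas [simp] = cinner.zero_left cinner.zero_right scaleC.zero_left scaleC.zero_right

lemma scaleC_one [simp]: "1 *\<^sub>C f = (f :: 'a::complex_inner)"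
  using scaleC_of_real[of 1 f] by simp

lemma cinner_eqI: "(\<And>h. cinner h f = cinner h g) \<Longrightarrow> f = (g :: 'a::complex_inner)"
  by (metis cinner.diff_right cinner_self eq_iff_diff_eq_0 norm_eq_zero of_real_eq_0_iff
      zero_eq_power2)

lemma cinner_eq_of_inner:
  fixes f f' g g' :: "'a::complex_inner"
  assumes "\<And>c. inner f (c *\<^sub>C g) = inner f' (c *\<^sub>C g')"
  shows "cinner f g = cinner f' g'"
  using assms[of 1] assms[of \<i>] by (simp add: complex_eq_iff inner_eq_Re_cinner cinner_scaleC_right)

section \<open>The word basis of the Fock space\<close>

lemma finite_sums_le_norm: "finite W \<Longrightarrow> (\<Sum>w\<in>W. (cmod (coeff f w))\<^sup>2) \<le> (norm f)\<^sup>2"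
  unfolding norm_fock_square by (intro finite_sum_le_infsum coeff_summable) auto

lemma cmod_coeff_le: "cmod (coeff f w) \<le> norm f"
  by (rule power2_le_imp_le) (use finite_sums_le_norm[of "{w}" f] in simp_all)

lemma coeff_Abs_fock:
  fixes h :: "'n::finite list \<Rightarrow> complex"
  assumes "\<And>W. finite W \<Longrightarrow> (\<Sum>w\<in>W. (cmod (h w))\<^sup>2) \<le> B\<^sup>2"
  shows "coeff (Abs_fock h) = h"
proof -
  have "(\<lambda>w. (cmod (h w))\<^sup>2) summable_on UNIV"
    by (rule nonneg_bdd_above_summable_on) (use assms in \<open>auto intro!: bdd_aboveI2[where M = "B\<^sup>2"]\<close>)
  then show ?thesis
    by (simp add: Abs_fock_inverse)
qed

lemma norm_fock_leI:
  assumes "\<And>W. finite W \<Longrightarrow> (\<Sum>w\<in>W. (cmod (coeff f w))\<^sup>2) \<le> B\<^sup>2" "0 \<le> B"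
  shows "norm f \<le> B"
proof (rule power2_le_imp_le)
  show "(norm f)\<^sup>2 \<le> B\<^sup>2"
    unfolding norm_fock_square by (rule infsum_le_finite_sums[OF coeff_summable]) (use assms in auto)
qed (use assms in auto)

lemma coeff_minus: "coeff (f - g) w = coeff f w - coeff g w"
  unfolding minus_fock_def plus_fock.rep_eq uminus_fock.rep_eq by simp

instance fock :: (finite) banach
proof
  fix X :: "nat \<Rightarrow> 'a fock"
  assume X: "Cauchy X"
  have "Cauchy (\<lambda>n. coeff (X n) w)" for w
  proof (rule metric_CauchyI)
    fix e :: real
    assume "0 < e"
    then obtain M where "\<And>m n. m \<ge> M \<Longrightarrow> n \<ge> M \<Longrightarrow> norm (X m - X n) < e"
      using X unfolding Cauchy_iff by blast
    then show "\<exists>M. \<forall>m\<ge>M. \<forall>n\<ge>M. dist (coeff (X m) w) (coeff (X n) w) < e"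
      using cmod_coeff_le[of "X _ - X _" w] unfolding dist_norm coeff_minus
      by (meson le_less_trans)
  qed
  then obtain g where g: "(\<lambda>n. coeff (X n) w) \<longlonglongrightarrow> g w" for w
    unfolding Cauchy_convergent_iff convergent_def by metis
  \<comment> \<open>Pass to the limit in the finite partial sums of the norm of the difference.\<close>
  have tail: "\<exists>M. \<forall>n\<ge>M. \<forall>W. finite W \<longrightarrow> (\<Sum>w\<in>W. (cmod (coeff (X n) w - g w))\<^sup>2) \<le> e\<^sup>2"
    if "0 < e" for e
  proof -
    obtain M where M: "\<And>m n. m \<ge> M \<Longrightarrow> n \<ge> M \<Longrightarrow> norm (X m - X n) < e"
      using X \<open>0 < e\<close> unfolding Cauchy_iff by blast
    have "(\<Sum>w\<in>W. (cmod (coeff (X n) w - g w))\<^sup>2) \<le> e\<^sup>2" if "finite W" "n \<ge> M" for n W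
    proof (rule tendsto_upperbound)
      show "(\<lambda>m. \<Sum>w\<in>W. (cmod (coeff (X n) w - coeff (X m) w))\<^sup>2)
          \<longlonglongrightarrow> (\<Sum>w\<in>W. (cmod (coeff (X n) w - g w))\<^sup>2)"
        by (intro tendsto_intros g)
      have "(\<Sum>w\<in>W. (cmod (coeff (X n) w - coeff (X m) w))\<^sup>2) \<le> e\<^sup>2" if "m \<ge> M" for m
        using finite_sums_le_norm[OF \<open>finite W\<close>, of "X n - X m"] M[OF \<open>n \<ge> M\<close> that]
          power_mono[of "norm (X n - X m)" e 2] by (simp add: coeff_minus)
      then show "\<forall>\<^sub>F m in sequentially. (\<Sum>w\<in>W. (cmod (coeff (X n) w - coeff (X m) w))\<^sup>2) \<le> e\<^sup>2"
        using eventually_sequentially by blast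
    qed simp
    then show ?thesis
      by blast
  qed
  obtain M1 where M1: "\<And>W. finite W \<Longrightarrow> (\<Sum>w\<in>W. (cmod (coeff (X M1) w - g w))\<^sup>2) \<le> 1\<^sup>2"
    using tail[of 1] by auto
  define h where "h = X M1 - Abs_fock (\<lambda>w. coeff (X M1) w - g w)"
  have h: "coeff h w = g w" for w
    using coeff_Abs_fock[of "\<lambda>w. coeff (X M1) w - g w" 1] M1 by (simp add: h_def coeff_minus)
  have "X \<longlonglongrightarrow> h"
  proof (rule LIMSEQ_I)
    fix e :: real
    assume "0 < e"
    then obtain M where M: "\<And>n W. n \<ge> M \<Longrightarrow> finite W \<Longrightarrow> (\<Sum>w\<in>W. (cmod (coeff (X n) w - g w))\<^sup>2) \<le> (e/2)\<^sup>2"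
      using tail[of "e/2"] by auto
    have "norm (X n - h) \<le> e/2" if "n \<ge> M" for n
      by (rule norm_fock_leI) (use M[OF that] \<open>0 < e\<close> in \<open>auto simp: coeff_minus h\<close>)
    then show "\<exists>M. \<forall>n\<ge>M. norm (X n - h) < e"
      using \<open>0 < e\<close> by (intro exI[of _ M]) fastforce
  qed
  then show "convergent X"
    by (rule convergentI)
qed

definition ket :: "'n::finite list \<Rightarrow> 'n fock" where
  "ket w = Abs_fock (\<lambda>v. if v = w then 1 else 0)"

lemma coeff_ket: "coeff (ket w) v = (if v = w then 1 else 0)"
proof -
  have "(\<Sum>v\<in>W. (cmod (if v = w then 1 else 0))\<^sup>2) \<le> 1\<^sup>2" if "finite W" for W
    using that by (simp add: if_distrib[of cmod] if_distrib[of "\<lambda>x. x\<^sup>2"] cong: if_cong)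
  from coeff_Abs_fock[OF this] show ?thesis
    unfolding ket_def by simp
qed

lemma ket_Nil: "ket [] = \<Omega>"
  by (rule fock_eqI) (simp add: coeff_ket vacuum.rep_eq)

lemma cinner_ket: "cinner (ket w) f = coeff f w"
proof -
  have "((\<lambda>v. cnj (coeff (ket w) v) * coeff f v) has_sum (\<Sum>v\<in>{w}. cnj (coeff (ket w) v) * coeff f v)) UNIV"
    by (rule has_sum_cong_neutral[THEN iffD1, rotated -1, OF has_sum_finite[of "{w}"]])
      (auto simp: coeff_ket)
  then show ?thesis
    unfolding cinner_fock_def by (auto dest!: infsumI simp: coeff_ket)
qed

lemma norm_vacuum [simp]: "norm (\<Omega> :: 'n::finite fock) = 1"
proof -
  have "complex_of_real ((norm (\<Omega> :: 'n fock))\<^sup>2) = 1"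
    unfolding cinner_self[symmetric] by (subst ket_Nil[symmetric], simp only: cinner_ket) (simp add: vacuum.rep_eq)
  then show ?thesis
    by (simp only: of_real_eq_1_iff power2_eq_1_iff) (use norm_ge_zero[of "\<Omega> :: 'n fock"] in linarith)
qed

lemma coeff_sum: "coeff (\<Sum>w\<in>W. F w) v = (\<Sum>w\<in>W. coeff (F w) v)"
  by (simp add: cinner_ket[symmetric] cinner.sum_right)

text \<open>
  The word basis is total. The form of an induction principle lets this be applied to a property of
  vectors without naming a dense subspace. The proof truncates the coefficients to a finite set of words.
\<close>

lemma fock_induct [case_names closed zero add scale ket]:
  assumes closed: "closed {f :: 'n::finite fock. P f}" and zero: "P 0"
    and add: "\<And>f g. P f \<Longrightarrow> P g \<Longrightarrow> P (f + g)" and scale: "\<And>c f. P f \<Longrightarrow> P (c *\<^sub>C f)"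
    and ket: "\<And>w. P (ket w)"
  shows "P f"
proof -
  have fin: "P (\<Sum>w\<in>W. coeff f w *\<^sub>C ket w)" if "finite W" for W
    using that by induction (auto intro: zero add scale ket)
  have "f \<in> closure {g. P g}"
  proof (rule closure_approachable[THEN iffD2], intro allI impI)
    fix e :: real
    assume "0 < e"
    have "((\<lambda>W. \<Sum>w\<in>W. (cmod (coeff f w))\<^sup>2) \<longlongrightarrow> (norm f)\<^sup>2) (finite_subsets_at_top UNIV)"
      using norm_fock_has_sum[of f] unfolding has_sum_def .
    then have "\<forall>\<^sub>F W in finite_subsets_at_top UNIV. dist (\<Sum>w\<in>W. (cmod (coeff f w))\<^sup>2) ((norm f)\<^sup>2) < e\<^sup>2"
      by (rule tendstoD) (use \<open>0 < e\<close> in simp)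
    then obtain W0 where W0: "finite W0" and
      "\<And>W. finite W \<Longrightarrow> W0 \<subseteq> W \<Longrightarrow> dist (\<Sum>w\<in>W. (cmod (coeff f w))\<^sup>2) ((norm f)\<^sup>2) < e\<^sup>2"
      unfolding eventually_finite_subsets_at_top by auto
    then have close: "(norm f)\<^sup>2 - (\<Sum>w\<in>W0. (cmod (coeff f w))\<^sup>2) < e\<^sup>2"
      by (force simp: dist_real_def)
    define g where "g = (\<Sum>w\<in>W0. coeff f w *\<^sub>C ket w)"
    have cg: "coeff g v = (if v \<in> W0 then coeff f v else 0)" for v
      using W0 unfolding g_def coeff_sum
      by (simp add: scaleC_fock.rep_eq coeff_ket if_distrib[of "\<lambda>x. _ * x"] cong: if_cong)
    have "norm (f - g) \<le> sqrt ((norm f)\<^sup>2 - (\<Sum>w\<in>W0. (cmod (coeff f w))\<^sup>2))"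
    proof (rule norm_fock_leI)
      fix W :: "'n list set"
      assume "finite W"
      have "(\<Sum>w\<in>W. (cmod (coeff (f - g) w))\<^sup>2) = (\<Sum>w\<in>W - W0. (cmod (coeff f w))\<^sup>2)"
        using \<open>finite W\<close> by (intro sum.mono_neutral_cong_right) (auto simp: coeff_minus cg)
      also have "\<dots> = (\<Sum>w\<in>(W - W0) \<union> W0. (cmod (coeff f w))\<^sup>2) - (\<Sum>w\<in>W0. (cmod (coeff f w))\<^sup>2)"
        using \<open>finite W\<close> W0 by (subst sum.union_disjoint) auto
      also have "\<dots> \<le> (norm f)\<^sup>2 - (\<Sum>w\<in>W0. (cmod (coeff f w))\<^sup>2)"
        using finite_sums_le_norm[of "(W - W0) \<union> W0" f] \<open>finite W\<close> W0 by simp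
      finally show "(\<Sum>w\<in>W. (cmod (coeff (f - g) w))\<^sup>2)
          \<le> (sqrt ((norm f)\<^sup>2 - (\<Sum>w\<in>W0. (cmod (coeff f w))\<^sup>2)))\<^sup>2"
        using finite_sums_le_norm[OF W0, of f] by simp
    qed (use finite_sums_le_norm[OF W0, of f] in simp)
    also have "\<dots> < e"
      using close \<open>0 < e\<close> by (intro real_less_lsqrt) auto
    finally show "\<exists>g\<in>{g. P g}. dist g f < e"
      using fin[OF W0] by (auto simp: dist_norm norm_minus_commute g_def)
  qed
  with closed show ?thesis
    by simp
qed

section \<open>The algebra of bounded operators\<close>

lemma cbounded_opsD: "x \<in> cbounded_ops \<Longrightarrow> x (c *\<^sub>C f) = c *\<^sub>C x f"
  by (simp add: cbounded_ops_def)

lemma cbounded_zero [simp, intro]: "0 \<in> cbounded_ops"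
  by (simp add: cbounded_ops_def)

lemma cbounded_id [simp, intro]: "id_blinfun \<in> cbounded_ops"
  by (simp add: cbounded_ops_def)

lemma cbounded_add [intro]: "x \<in> cbounded_ops \<Longrightarrow> y \<in> cbounded_ops \<Longrightarrow> x + y \<in> cbounded_ops"
  by (simp add: cbounded_ops_def blinfun.add_left scaleC.add_right)

lemma cbounded_diff [intro]: "x \<in> cbounded_ops \<Longrightarrow> y \<in> cbounded_ops \<Longrightarrow> x - y \<in> cbounded_ops"
  by (simp add: cbounded_ops_def blinfun.diff_left scaleC.diff_right)

lemma cbounded_scaleR [intro]: "x \<in> cbounded_ops \<Longrightarrow> a *\<^sub>R x \<in> cbounded_ops"
  by (simp add: cbounded_ops_def blinfun.scaleR_left scaleC.scaleR_right)

lemma cbounded_scaleC [intro]: "x \<in> cbounded_ops \<Longrightarrow> op_scaleC c x \<in> cbounded_ops"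
  by (simp add: cbounded_ops_def scaleC_scaleC mult.commute)

lemma cbounded_compose [intro]: "x \<in> cbounded_ops \<Longrightarrow> y \<in> cbounded_ops \<Longrightarrow> x o\<^sub>L y \<in> cbounded_ops"
  by (simp add: cbounded_ops_def)

lemma cbounded_sum [intro]: "(\<And>i. i \<in> A \<Longrightarrow> F i \<in> cbounded_ops) \<Longrightarrow> (\<Sum>i\<in>A. F i) \<in> cbounded_ops"
  by (induction A rule: infinite_finite_induct) auto

lemma cbounded_limit:
  fixes x :: "'a::complex_inner \<Rightarrow>\<^sub>L 'a"
  assumes "\<And>k. X k \<in> cbounded_ops" "\<And>f. (\<lambda>k. blinfun_apply (X k) f) \<longlonglongrightarrow> x f"
  shows "x \<in> cbounded_ops"
  unfolding cbounded_ops_def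
proof (rule CollectI, intro allI)
  fix c f
  have "(\<lambda>k. X k (c *\<^sub>C f)) \<longlonglongrightarrow> c *\<^sub>C x f"
    unfolding cbounded_opsD[OF assms(1)] by (intro scaleC.tendsto tendsto_const assms(2))
  with assms(2) show "x (c *\<^sub>C f) = c *\<^sub>C x f"
    by (rule LIMSEQ_unique)
qed

lemma blinfun_eq_on_words:
  assumes "x \<in> cbounded_ops" "y \<in> cbounded_ops" "\<And>w. x (ket w) = y (ket w)"
  shows "x = y"
proof (rule blinfun_eqI)
  fix f
  show "x f = y f"
  proof (induction f rule: fock_induct)
    case closed
    show ?case by (intro closed_Collect_eq continuous_intros)
  qed (use assms in \<open>simp_all add: blinfun.add_right cbounded_opsD\<close>)
qed

lemma blinfun_cinner_eqI:
  fixes x y :: "'a::complex_inner \<Rightarrow>\<^sub>L 'b::complex_inner"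
  shows "(\<And>f g. cinner f (x g) = cinner f (y g)) \<Longrightarrow> x = y"
  by (intro blinfun_eqI cinner_eqI)

lemma op_scaleC_one [simp]: "op_scaleC 1 x = x"
  by (rule blinfun_eqI) simp

lemma op_scaleC_zero [simp]: "op_scaleC 0 x = 0"
  by (rule blinfun_eqI) simp

lemma norm_op_scaleC: "norm (op_scaleC c x) \<le> cmod c * norm x"
proof (rule norm_blinfun_bound)
  fix f
  have "norm (x f) \<le> norm x * norm f"
    by (rule norm_blinfun)
  then show "norm (op_scaleC c x f) \<le> cmod c * norm x * norm f"
    by (simp add: norm_scaleC mult_left_mono mult.assoc)
qed simp

lemma tendsto_op_scaleC:
  assumes "X \<longlonglongrightarrow> x"
  shows "(\<lambda>k. op_scaleC c (X k)) \<longlonglongrightarrow> op_scaleC c x"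
proof -
  have lim: "(\<lambda>k. cmod c * norm (X k - x)) \<longlonglongrightarrow> cmod c * 0"
    by (intro tendsto_mult tendsto_const tendsto_norm_zero LIM_zero assms)
  have le: "norm (op_scaleC c (X k) - op_scaleC c x) \<le> cmod c * norm (X k - x)" for k
  proof -
    have "op_scaleC c (X k) - op_scaleC c x = op_scaleC c (X k - x)"
      by (rule blinfun_eqI) (simp add: blinfun.diff_left scaleC.diff_right)
    then show ?thesis
      using norm_op_scaleC by simp
  qed
  have "(\<lambda>k. op_scaleC c (X k) - op_scaleC c x) \<longlonglongrightarrow> 0"
    by (rule Lim_null_comparison[OF always_eventually[OF allI[OF le]]]) (use lim in simp)
  then show ?thesis
    by (rule LIM_zero_cancel)
qed

lemma op_scaleC_of_real: "op_scaleC (complex_of_real t) x = t *\<^sub>R x"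
  by (rule blinfun_eqI) (simp add: blinfun.scaleR_left scaleC_of_real)

lemma compose_id_blinfun [simp]: "x o\<^sub>L id_blinfun = x" "id_blinfun o\<^sub>L x = x"
  by (auto intro: blinfun_eqI)

lemma compose_assoc_blinfun: "(x o\<^sub>L y) o\<^sub>L z = x o\<^sub>L (y o\<^sub>L z)"
  by (rule blinfun_eqI) simp

lemma closed_cbounded_ops: "closed (cbounded_ops :: ('a::complex_inner \<Rightarrow>\<^sub>L 'a) set)"
  unfolding closed_sequential_limits
proof (intro allI impI, elim conjE)
  fix X :: "nat \<Rightarrow> 'a \<Rightarrow>\<^sub>L 'a" and l
  assume X: "\<forall>k. X k \<in> cbounded_ops" "X \<longlonglongrightarrow> l"
  show "l \<in> cbounded_ops"
    by (rule cbounded_limit[of X]) (use X in \<open>auto intro: blinfun.tendsto tendsto_const\<close>)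
qed

lemma norm_blinfun_boundI:
  fixes x :: "'a::complex_inner \<Rightarrow>\<^sub>L 'a"
  assumes "0 \<le> B" "\<And>f g. cmod (cinner f (x g)) \<le> B * norm f * norm g"
  shows "norm x \<le> B"
proof (rule norm_blinfun_bound[OF assms(1)])
  fix g
  have "(norm (x g))\<^sup>2 \<le> B * norm (x g) * norm g"
    using assms(2)[of "x g" g] by (simp add: cinner_self norm_power)
  then show "norm (x g) \<le> B * norm g"
    by (cases "x g = 0") (use assms(1) in \<open>auto simp: power2_eq_square\<close>)
qed

text \<open>
  The adjoint of \<open>x\<close> exists because its word coefficients are prescribed: they have to be
  \<open>\<langle>x w, f\<rangle>\<close>, and testing against the truncations of this family shows that it is square summable.
\<close>

lemma adjoint_exists:
  fixes x :: "'n::finite fock \<Rightarrow>\<^sub>L 'n fock"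
  assumes x: "x \<in> cbounded_ops"
  shows "\<exists>y. \<forall>f g. cinner (blinfun_apply y f) g = cinner f (x g)"
proof -
  have bound: "(\<Sum>w\<in>W. (cmod (cinner (x (ket w)) f))\<^sup>2) \<le> (norm x * norm f)\<^sup>2" if "finite W" for f W
  proof -
    define g where "g = (\<Sum>w\<in>W. cinner (x (ket w)) f *\<^sub>C ket w)"
    define S where "S = (\<Sum>w\<in>W. (cmod (cinner (x (ket w)) f))\<^sup>2)"
    have "0 \<le> S"
      by (simp add: S_def sum_nonneg)
    have cg: "coeff g v = (if v \<in> W then cinner (x (ket v)) f else 0)" for v
      using that unfolding g_def coeff_sum
      by (simp add: scaleC_fock.rep_eq coeff_ket if_distrib[of "\<lambda>x. _ * x"] cong: if_cong)
    have conj: "cnj z * z = complex_of_real ((cmod z)\<^sup>2)" for z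
      by (subst mult.commute) (rule complex_norm_square[symmetric])
    have "norm g \<le> sqrt S"
    proof (rule norm_fock_leI)
      fix V :: "'n list set"
      assume "finite V"
      have "(\<Sum>v\<in>V. (cmod (coeff g v))\<^sup>2) = (\<Sum>w\<in>V \<inter> W. (cmod (cinner (x (ket w)) f))\<^sup>2)"
        using \<open>finite V\<close> by (intro sum.mono_neutral_cong_right) (auto simp: cg)
      also have "\<dots> \<le> S"
        unfolding S_def by (rule sum_mono2) (use that in auto)
      finally show "(\<Sum>v\<in>V. (cmod (coeff g v))\<^sup>2) \<le> (sqrt S)\<^sup>2"
        using \<open>0 \<le> S\<close> by simp
    qed (use \<open>0 \<le> S\<close> in simp)
    have "cinner (x g) f = (\<Sum>w\<in>W. cnj (cinner (x (ket w)) f) * cinner (x (ket w)) f)"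
      unfolding g_def by (simp add: blinfun.sum_right cinner.sum_left cbounded_opsD[OF x] cinner_scaleC_left)
    then have "cinner (x g) f = complex_of_real S"
      by (simp only: conj S_def of_real_sum)
    then have "S = cmod (cinner (x g) f)"
      using \<open>0 \<le> S\<close> by simp
    also have "\<dots> \<le> norm (x g) * norm f"
      by (rule cinner_le_norm)
    also have "\<dots> \<le> (norm x * norm g) * norm f"
      by (intro mult_right_mono norm_blinfun) auto
    also have "\<dots> \<le> (norm x * sqrt S) * norm f"
      using \<open>norm g \<le> sqrt S\<close> by (intro mult_right_mono mult_left_mono) auto
    finally have "sqrt S * sqrt S \<le> (norm x * norm f) * sqrt S"
      using \<open>0 \<le> S\<close> by (simp add: mult_ac)
    then have "sqrt S \<le> norm x * norm f"
      using \<open>0 \<le> S\<close> by (cases "S = 0") (auto intro: mult_right_le_imp_le[of _ "sqrt S"])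
    then have "(sqrt S)\<^sup>2 \<le> (norm x * norm f)\<^sup>2"
      by (rule power_mono) (use \<open>0 \<le> S\<close> in simp)
    then show ?thesis
      using \<open>0 \<le> S\<close> by (simp add: S_def)
  qed
  define y where "y f = Abs_fock (\<lambda>w. cinner (x (ket w)) f)" for f
  have cy: "coeff (y f) w = cinner (x (ket w)) f" for f w
    unfolding y_def by (subst coeff_Abs_fock[OF bound]) auto
  have "bounded_linear y"
  proof (rule bounded_linear_intro)
    show "norm (y f) \<le> norm f * norm x" for f
      by (rule norm_fock_leI) (use bound[of _ f] in \<open>auto simp: cy mult.commute\<close>)
  qed (rule fock_eqI, simp add: cy plus_fock.rep_eq scaleR_fock_def scaleC_fock.rep_eq
      cinner.add_right cinner_scaleC_right)+
  then have ap: "blinfun_apply (Blinfun y) = y"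
    by (rule bounded_linear_Blinfun_apply)
  have "cinner (y f) g = cinner f (x g)" for f g
  proof (induction g rule: fock_induct)
    case closed
    show ?case by (intro closed_Collect_eq cinner.continuous_on continuous_intros)
  next
    case (ket w)
    show ?case by (subst cinner_commute) (simp add: cinner_ket cy flip: cinner_commute)
  qed (use x in \<open>simp_all add: cinner.add_right blinfun.add_right cbounded_opsD cinner_scaleC_right\<close>)
  then show ?thesis
    by (intro exI[of _ "Blinfun y"]) (simp add: ap)
qed

lemma adj_eqI:
  fixes x :: "'a::complex_inner \<Rightarrow>\<^sub>L 'a"
  assumes "\<And>f g. cinner (blinfun_apply y f) g = cinner f (x g)"
  shows "adj x = y"
  unfolding adj_def
proof (rule the_equality)
  fix z
  assume z: "\<forall>f g. cinner (blinfun_apply z f) g = cinner f (x g)"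
  show "z = y"
    by (rule blinfun_cinner_eqI) (metis z assms cinner_commute)
qed (use assms in blast)

lemma cinner_adj_left:
  "x \<in> cbounded_ops \<Longrightarrow> cinner (adj x f) g = cinner f (x g)"
  for x :: "'n::finite fock \<Rightarrow>\<^sub>L 'n fock"
  using adjoint_exists[of x] adj_eqI by metis

lemma cinner_adj_right:
  "x \<in> cbounded_ops \<Longrightarrow> cinner f (adj x g) = cinner (x f) g"
  for x :: "'n::finite fock \<Rightarrow>\<^sub>L 'n fock"
  by (metis cinner_adj_left cinner_commute)

lemma cbounded_adj [intro]: "x \<in> cbounded_ops \<Longrightarrow> adj x \<in> cbounded_ops"
  for x :: "'n::finite fock \<Rightarrow>\<^sub>L 'n fock"
  unfolding cbounded_ops_def[of] mem_Collect_eq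
  by (intro allI cinner_eqI) (simp add: cinner_adj_right cinner_scaleC_right cbounded_ops_def)

lemma adj_adj [simp]: "x \<in> cbounded_ops \<Longrightarrow> adj (adj x) = x"
  for x :: "'n::finite fock \<Rightarrow>\<^sub>L 'n fock"
  by (rule adj_eqI) (simp add: cinner_adj_right)

lemma adj_id [simp]: "adj id_blinfun = id_blinfun"
  by (rule adj_eqI) simp

lemma adj_add: "x \<in> cbounded_ops \<Longrightarrow> y \<in> cbounded_ops \<Longrightarrow> adj (x + y) = adj x + adj y"
  for x y :: "'n::finite fock \<Rightarrow>\<^sub>L 'n fock"
  by (rule adj_eqI) (simp add: blinfun.add_left cinner.add_left cinner.add_right cinner_adj_left)

lemma adj_diff: "x \<in> cbounded_ops \<Longrightarrow> y \<in> cbounded_ops \<Longrightarrow> adj (x - y) = adj x - adj y"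
  for x y :: "'n::finite fock \<Rightarrow>\<^sub>L 'n fock"
  by (rule adj_eqI) (simp add: blinfun.diff_left cinner.diff_left cinner.diff_right cinner_adj_left)

lemma adj_scaleC: "x \<in> cbounded_ops \<Longrightarrow> adj (op_scaleC c x) = op_scaleC (cnj c) (adj x)"
  for x :: "'n::finite fock \<Rightarrow>\<^sub>L 'n fock"
  by (rule adj_eqI) (simp add: cinner_scaleC_left cinner_scaleC_right cinner_adj_left)

lemma adj_scaleR: "x \<in> cbounded_ops \<Longrightarrow> adj (a *\<^sub>R x) = a *\<^sub>R adj x"
  for x :: "'n::finite fock \<Rightarrow>\<^sub>L 'n fock"
  by (rule adj_eqI) (simp add: blinfun.scaleR_left cinner.scaleR_left cinner.scaleR_right cinner_adj_left)

lemma adj_compose: "x \<in> cbounded_ops \<Longrightarrow> y \<in> cbounded_ops \<Longrightarrow> adj (x o\<^sub>L y) = adj y o\<^sub>L adj x"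
  for x y :: "'n::finite fock \<Rightarrow>\<^sub>L 'n fock"
  by (rule adj_eqI) (simp add: cinner_adj_left)

lemma norm_adj_le: "x \<in> cbounded_ops \<Longrightarrow> norm (adj x) \<le> norm x"
  for x :: "'n::finite fock \<Rightarrow>\<^sub>L 'n fock"
proof (rule norm_blinfun_boundI)
  fix f g
  assume x: "x \<in> cbounded_ops"
  have "cmod (cinner (x f) g) \<le> norm (x f) * norm g"
    by (rule cinner_le_norm)
  also have "\<dots> \<le> norm x * norm f * norm g"
    by (intro mult_right_mono norm_blinfun) auto
  finally show "cmod (cinner f (adj x g)) \<le> norm x * norm f * norm g"
    by (simp add: cinner_adj_right[OF x])
qed simp

lemma norm_adj [simp]: "x \<in> cbounded_ops \<Longrightarrow> norm (adj x) = norm x"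
  for x :: "'n::finite fock \<Rightarrow>\<^sub>L 'n fock"
  using norm_adj_le[of x] norm_adj_le[of "adj x"] by (simp add: cbounded_adj order_antisym)

section \<open>Quadratic forms and monotone limits of operators\<close>

definition selfadj :: "('n::finite fock \<Rightarrow>\<^sub>L 'n fock) \<Rightarrow> bool" where
  "selfadj x \<longleftrightarrow> x \<in> cbounded_ops \<and> adj x = x"

definition qform :: "('n::finite fock \<Rightarrow>\<^sub>L 'n fock) \<Rightarrow> 'n fock \<Rightarrow> real" where
  "qform x f = inner f (x f)"

definition pos_op :: "('n::finite fock \<Rightarrow>\<^sub>L 'n fock) \<Rightarrow> bool" where
  "pos_op x \<longleftrightarrow> selfadj x \<and> (\<forall>f. 0 \<le> qform x f)"

lemma selfadj_cinner: "selfadj x \<Longrightarrow> cinner (x f) g = cinner f (x g)"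
  unfolding selfadj_def by (metis cinner_adj_left)

lemma selfadj_inner: "selfadj x \<Longrightarrow> inner (x f) g = inner f (x g)"
  by (simp add: inner_eq_Re_cinner selfadj_cinner)

lemma selfadjI:
  "x \<in> cbounded_ops \<Longrightarrow> (\<And>f g. cinner (blinfun_apply x f) g = cinner f (x g)) \<Longrightarrow> selfadj x"
  unfolding selfadj_def by (auto intro: adj_eqI)

lemma selfadj_cbounded [intro]: "selfadj x \<Longrightarrow> x \<in> cbounded_ops"
  by (simp add: selfadj_def)

lemma selfadj_id [simp, intro]: "selfadj id_blinfun"
  by (simp add: selfadj_def)

lemma selfadj_zero [simp, intro]: "selfadj 0"
  by (rule selfadjI) auto

lemma selfadj_add [intro]: "selfadj x \<Longrightarrow> selfadj y \<Longrightarrow> selfadj (x + y)"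
  by (auto simp: selfadj_def adj_add)

lemma selfadj_diff [intro]: "selfadj x \<Longrightarrow> selfadj y \<Longrightarrow> selfadj (x - y)"
  by (auto simp: selfadj_def adj_diff)

lemma selfadj_scaleR [intro]: "selfadj x \<Longrightarrow> selfadj (a *\<^sub>R x)"
  by (auto simp: selfadj_def adj_scaleR)

lemma selfadj_sum [intro]: "(\<And>i. i \<in> A \<Longrightarrow> selfadj (F i)) \<Longrightarrow> selfadj (\<Sum>i\<in>A. F i)"
  by (induction A rule: infinite_finite_induct) auto

lemma selfadj_limit:
  assumes "\<And>k. selfadj (X k)" "\<And>f. (\<lambda>k. blinfun_apply (X k) f) \<longlonglongrightarrow> blinfun_apply x f"
  shows "selfadj x"
proof (rule selfadjI)
  show "x \<in> cbounded_ops"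
    by (rule cbounded_limit[OF _ assms(2)]) (use assms(1) in auto)
  fix f g
  have "(\<lambda>k. cinner (X k f) g) \<longlonglongrightarrow> cinner f (x g)"
    unfolding selfadj_cinner[OF assms(1)] by (intro cinner.tendsto tendsto_const assms)
  moreover have "(\<lambda>k. cinner (X k f) g) \<longlonglongrightarrow> cinner (x f) g"
    by (intro cinner.tendsto tendsto_const assms)
  ultimately show "cinner (x f) g = cinner f (x g)"
    by (rule LIMSEQ_unique[THEN sym])
qed

lemma qform_id [simp]: "qform id_blinfun f = (norm f)\<^sup>2"
  by (simp add: qform_def power2_norm_eq_inner)

lemma qform_zero [simp]: "qform 0 f = 0"
  by (simp add: qform_def)

lemma qform_add: "qform (x + y) f = qform x f + qform y f"
  by (simp add: qform_def blinfun.add_left inner_add_right)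

lemma qform_diff: "qform (x - y) f = qform x f - qform y f"
  by (simp add: qform_def blinfun.diff_left inner_diff_right)

lemma qform_scaleR: "qform (a *\<^sub>R x) f = a * qform x f"
  by (simp add: qform_def blinfun.scaleR_left)

lemma qform_sum: "qform (\<Sum>i\<in>A. F i) f = (\<Sum>i\<in>A. qform (F i) f)"
  by (simp add: qform_def blinfun.sum_left inner_sum_right)

lemma tendsto_qform:
  "(\<And>f. (\<lambda>k. blinfun_apply (X k) f) \<longlonglongrightarrow> blinfun_apply x f) \<Longrightarrow> (\<lambda>k. qform (X k) f) \<longlonglongrightarrow> qform x f"
  unfolding qform_def by (intro tendsto_inner tendsto_const)

lemma cinner_selfadj: "selfadj x \<Longrightarrow> cinner f (x f) = complex_of_real (qform x f)"
  using cinner_commute[of f "x f"] selfadj_cinner[of x f f]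
  by (simp add: qform_def inner_eq_Re_cinner complex_eq_iff)

lemma abs_qform_le: "\<bar>qform x f\<bar> \<le> norm x * (norm f)\<^sup>2"
proof -
  have "\<bar>qform x f\<bar> \<le> norm f * norm (x f)"
    unfolding qform_def by (rule Cauchy_Schwarz_ineq2)
  also have "\<dots> \<le> norm f * (norm x * norm f)"
    by (intro mult_left_mono norm_blinfun) auto
  finally show ?thesis
    by (simp add: power2_eq_square mult_ac)
qed

lemma pos_opD: "pos_op x \<Longrightarrow> selfadj x" "pos_op x \<Longrightarrow> 0 \<le> qform x f"
  by (auto simp: pos_op_def)

lemma qform_square: "x \<in> cbounded_ops \<Longrightarrow> qform (adj x o\<^sub>L x) f = (norm (x f))\<^sup>2"
  by (simp add: qform_def inner_eq_Re_cinner cinner_adj_right cinner_self)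

lemma selfadj_square: "x \<in> cbounded_ops \<Longrightarrow> selfadj (adj x o\<^sub>L x)"
  by (auto simp: selfadj_def adj_compose cbounded_adj)

lemma qform_plus_scaleR:
  assumes "selfadj x"
  shows "qform x (f + t *\<^sub>R g) = qform x f + 2 * t * inner (x f) g + t\<^sup>2 * qform x g"
  using selfadj_inner[OF assms, of f g] inner_commute[of "x f" g]
  by (simp add: qform_def blinfun.add_right blinfun.scaleR_right inner_add_left inner_add_right
      power2_eq_square algebra_simps)

lemma pos_op_Cauchy_Schwarz:
  assumes "pos_op x"
  shows "(inner (x f) g)\<^sup>2 \<le> qform x f * qform x g"
proof -
  note ge = pos_opD(2)[OF assms, of "f + _ *\<^sub>R g", unfolded qform_plus_scaleR[OF pos_opD(1)[OF assms]]]
  define a b c where "a = qform x f" and "b = inner (x f) g" and "c = qform x g"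
  have ge: "0 \<le> a + 2 * t * b + t\<^sup>2 * c" for t
    using ge[of t] by (simp add: a_def b_def c_def)
  have "0 \<le> c"
    using pos_opD(2)[OF assms] by (simp add: c_def)
  show ?thesis
  proof (cases "c = 0")
    case True
    have "b = 0"
    proof (rule ccontr)
      assume "b \<noteq> 0"
      then show False
        using ge[of "- (a + 1) / (2 * b)"] True by (simp add: field_simps)
    qed
    then show ?thesis
      using True by (simp add: b_def c_def)
  next
    case False
    then have "0 \<le> c * (a + 2 * (- b / c) * b + (- b / c)\<^sup>2 * c)"
      by (intro mult_nonneg_nonneg \<open>0 \<le> c\<close> ge)
    also have "\<dots> = a * c - b\<^sup>2"
      using False by (simp add: field_simps power2_eq_square)
    finally show ?thesis
      by (simp add: a_def b_def c_def)
  qed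
qed

text \<open>
  For a positive operator below \<open>B\<close>, smallness of the quadratic form at a vector forces smallness
  of the operator there: this upgrades weak convergence of monotone sequences to strong convergence.
\<close>

lemma pos_op_norm_le_qform:
  assumes "pos_op x" and B: "\<And>f. qform x f \<le> B * (norm f)\<^sup>2"
  shows "(norm (x f))\<^sup>2 \<le> B * qform x f"
proof (cases "x f = 0")
  case True
  then show ?thesis
    by (simp add: qform_def)
next
  case False
  have "((norm (x f))\<^sup>2)\<^sup>2 \<le> qform x f * qform x (x f)"
    using pos_op_Cauchy_Schwarz[OF assms(1), of f "x f"] by (simp add: power2_norm_eq_inner)
  also have "\<dots> \<le> qform x f * (B * (norm (x f))\<^sup>2)"
    by (intro mult_left_mono B pos_opD(2)[OF assms(1)])
  finally have "(norm (x f))\<^sup>2 * (norm (x f))\<^sup>2 \<le> (B * qform x f) * (norm (x f))\<^sup>2"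
    by (simp add: power2_eq_square mult_ac)
  then show ?thesis
    by (rule mult_right_le_imp_le) (use False in simp)
qed

lemma pos_op_norm_le:
  assumes "pos_op x" and B: "\<And>f. qform x f \<le> B * (norm f)\<^sup>2" and "0 \<le> B"
  shows "norm x \<le> B"
proof (rule norm_blinfun_bound[OF \<open>0 \<le> B\<close>])
  fix f
  have "(norm (x f))\<^sup>2 \<le> B * qform x f"
    by (rule pos_op_norm_le_qform[OF assms(1) B])
  also have "\<dots> \<le> B * (B * (norm f)\<^sup>2)"
    by (intro mult_left_mono B \<open>0 \<le> B\<close>)
  finally have "(norm (x f))\<^sup>2 \<le> (B * norm f)\<^sup>2"
    by (simp add: power2_eq_square mult_ac)
  then show "norm (x f) \<le> B * norm f"
    by (rule power2_le_imp_le) (use \<open>0 \<le> B\<close> in simp)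
qed

lemma pos_op_eq_0: "pos_op x \<Longrightarrow> qform x f = 0 \<Longrightarrow> x f = 0"
  using pos_op_norm_le_qform[of x "norm x" f] abs_qform_le[of x] by (force simp: abs_le_iff)

lemma pointwise_limit_blinfun:
  fixes X :: "nat \<Rightarrow> 'a::real_normed_vector \<Rightarrow>\<^sub>L 'b::real_normed_vector"
  assumes conv: "\<And>f. convergent (\<lambda>k. X k f)" and B: "\<And>k. norm (X k) \<le> B"
  obtains x where "\<And>f. (\<lambda>k. X k f) \<longlonglongrightarrow> blinfun_apply x f" "norm x \<le> B"
proof -
  define z where "z f = lim (\<lambda>k. X k f)" for f
  have lim: "(\<lambda>k. X k f) \<longlonglongrightarrow> z f" for f
    using conv[of f] unfolding z_def by (simp add: convergent_LIMSEQ_iff)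
  have "0 \<le> B"
    using B[of 0] norm_ge_zero order_trans by blast
  have bd: "norm (z f) \<le> B * norm f" for f
  proof (rule tendsto_upperbound[OF tendsto_norm[OF lim]])
    show "\<forall>\<^sub>F k in sequentially. norm (X k f) \<le> B * norm f"
      using norm_blinfun[of "X _" f] B by (intro always_eventually allI)
        (meson mult_right_mono norm_ge_zero order_trans)
  qed simp
  have "bounded_linear z"
  proof (rule bounded_linear_intro)
    show "z (f + g) = z f + z g" for f g
      using tendsto_add[OF lim[of f] lim[of g]] lim[of "f + g"]
      by (simp add: blinfun.add_right LIMSEQ_unique)
    show "z (a *\<^sub>R f) = a *\<^sub>R z f" for a f
      using tendsto_scaleR[OF tendsto_const lim[of f], of a] lim[of "a *\<^sub>R f"]
      by (simp add: blinfun.scaleR_right LIMSEQ_unique)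
    show "norm (z f) \<le> norm f * B" for f
      using bd[of f] by (simp add: mult.commute)
  qed
  then have ap: "blinfun_apply (Blinfun z) = z"
    by (rule bounded_linear_Blinfun_apply)
  show ?thesis
    by (rule that[of "Blinfun z"]) (use lim bd norm_blinfun_bound[OF \<open>0 \<le> B\<close>, of "Blinfun z"] in \<open>auto simp: ap\<close>)
qed

text \<open>
  Monotone convergence: bounded increasing sequences of self-adjoint operators converge strongly. The
  forms converge because they are monotone, and by the preceding estimate the differences of the
  operators are controlled by the differences of the forms.
\<close>

lemma incseq_operators_converge:
  fixes X :: "nat \<Rightarrow> 'n::finite fock \<Rightarrow>\<^sub>L 'n fock"
  assumes sa: "\<And>k. selfadj (X k)" and inc: "\<And>k f. qform (X k) f \<le> qform (X (Suc k)) f"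
    and B: "\<And>k f. qform (X k) f \<le> B * (norm f)\<^sup>2"
  obtains x where "selfadj x" "\<And>f. (\<lambda>k. X k f) \<longlonglongrightarrow> blinfun_apply x f"
    "\<And>f k. qform (X k) f \<le> qform x f"
proof -
  have mono: "qform (X m) f \<le> qform (X k) f" if "m \<le> k" for m k f
    using lift_Suc_mono_le[of "\<lambda>k. qform (X k) f"] inc that by blast
  define C where "C = \<bar>B\<bar> + norm (X 0)"
  have "0 \<le> C"
    by (simp add: C_def)
  have pos: "pos_op (X k - X m)" if "m \<le> k" for m k
    unfolding pos_op_def using mono[OF that] sa by (auto simp: qform_diff)
  have bd: "qform (X k - X m) f \<le> C * (norm f)\<^sup>2" if "m \<le> k" for m k f
  proof -
    have "qform (X k) f \<le> \<bar>B\<bar> * (norm f)\<^sup>2"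
      using B[of k f] by (rule order_trans) (intro mult_right_mono, auto)
    moreover have "qform (X m) f \<ge> - (norm (X 0) * (norm f)\<^sup>2)"
      using mono[of 0 m f] abs_qform_le[of "X 0" f] by simp
    ultimately show ?thesis
      by (simp add: qform_diff C_def algebra_simps)
  qed
  have conv: "convergent (\<lambda>k. X k f)" for f
  proof -
    have "incseq (\<lambda>k. qform (X k) f)"
      using inc by (intro incseq_SucI)
    then have "convergent (\<lambda>k. qform (X k) f)"
      using incseq_convergent[of "\<lambda>k. qform (X k) f" "B * (norm f)\<^sup>2"] B convergentI by metis
    then have q: "Cauchy (\<lambda>k. qform (X k) f)"
      by (simp add: Cauchy_convergent_iff)
    have "Cauchy (\<lambda>k. X k f)"
    proof (rule CauchyI')
      fix e :: real
      assume "0 < e"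
      then have "0 < e\<^sup>2 / (C + 1)"
        using \<open>0 \<le> C\<close> by simp
      then obtain M where M: "\<And>m n. m \<ge> M \<Longrightarrow> n \<ge> M \<Longrightarrow> norm (qform (X m) f - qform (X n) f) < e\<^sup>2 / (C + 1)"
        using q unfolding Cauchy_iff by metis
      have "norm (X m f - X n f) < e" if "m \<ge> M" "m < n" for m n
      proof -
        have "(norm ((X n - X m) f))\<^sup>2 \<le> C * qform (X n - X m) f"
          by (rule pos_op_norm_le_qform[OF pos bd]) (use that in auto)
        also have "\<dots> \<le> C * (e\<^sup>2 / (C + 1))"
          using M[of n m] that \<open>0 \<le> C\<close> by (intro mult_left_mono) (auto simp: qform_diff)
        also have "\<dots> < e\<^sup>2"
          using \<open>0 \<le> C\<close> \<open>0 < e\<close> by (simp add: field_simps)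
        finally show ?thesis
          using \<open>0 < e\<close> by (simp add: blinfun.diff_left norm_minus_commute power2_less_imp_less)
      qed
      then show "\<exists>M. \<forall>m\<ge>M. \<forall>n>m. dist (X m f) (X n f) < e"
        unfolding dist_norm by blast
    qed
    then show ?thesis
      by (rule Cauchy_convergent)
  qed
  have "norm (X k) \<le> C + norm (X 0)" for k
    using pos_op_norm_le[OF pos[of 0 k] bd \<open>0 \<le> C\<close>] norm_triangle_sub[of "X k" "X 0"] by simp
  from pointwise_limit_blinfun[OF conv this]
  obtain x where x: "\<And>f. (\<lambda>k. X k f) \<longlonglongrightarrow> blinfun_apply x f"
    by metis
  show ?thesis
  proof (rule that[OF selfadj_limit[OF sa x] x])
    show "qform (X k) f \<le> qform x f" for f k
      by (rule tendsto_lowerbound[OF tendsto_qform[OF x]])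
        (use mono in \<open>auto intro: eventually_sequentiallyI[of k]\<close>)
  qed
qed

lemma decseq_operators_converge:
  fixes X :: "nat \<Rightarrow> 'n::finite fock \<Rightarrow>\<^sub>L 'n fock"
  assumes sa: "\<And>k. selfadj (X k)" and dec: "\<And>k f. qform (X (Suc k)) f \<le> qform (X k) f"
    and nonneg: "\<And>k f. 0 \<le> qform (X k) f"
  obtains x where "pos_op x" "\<And>f. (\<lambda>k. X k f) \<longlonglongrightarrow> blinfun_apply x f"
    "\<And>f k. qform x f \<le> qform (X k) f"
proof -
  have neg: "selfadj (- y)" "qform (- y) f = - qform y f" if "selfadj y" for y f
    using selfadj_diff[of 0 y] qform_diff[of 0 y f] that by auto
  show ?thesis
  proof (rule incseq_operators_converge[of "\<lambda>k. - X k" 0])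
    show "qform (- X k) f \<le> qform (- X (Suc k)) f" "qform (- X k) f \<le> 0 * (norm f)\<^sup>2" for k f
      using dec nonneg by (simp_all add: neg[OF sa])
    fix y
    assume y: "selfadj y" "\<And>f. (\<lambda>k. (- X k) f) \<longlonglongrightarrow> blinfun_apply y f"
      "\<And>f k. qform (- X k) f \<le> qform y f"
    have lim: "(\<lambda>k. X k f) \<longlonglongrightarrow> blinfun_apply (- y) f" for f
      using tendsto_minus[OF y(2)[of f]] by (simp add: blinfun.minus_left)
    have "0 \<le> qform (- y) f" for f
      by (rule tendsto_lowerbound[OF tendsto_qform[OF lim]]) (use nonneg in auto)
    moreover have "qform (- y) f \<le> qform (X k) f" for f k
      using y(3)[of k f] by (simp add: neg[OF sa] neg[OF y(1)])
    ultimately show thesis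
      using that[of "- y"] lim neg(1)[OF y(1)] unfolding pos_op_def by blast
  qed (rule neg(1)[OF sa])
qed

section \<open>Averaging over a family of isometries\<close>

text \<open>
  For the left creation operators this is the Markov operator. The right creation operators give a
  second average, which commutes with the first one.
\<close>

definition avg :: "('i::finite \<Rightarrow> 'n::finite fock \<Rightarrow>\<^sub>L 'n fock) \<Rightarrow> ('n fock \<Rightarrow>\<^sub>L 'n fock) \<Rightarrow> 'n fock \<Rightarrow>\<^sub>L 'n fock"
  where "avg a x = (1 / real CARD('i)) *\<^sub>R (\<Sum>i\<in>UNIV. adj (a i) o\<^sub>L x o\<^sub>L a i)"

definition isometries :: "('i \<Rightarrow> 'n::finite fock \<Rightarrow>\<^sub>L 'n fock) \<Rightarrow> bool" where
  "isometries a \<longleftrightarrow> (\<forall>i. a i \<in> cbounded_ops \<and> (\<forall>f g. cinner (a i f) (a i g) = cinner f g))"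

lemma isometries_cbounded: "isometries a \<Longrightarrow> a i \<in> cbounded_ops"
  by (simp add: isometries_def)

lemma isometries_norm: "isometries a \<Longrightarrow> norm (a i f) = norm f"
  by (simp add: isometries_def norm_eq_sqrt_inner inner_eq_Re_cinner)

lemma norm_adj_isometry_le:
  assumes "isometries a"
  shows "norm (adj (a i) f) \<le> norm f"
proof -
  have "norm (a i) \<le> 1"
    by (rule norm_blinfun_bound) (simp_all add: isometries_norm[OF assms])
  then have "norm (adj (a i)) \<le> 1"
    by (simp add: isometries_cbounded[OF assms])
  then show ?thesis
    by (meson norm_blinfun order_trans mult_left_le_one_le norm_ge_zero)
qed

context
  fixes a :: "'i::finite \<Rightarrow> 'n::finite fock \<Rightarrow>\<^sub>L 'n fock"
  assumes a: "isometries a"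
begin

lemma cinner_avg:
  "cinner f (avg a x g) = complex_of_real (1 / real CARD('i)) * (\<Sum>i\<in>UNIV. cinner (a i f) (x (a i g)))"
  by (simp add: avg_def blinfun.scaleR_left blinfun.sum_left cinner.scaleR_right cinner.sum_right
      cinner_adj_right[OF isometries_cbounded[OF a]] scaleR_conv_of_real)

lemma qform_avg: "qform (avg a x) f = (\<Sum>i\<in>UNIV. qform x (a i f)) / real CARD('i)"
  by (simp add: qform_def inner_eq_Re_cinner cinner_avg)

lemma avg_cbounded [intro]: "x \<in> cbounded_ops \<Longrightarrow> avg a x \<in> cbounded_ops"
  unfolding avg_def by (intro cbounded_scaleR cbounded_sum cbounded_compose cbounded_adj
      isometries_cbounded[OF a])

lemma avg_add: "avg a (x + y) = avg a x + avg a y"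
  by (rule blinfun_cinner_eqI)
    (simp add: cinner_avg blinfun.add_left cinner.add_right sum.distrib distrib_left)

lemma avg_diff: "avg a (x - y) = avg a x - avg a y"
  by (rule blinfun_cinner_eqI)
    (simp add: cinner_avg blinfun.diff_left cinner.diff_right sum_subtractf right_diff_distrib)

lemma avg_scaleR: "avg a (t *\<^sub>R x) = t *\<^sub>R avg a x"
  by (rule blinfun_cinner_eqI)
    (simp add: cinner_avg blinfun.scaleR_left cinner.scaleR_right scaleR_sum_right[symmetric])

lemma avg_scaleC: "avg a (op_scaleC c x) = op_scaleC c (avg a x)"
  by (rule blinfun_cinner_eqI)
    (simp add: cinner_avg cinner_scaleC_right sum_distrib_left[symmetric])

lemma avg_id [simp]: "avg a id_blinfun = id_blinfun"
  using a by (intro blinfun_cinner_eqI) (simp add: cinner_avg isometries_def)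

lemma avg_sum: "avg a (\<Sum>j\<in>J. F j) = (\<Sum>j\<in>J. avg a (F j))"
proof (induction J rule: infinite_finite_induct)
  case empty
  show ?case using avg_diff[of 0 0] by simp
next
  case (infinite J)
  show ?case using avg_diff[of 0 0] infinite by simp
qed (simp add: avg_add)

lemma adj_avg: "x \<in> cbounded_ops \<Longrightarrow> adj (avg a x) = avg a (adj x)"
proof (rule adj_eqI)
  fix f g
  assume x: "x \<in> cbounded_ops"
  have "cinner (avg a (adj x) f) g = cnj (cinner g (avg a (adj x) f))"
    by (rule cinner_commute)
  also have "\<dots> = cinner f (avg a x g)"
    by (simp add: cinner_avg cinner_adj_right[OF x] cinner_commute[symmetric])
  finally show "cinner (avg a (adj x) f) g = cinner f (avg a x g)" .
qed

lemma avg_selfadj [intro]: "selfadj x \<Longrightarrow> selfadj (avg a x)"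
  by (auto simp: selfadj_def adj_avg)

lemma avg_compose_right:
  assumes "\<And>i f. a i (blinfun_apply b f) = b (a i f)"
  shows "avg a (x o\<^sub>L b) = avg a x o\<^sub>L b"
  by (rule blinfun_cinner_eqI) (simp add: cinner_avg assms)

lemma avg_compose_left:
  assumes "b \<in> cbounded_ops" "\<And>i f. a i (blinfun_apply b f) = b (a i f)"
  shows "avg a (adj b o\<^sub>L x) = adj b o\<^sub>L avg a x"
  by (rule blinfun_cinner_eqI) (simp add: cinner_avg cinner_adj_right assms)

lemma tendsto_avg:
  assumes "\<And>f. ((\<lambda>k. blinfun_apply (X k) f) \<longlongrightarrow> blinfun_apply x f) F"
  shows "((\<lambda>k. avg a (X k) f) \<longlongrightarrow> avg a x f) F"
  unfolding avg_def by (simp add: blinfun.scaleR_left blinfun.sum_left)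
    (intro tendsto_intros blinfun.tendsto assms)

lemma norm_avg_le: "norm (avg a x) \<le> norm x"
proof (rule norm_blinfun_boundI)
  fix f g
  have "cmod (cinner (a i f) (x (a i g))) \<le> norm x * norm f * norm g" for i
  proof -
    have "cmod (cinner (a i f) (x (a i g))) \<le> norm f * norm (x (a i g))"
      using cinner_le_norm[of "a i f" "x (a i g)"] by (simp add: isometries_norm[OF a])
    also have "\<dots> \<le> norm f * (norm x * norm g)"
      using norm_blinfun[of x "a i g"] by (intro mult_left_mono) (simp_all add: isometries_norm[OF a])
    finally show ?thesis
      by (simp add: mult_ac)
  qed
  then have "cmod (\<Sum>i\<in>UNIV. cinner (a i f) (x (a i g))) \<le> (\<Sum>i\<in>(UNIV :: 'i set). norm x * norm f * norm g)"
    by (intro sum_norm_le)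
  then show "cmod (cinner f (avg a x g)) \<le> norm x * norm f * norm g"
    by (simp add: cinner_avg norm_divide field_simps)
qed simp

text \<open>
  The Kadison-Schwarz inequality \<open>(A x)\<^sup>* (A x) \<le> A (x\<^sup>* x)\<close> for \<open>A = avg a\<close>, as an inequality of forms.
\<close>

lemma avg_Schwarz: "(norm (avg a x f))\<^sup>2 \<le> (\<Sum>i\<in>UNIV. (norm (x (a i f)))\<^sup>2) / real CARD('i)"
proof -
  let ?n = "real CARD('i)"
  have "norm (avg a x f) \<le> (\<Sum>i\<in>UNIV. norm (x (a i f))) / ?n"
  proof -
    have "avg a x f = (1 / ?n) *\<^sub>R (\<Sum>i\<in>UNIV. adj (a i) (x (a i f)))"
      by (simp add: avg_def blinfun.scaleR_left blinfun.sum_left)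
    then have "norm (avg a x f) = norm (\<Sum>i\<in>UNIV. adj (a i) (x (a i f))) / ?n"
      by simp
    also have "\<dots> \<le> (\<Sum>i\<in>UNIV. norm (x (a i f))) / ?n"
      by (intro divide_right_mono sum_norm_le norm_adj_isometry_le[OF a]) simp
    finally show ?thesis .
  qed
  then have "(norm (avg a x f))\<^sup>2 \<le> ((\<Sum>i\<in>UNIV. norm (x (a i f))) / ?n)\<^sup>2"
    by (rule power_mono) simp
  also have "\<dots> \<le> (?n * (\<Sum>i\<in>UNIV. (norm (x (a i f)))\<^sup>2)) / ?n\<^sup>2"
    using sum_squared_le_sum_of_squares[of "\<lambda>i. norm (x (a i f))" UNIV]
    unfolding power_divide by (intro divide_right_mono) (auto simp: mult.commute)
  finally show ?thesis
    by (simp add: power2_eq_square)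
qed

lemma avg_mono: "(\<And>f. qform x f \<le> qform y f) \<Longrightarrow> qform (avg a x) f \<le> qform (avg a y) f"
  unfolding qform_avg by (intro divide_right_mono sum_mono) auto

lemma avg_pow_mono: "(\<And>f. qform x f \<le> qform y f) \<Longrightarrow> qform ((avg a ^^ k) x) f \<le> qform ((avg a ^^ k) y) f"
  by (induction k arbitrary: f) (auto intro: avg_mono)

lemma avg_pow_add: "(avg a ^^ k) (x + y) = (avg a ^^ k) x + (avg a ^^ k) y"
  by (induction k) (auto simp: avg_add)

lemma avg_pow_diff: "(avg a ^^ k) (x - y) = (avg a ^^ k) x - (avg a ^^ k) y"
  by (induction k) (auto simp: avg_diff)

lemma avg_pow_scaleR: "(avg a ^^ k) (t *\<^sub>R x) = t *\<^sub>R (avg a ^^ k) x"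
  by (induction k) (auto simp: avg_scaleR)

lemma avg_pow_scaleC: "(avg a ^^ k) (op_scaleC c x) = op_scaleC c ((avg a ^^ k) x)"
  by (induction k) (auto simp: avg_scaleC)

lemma avg_pow_id [simp]: "(avg a ^^ k) id_blinfun = id_blinfun"
  by (induction k) auto

lemma avg_pow_sum: "(avg a ^^ k) (\<Sum>j\<in>J. F j) = (\<Sum>j\<in>J. (avg a ^^ k) (F j))"
  by (induction k) (auto simp: avg_sum)

lemma avg_pow_fixed: "avg a x = x \<Longrightarrow> (avg a ^^ k) x = x"
  by (induction k) auto

lemma avg_pow_cbounded [intro]: "x \<in> cbounded_ops \<Longrightarrow> (avg a ^^ k) x \<in> cbounded_ops"
  by (induction k) auto

lemma avg_pow_selfadj [intro]: "selfadj x \<Longrightarrow> selfadj ((avg a ^^ k) x)"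
  by (induction k) auto

lemma adj_avg_pow: "x \<in> cbounded_ops \<Longrightarrow> adj ((avg a ^^ k) x) = (avg a ^^ k) (adj x)"
  by (induction k) (auto simp: adj_avg avg_pow_cbounded)

lemma norm_avg_pow_le: "norm ((avg a ^^ k) x) \<le> norm x"
  by (induction k) (auto intro: order_trans[OF norm_avg_le])

end

lemma avg_commute:
  assumes a: "isometries a" and b: "isometries b" and ab: "\<And>i j f. blinfun_apply (a i) (b j f) = blinfun_apply (b j) (a i f)"
  shows "avg a (avg b x) = avg b (avg a x)"
proof (rule blinfun_cinner_eqI)
  fix f g
  have "(\<Sum>i\<in>UNIV. \<Sum>j\<in>UNIV. cinner (b j (a i f)) (x (b j (a i g))))
      = (\<Sum>j\<in>UNIV. \<Sum>i\<in>UNIV. cinner (a i (b j f)) (x (a i (b j g))))"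
    unfolding ab by (rule sum.swap)
  then show "cinner f (avg a (avg b x) g) = cinner f (avg b (avg a x) g)"
    by (simp add: cinner_avg[OF a] cinner_avg[OF b] sum_divide_distrib[symmetric] divide_divide_eq_left
        mult.commute)
qed

section \<open>Creation operators and harmonic operators\<close>

lemma limitin_strong_operator_topology:
  fixes X :: "'i \<Rightarrow> 'a::real_normed_vector \<Rightarrow>\<^sub>L 'b::real_normed_vector"
  shows "limitin strong_operator_topology X x F \<longleftrightarrow> (\<forall>f. ((\<lambda>k. X k f) \<longlongrightarrow> x f) F)"
proof
  assume "limitin strong_operator_topology X x F"
  then have "limitin euclidean ((\<lambda>y. blinfun_apply y f) \<circ> X) (blinfun_apply x f) F" for f
    by (rule continuous_map_limit[OF strong_operator_topology_continuous_evaluation])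
  then show "\<forall>f. ((\<lambda>k. X k f) \<longlongrightarrow> x f) F"
    by (simp add: comp_def)
next
  assume "\<forall>f. ((\<lambda>k. X k f) \<longlongrightarrow> x f) F"
  then have "limitin (product_topology (\<lambda>_. euclidean) UNIV) (\<lambda>k. blinfun_apply (X k)) (blinfun_apply x) F"
    by (simp add: limitin_componentwise)
  then have "limitin euclidean (\<lambda>k. blinfun_apply (X k)) (blinfun_apply x) F"
    by (simp only: euclidean_product_topology)
  then show "limitin strong_operator_topology X x F"
    unfolding limitin_def strong_operator_topology_topspace
    by (auto simp: strong_operator_topology_def openin_pullback_topology)
qed

lemma cinner_tensor_right:
  assumes "orthonormal_basis e"
  shows "cinner (tensor_right e f \<xi>) (tensor_right e g \<zeta>) = cinner \<xi> \<zeta> * cinner f g"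
proof -
  have "((\<lambda>w. cnj (coeff (tensor_right e f \<xi>) w) * coeff (tensor_right e g \<zeta>) w) has_sum
      (\<Sum>i\<in>UNIV. cnj (cinner (e i) \<xi>) * cinner (e i) \<zeta>) * cinner f g) UNIV"
    unfolding cinner_fock_def
    by (rule has_sum_branches[where \<phi> = "\<lambda>i v. v @ [i]", OF _ _ _ has_sum_infsum])
      (auto simp: tensor_right.rep_eq coeff_mult_summable, metis append_butlast_last_id)
  then show ?thesis
    unfolding cinner_expansion[OF assms, of \<xi> \<zeta>] cinner_fock_def[of "tensor_right e f \<xi>"]
    by (rule infsumI)
qed

lemma cbounded_left_creation [intro]: "left_creation e \<xi> \<in> cbounded_ops"
  by (auto intro!: fock_eqI simp: cbounded_ops_def left_creation_apply tensor_left.rep_eq scaleC_fock.rep_eq split: list.split)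

lemma cbounded_right_creation [intro]: "right_creation e \<xi> \<in> cbounded_ops"
  by (auto intro!: fock_eqI simp: cbounded_ops_def right_creation_apply tensor_right.rep_eq scaleC_fock.rep_eq)

lemma left_right_creation_commute:
  "left_creation e \<xi> (right_creation e \<zeta> f) = right_creation e \<zeta> (left_creation e \<xi> f)"
proof (rule fock_eqI)
  fix w
  show "coeff (left_creation e \<xi> (right_creation e \<zeta> f)) w = coeff (right_creation e \<zeta> (left_creation e \<xi> f)) w"
    by (cases w) (auto simp: left_creation_apply right_creation_apply tensor_left.rep_eq
        tensor_right.rep_eq split: list.split)
qed

lemma right_creation_vacuum: "right_creation e \<xi> \<Omega> = left_creation e \<xi> \<Omega>"
  using left_creation_simple_tensor[of e \<xi> "[]"] right_creation_simple_tensor[of e \<xi> "[]"]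
  by (simp add: simple_tensor_Nil)

locale fock_basis =
  fixes e :: "'n::finite \<Rightarrow> 'h::complex_inner"
  assumes onb: "orthonormal_basis e" and dim: "CARD('n) > 1"
begin

abbreviation L :: "'n \<Rightarrow> 'n fock \<Rightarrow>\<^sub>L 'n fock" where "L i \<equiv> left_creation e (e i)"
abbreviation R :: "'n \<Rightarrow> 'n fock \<Rightarrow>\<^sub>L 'n fock" where "R i \<equiv> right_creation e (e i)"
abbreviation M :: "('n fock \<Rightarrow>\<^sub>L 'n fock) set" where "M \<equiv> H_infty e"
abbreviation choi :: "('n fock \<Rightarrow>\<^sub>L 'n fock) \<Rightarrow> ('n fock \<Rightarrow>\<^sub>L 'n fock) \<Rightarrow> 'n fock \<Rightarrow>\<^sub>L 'n fock" (infixl "\<odot>" 70)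
  where "x \<odot> y \<equiv> choi_effros e x y"
abbreviation vac :: "('n fock \<Rightarrow>\<^sub>L 'n fock) \<Rightarrow> complex" where "vac x \<equiv> cinner \<Omega> (x \<Omega>)"

lemma cinner_basis: "cinner (e i) (e j) = (if i = j then 1 else 0)"
  using onb by (simp add: orthonormal_basis_def)

lemma markov_eq: "markov e = avg L"
  by (rule ext) (simp add: markov_def avg_def)

lemma isometries_L: "isometries L"
  by (auto simp: isometries_def left_creation_apply cinner_tensor_left[OF onb] cinner_basis)

lemma isometries_R: "isometries R"
  by (auto simp: isometries_def right_creation_apply cinner_tensor_right[OF onb] cinner_basis)

lemma adj_right_creation_right_creation:
  "adj (right_creation e \<xi>) (right_creation e \<zeta> f) = cinner \<xi> \<zeta> *\<^sub>C f"
  by (rule cinner_eqI)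
    (simp add: cinner_adj_right[OF cbounded_right_creation] right_creation_apply
      cinner_tensor_right[OF onb] cinner_scaleC_right)

lemma M_iff: "x \<in> M \<longleftrightarrow> x \<in> cbounded_ops \<and> avg L x = x"
  by (simp add: H_infty_def markov_eq)

lemma M_cbounded: "x \<in> M \<Longrightarrow> x \<in> cbounded_ops"
  by (simp add: M_iff)

lemma M_avg: "x \<in> M \<Longrightarrow> avg L x = x"
  by (simp add: M_iff)

lemma M_id [simp, intro]: "id_blinfun \<in> M"
  by (simp add: M_iff avg_id[OF isometries_L])

lemma M_add [intro]: "x \<in> M \<Longrightarrow> y \<in> M \<Longrightarrow> x + y \<in> M"
  by (auto simp: M_iff avg_add[OF isometries_L])

lemma M_diff [intro]: "x \<in> M \<Longrightarrow> y \<in> M \<Longrightarrow> x - y \<in> M"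
  by (auto simp: M_iff avg_diff[OF isometries_L])

lemma M_zero [simp, intro]: "0 \<in> M"
  using M_diff[OF M_id M_id] by simp

lemma M_scaleR [intro]: "x \<in> M \<Longrightarrow> t *\<^sub>R x \<in> M"
  by (auto simp: M_iff avg_scaleR[OF isometries_L])

lemma M_scaleC [intro]: "x \<in> M \<Longrightarrow> op_scaleC c x \<in> M"
  by (auto simp: M_iff avg_scaleC[OF isometries_L])

lemma M_sum [intro]: "(\<And>i. i \<in> A \<Longrightarrow> F i \<in> M) \<Longrightarrow> (\<Sum>i\<in>A. F i) \<in> M"
  by (induction A rule: infinite_finite_induct) auto

lemma M_adj [intro]: "x \<in> M \<Longrightarrow> adj x \<in> M"
  by (auto simp: M_iff adj_avg[OF isometries_L, symmetric])

lemma M_limit: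
  assumes "\<And>k. X k \<in> M" "\<And>f. (\<lambda>k. blinfun_apply (X k) f) \<longlonglongrightarrow> blinfun_apply x f"
  shows "x \<in> M"
proof -
  have "avg L x = x"
  proof (rule blinfun_eqI)
    fix f
    have "(\<lambda>k. avg L (X k) f) \<longlonglongrightarrow> avg L x f"
      by (rule tendsto_avg[OF isometries_L assms(2)])
    then show "avg L x f = x f"
      using assms by (simp add: M_avg LIMSEQ_unique)
  qed
  moreover have "x \<in> cbounded_ops"
    by (rule cbounded_limit[OF _ assms(2)]) (use assms(1) in \<open>auto dest: M_cbounded\<close>)
  ultimately show ?thesis
    by (simp add: M_iff)
qed

text \<open>
  Right creation operators commute with all left creation operators. Hence the harmonic operators
  form a right module over them, and a left module over their adjoints.
\<close>

lemma M_right_creation [intro]: "x \<in> M \<Longrightarrow> x o\<^sub>L right_creation e \<xi> \<in> M"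
  by (auto simp: M_iff avg_compose_right[OF isometries_L left_right_creation_commute])

lemma M_adj_right_creation [intro]: "x \<in> M \<Longrightarrow> adj (right_creation e \<xi>) o\<^sub>L x \<in> M"
  by (auto simp: M_iff cbounded_adj avg_compose_left[OF isometries_L cbounded_right_creation left_right_creation_commute])

lemma right_creation_in_M [intro]: "right_creation e \<xi> \<in> M"
  using M_right_creation[OF M_id, of \<xi>] by simp

lemma avg_LR_commute: "avg L (avg R x) = avg R (avg L x)"
  by (rule avg_commute[OF isometries_L isometries_R left_right_creation_commute])

lemma M_avg_R [intro]: "x \<in> M \<Longrightarrow> avg R x \<in> M"
  by (auto simp: M_iff avg_LR_commute avg_cbounded[OF isometries_R])

lemma M_avg_R_pow [intro]: "x \<in> M \<Longrightarrow> (avg R ^^ k) x \<in> M"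
  by (induction k) auto

text \<open>
  The two averages agree in the vacuum state, since left and right creation agree on the vacuum.
\<close>

lemma vac_avg: "vac (avg R x) = vac (avg L x)"
  by (simp add: cinner_avg[OF isometries_L] cinner_avg[OF isometries_R] right_creation_vacuum)

lemma vac_avg_R: "x \<in> M \<Longrightarrow> vac (avg R x) = vac x"
  by (simp add: vac_avg M_avg)

lemma vac_avg_R_pow: "x \<in> M \<Longrightarrow> vac ((avg R ^^ k) x) = vac x"
  by (induction k) (auto simp: vac_avg_R M_avg_R_pow)

section \<open>The Choi-Effros product\<close>

text \<open>
  For harmonic \<open>x\<close> the Kadison-Schwarz inequality reads \<open>x\<^sup>* x \<le> P (x\<^sup>* x)\<close>. So the Markov iterates of
  \<open>x\<^sup>* x\<close> increase, and they converge strongly. Polarization extends this to all products.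
\<close>

lemma markov_square_increasing:
  assumes "x \<in> M"
  shows "qform ((avg L ^^ k) (adj x o\<^sub>L x)) f \<le> qform ((avg L ^^ Suc k) (adj x o\<^sub>L x)) f"
proof -
  note x = M_cbounded[OF assms]
  have "qform (adj x o\<^sub>L x) f \<le> qform (avg L (adj x o\<^sub>L x)) f" for f
    using avg_Schwarz[OF isometries_L, of x f] unfolding qform_avg[OF isometries_L] qform_square[OF x] M_avg[OF assms] .
  from avg_pow_mono[OF isometries_L this] show ?thesis
    by (simp only: funpow_Suc_right comp_def)
qed

lemma markov_square_converges:
  assumes "x \<in> M"
  obtains z where "selfadj z" "\<And>f. (\<lambda>k. (avg L ^^ k) (adj x o\<^sub>L x) f) \<longlonglongrightarrow> blinfun_apply z f"
    "\<And>f k. qform ((avg L ^^ k) (adj x o\<^sub>L x)) f \<le> qform z f"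
proof (rule incseq_operators_converge[of "\<lambda>k. (avg L ^^ k) (adj x o\<^sub>L x)" "norm (adj x o\<^sub>L x)"])
  fix k f
  have "qform ((avg L ^^ k) (adj x o\<^sub>L x)) f \<le> norm ((avg L ^^ k) (adj x o\<^sub>L x)) * (norm f)\<^sup>2"
    using abs_qform_le[of "(avg L ^^ k) (adj x o\<^sub>L x)" f] by simp
  also have "\<dots> \<le> norm (adj x o\<^sub>L x) * (norm f)\<^sup>2"
    by (intro mult_right_mono norm_avg_pow_le[OF isometries_L]) simp
  finally show "qform ((avg L ^^ k) (adj x o\<^sub>L x)) f \<le> norm (adj x o\<^sub>L x) * (norm f)\<^sup>2" .
qed (use that assms in \<open>auto intro!: markov_square_increasing[simplified] avg_pow_selfadj[OF isometries_L] selfadj_square M_cbounded\<close>)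

lemma polarization:
  fixes x y :: "'n fock \<Rightarrow>\<^sub>L 'n fock"
  assumes "x \<in> cbounded_ops" "y \<in> cbounded_ops"
  shows "op_scaleC 4 (x o\<^sub>L y) = (\<Sum>c\<leftarrow>[1, \<i>, -1, -\<i>]. op_scaleC (cnj c)
           (adj (adj x + op_scaleC c y) o\<^sub>L (adj x + op_scaleC c y)))"
proof (rule blinfun_cinner_eqI)
  fix f g
  have adj: "adj (adj x + op_scaleC c y) = x + op_scaleC (cnj c) (adj y)" for c
    using assms by (simp add: adj_add adj_scaleC cbounded_adj cbounded_scaleC)
  show "cinner f (op_scaleC 4 (x o\<^sub>L y) g) = cinner f ((\<Sum>c\<leftarrow>[1, \<i>, -1, -\<i>]. op_scaleC (cnj c)
           (adj (adj x + op_scaleC c y) o\<^sub>L (adj x + op_scaleC c y))) g)"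
    unfolding adj using assms
    by (simp add: blinfun.add_left blinfun.add_right cinner.add_right cinner_scaleC_right
        cbounded_opsD cbounded_adj scaleC.add_right scaleC_scaleC algebra_simps)
qed

lemma choi_exists:
  assumes "x \<in> M" "y \<in> M"
  obtains z where "\<And>f. (\<lambda>k. (avg L ^^ k) (x o\<^sub>L y) f) \<longlonglongrightarrow> blinfun_apply z f"
proof -
  define s where "s c = adj x + op_scaleC c y" for c
  have "\<exists>z. \<forall>f. (\<lambda>k. (avg L ^^ k) (adj (s c) o\<^sub>L s c) f) \<longlonglongrightarrow> blinfun_apply z f" for c
    using assms by (metis markov_square_converges[of "s c"] s_def M_add M_adj M_scaleC)
  then obtain z where z: "\<And>c f. (\<lambda>k. (avg L ^^ k) (adj (s c) o\<^sub>L s c) f) \<longlonglongrightarrow> blinfun_apply (z c) f"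
    by metis
  have "x o\<^sub>L y = op_scaleC (1/4) (op_scaleC 4 (x o\<^sub>L y))"
    by (rule blinfun_eqI) (simp add: scaleC_scaleC)
  also have "\<dots> = op_scaleC (1/4) (\<Sum>c\<leftarrow>[1, \<i>, -1, -\<i>]. op_scaleC (cnj c) (adj (s c) o\<^sub>L s c))"
    using assms by (subst polarization) (auto simp: s_def M_cbounded)
  finally have eq: "x o\<^sub>L y = op_scaleC (1/4) (\<Sum>c\<leftarrow>[1, \<i>, -1, -\<i>]. op_scaleC (cnj c) (adj (s c) o\<^sub>L s c))" .
  show ?thesis
  proof (rule that[of "op_scaleC (1/4) (\<Sum>c\<leftarrow>[1, \<i>, -1, -\<i>]. op_scaleC (cnj c) (z c))"])
    show "(\<lambda>k. (avg L ^^ k) (x o\<^sub>L y) f)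
        \<longlonglongrightarrow> op_scaleC (1/4) (\<Sum>c\<leftarrow>[1, \<i>, -1, -\<i>]. op_scaleC (cnj c) (z c)) f" for f
      unfolding eq
      by (simp add: avg_pow_scaleC[OF isometries_L] avg_pow_add[OF isometries_L] blinfun.add_left)
        (intro tendsto_add scaleC.tendsto tendsto_const z)
  qed
qed

lemma choi_eqI:
  assumes "\<And>f. (\<lambda>k. (avg L ^^ k) (x o\<^sub>L y) f) \<longlonglongrightarrow> blinfun_apply z f"
  shows "x \<odot> y = z"
  unfolding choi_effros_def limitin_strong_operator_topology markov_eq
proof (rule the_equality)
  show "z' = z" if "\<forall>f. (\<lambda>k. (avg L ^^ k) (x o\<^sub>L y) f) \<longlonglongrightarrow> blinfun_apply z' f" for z'
    using that assms by (intro blinfun_eqI) (blast intro: LIMSEQ_unique)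
qed (use assms in blast)

lemma choi_tendsto:
  assumes "x \<in> M" "y \<in> M"
  shows "(\<lambda>k. (avg L ^^ k) (x o\<^sub>L y) f) \<longlonglongrightarrow> (x \<odot> y) f"
  using choi_exists[OF assms] choi_eqI by metis

lemma markov_limit_in_M:
  assumes x: "x \<in> cbounded_ops" and lim: "\<And>f. (\<lambda>k. (avg L ^^ k) x f) \<longlonglongrightarrow> blinfun_apply z f"
  shows "z \<in> M"
proof -
  have "z \<in> cbounded_ops"
    by (rule cbounded_limit[OF _ lim]) (rule avg_pow_cbounded[OF isometries_L x])
  moreover have "avg L z = z"
  proof (rule blinfun_eqI)
    fix f
    have "(\<lambda>k. (avg L ^^ Suc k) x f) \<longlonglongrightarrow> avg L z f"
      using tendsto_avg[OF isometries_L lim, of f] by simp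
    then show "avg L z f = z f"
      using LIMSEQ_Suc[OF lim[of f]] by (rule LIMSEQ_unique)
  qed
  ultimately show ?thesis
    by (simp add: M_iff)
qed

lemma choi_in_M [intro]: "x \<in> M \<Longrightarrow> y \<in> M \<Longrightarrow> x \<odot> y \<in> M"
  by (rule markov_limit_in_M[OF cbounded_compose choi_tendsto]) (auto dest: M_cbounded)

lemma choi_eq_compose: "x o\<^sub>L y \<in> M \<Longrightarrow> x \<odot> y = x o\<^sub>L y"
  by (rule choi_eqI) (simp add: avg_pow_fixed[OF isometries_L] M_avg)

lemma choi_id_left: "x \<in> M \<Longrightarrow> id_blinfun \<odot> x = x"
  using choi_eq_compose[of id_blinfun x] by simp

lemma choi_id_right: "x \<in> M \<Longrightarrow> x \<odot> id_blinfun = x"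
  using choi_eq_compose[of x id_blinfun] by simp

lemma choi_add_left:
  assumes x: "x \<in> M" and y: "y \<in> M" and z: "z \<in> M"
  shows "(x + y) \<odot> z = x \<odot> z + y \<odot> z"
proof (rule choi_eqI)
  have "(x + y) o\<^sub>L z = (x o\<^sub>L z) + (y o\<^sub>L z)"
    by (rule blinfun_eqI) (simp add: blinfun.add_left)
  then show "(\<lambda>k. (avg L ^^ k) ((x + y) o\<^sub>L z) f) \<longlonglongrightarrow> (x \<odot> z + y \<odot> z) f" for f
    using tendsto_add[OF choi_tendsto[OF x z] choi_tendsto[OF y z]]
    by (simp add: avg_pow_add[OF isometries_L] blinfun.add_left)
qed

lemma choi_add_right:
  assumes x: "x \<in> M" and y: "y \<in> M" and z: "z \<in> M"
  shows "z \<odot> (x + y) = z \<odot> x + z \<odot> y"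
proof (rule choi_eqI)
  have "z o\<^sub>L (x + y) = (z o\<^sub>L x) + (z o\<^sub>L y)"
    by (rule blinfun_eqI) (simp add: blinfun.add_left blinfun.add_right)
  then show "(\<lambda>k. (avg L ^^ k) (z o\<^sub>L (x + y)) f) \<longlonglongrightarrow> (z \<odot> x + z \<odot> y) f" for f
    using tendsto_add[OF choi_tendsto[OF z x] choi_tendsto[OF z y]]
    by (simp add: avg_pow_add[OF isometries_L] blinfun.add_left)
qed

lemma choi_scaleR_left:
  assumes x: "x \<in> M" and z: "z \<in> M"
  shows "(t *\<^sub>R x) \<odot> z = t *\<^sub>R (x \<odot> z)"
proof (rule choi_eqI)
  have "(t *\<^sub>R x) o\<^sub>L z = t *\<^sub>R (x o\<^sub>L z)"
    by (rule blinfun_eqI) (simp add: blinfun.scaleR_left)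
  then show "(\<lambda>k. (avg L ^^ k) ((t *\<^sub>R x) o\<^sub>L z) f) \<longlonglongrightarrow> (t *\<^sub>R (x \<odot> z)) f" for f
    using tendsto_scaleR[OF tendsto_const choi_tendsto[OF x z], of t]
    by (simp add: avg_pow_scaleR[OF isometries_L] blinfun.scaleR_left)
qed

lemma choi_scaleR_right:
  assumes x: "x \<in> M" and z: "z \<in> M"
  shows "z \<odot> (t *\<^sub>R x) = t *\<^sub>R (z \<odot> x)"
proof (rule choi_eqI)
  have "z o\<^sub>L (t *\<^sub>R x) = t *\<^sub>R (z o\<^sub>L x)"
    by (rule blinfun_eqI) (simp add: blinfun.scaleR_left blinfun.scaleR_right)
  then show "(\<lambda>k. (avg L ^^ k) (z o\<^sub>L (t *\<^sub>R x)) f) \<longlonglongrightarrow> (t *\<^sub>R (z \<odot> x)) f" for f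
    using tendsto_scaleR[OF tendsto_const choi_tendsto[OF z x], of t]
    by (simp add: avg_pow_scaleR[OF isometries_L] blinfun.scaleR_left)
qed

lemma norm_choi_le:
  assumes x: "x \<in> M" and y: "y \<in> M"
  shows "norm (x \<odot> y) \<le> norm x * norm y"
proof (rule norm_blinfun_bound)
  fix f
  have "norm ((avg L ^^ k) (x o\<^sub>L y) f) \<le> norm x * norm y * norm f" for k
  proof -
    have "norm ((avg L ^^ k) (x o\<^sub>L y)) \<le> norm x * norm y"
      using norm_avg_pow_le[OF isometries_L] norm_blinfun_compose[of x y] order_trans by blast
    then show ?thesis
      by (meson norm_blinfun order_trans mult_right_mono norm_ge_zero)
  qed
  then show "norm ((x \<odot> y) f) \<le> norm x * norm y * norm f"
    by (intro tendsto_upperbound[OF tendsto_norm[OF choi_tendsto[OF x y]]]) auto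
qed simp

text \<open>
  The Choi-Effros square dominates the operator square because the Markov iterates increase.
\<close>

lemma markov_square_le_choi:
  assumes x: "x \<in> M"
  shows "qform ((avg L ^^ k) (adj x o\<^sub>L x)) f \<le> qform (adj x \<odot> x) f"
  using markov_square_converges[OF x] choi_eqI by metis

lemma norm_square_le_choi:
  assumes x: "x \<in> M"
  shows "(norm (x f))\<^sup>2 \<le> qform (adj x \<odot> x) f"
  using markov_square_le_choi[OF x, of 0 f] by (simp add: qform_square[OF M_cbounded[OF x]])

lemma pos_op_choi_square:
  assumes x: "x \<in> M"
  shows "pos_op (adj x \<odot> x)"
  unfolding pos_op_def
proof (intro conjI allI)
  show "selfadj (adj x \<odot> x)"
    using markov_square_converges[OF x] choi_eqI by metis
  show "0 \<le> qform (adj x \<odot> x) f" for f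
    using norm_square_le_choi[OF x, of f] zero_le_power2 order_trans by blast
qed

section \<open>Square roots of positive harmonic operators\<close>

text \<open>
  For \<open>0 \<le> t \<le> q < 1\<close> the square root of \<open>1 - t\<close> is \<open>1 - y\<close>, where \<open>y\<close> solves
  \<open>y = (t + y \<circ> y) / 2\<close>. The right-hand side is a contraction of the ball of radius \<open>q\<close>, by
  bilinearity and the estimate \<open>norm_choi_le\<close>, so that Banach's fixed point theorem applies.
\<close>

lemma choi_square_root:
  assumes t: "t \<in> M" "pos_op t" and q: "\<And>f. qform t f \<le> q * (norm f)\<^sup>2" "0 \<le> q" "q < 1"
  obtains y where "y \<in> M" "selfadj y" "y \<odot> y = id_blinfun - t"
proof -
  define S where "S = {y \<in> M. selfadj y \<and> norm y \<le> q}"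
  define F where "F y = (1/2) *\<^sub>R (t + y \<odot> y)" for y
  have "norm t \<le> q"
    by (rule pos_op_norm_le[OF t(2) q(1,2)])
  have "closed S"
    unfolding closed_sequential_limits
  proof (intro allI impI, elim conjE)
    fix X l
    assume X: "\<forall>k. X k \<in> S" "X \<longlonglongrightarrow> l"
    have lim: "(\<lambda>k. X k f) \<longlonglongrightarrow> l f" for f
      by (intro blinfun.tendsto X tendsto_const)
    have "l \<in> M" "selfadj l"
      using M_limit[OF _ lim] selfadj_limit[OF _ lim] X(1) by (auto simp: S_def)
    moreover have "norm l \<le> q"
      by (rule tendsto_upperbound[OF tendsto_norm[OF X(2)]]) (use X(1) in \<open>auto simp: S_def\<close>)
    ultimately show "l \<in> S"
      by (simp add: S_def)
  qed
  have sq_bound: "norm (y \<odot> y) \<le> q" if "y \<in> S" for y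
  proof -
    have "norm (y \<odot> y) \<le> norm y * norm y"
      using that by (intro norm_choi_le) (auto simp: S_def)
    also have "\<dots> \<le> q * 1"
      using that q by (intro mult_mono) (auto simp: S_def)
    finally show ?thesis by simp
  qed
  have maps: "F y \<in> S" if "y \<in> S" for y
  proof -
    have y: "y \<in> M" "adj y = y"
      using that by (auto simp: S_def selfadj_def)
    have "F y \<in> M"
      unfolding F_def using t y by auto
    moreover have "selfadj (F y)"
      using y t pos_op_choi_square[OF y(1)] unfolding F_def
      by (auto simp: pos_op_def)
    moreover have "norm (F y) \<le> q"
      using norm_triangle_ineq[of t "y \<odot> y"] \<open>norm t \<le> q\<close> sq_bound[OF that] by (simp add: F_def)
    ultimately show ?thesis
      by (simp add: S_def)
  qed
  have contr: "dist (F y) (F z) \<le> q * dist y z" if "y \<in> S" "z \<in> S" for y z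
  proof -
    have M: "y \<in> M" "z \<in> M" "y - z \<in> M" and n: "norm y \<le> q" "norm z \<le> q"
      using that by (auto simp: S_def)
    have "y \<odot> y - z \<odot> z = y \<odot> (y - z) + (y - z) \<odot> z"
      using choi_add_right[OF M(3) M(2) M(1)] choi_add_left[OF M(3) M(2) M(2)] by simp
    then have "norm (y \<odot> y - z \<odot> z) \<le> norm y * norm (y - z) + norm (y - z) * norm z"
      using norm_triangle_ineq[of "y \<odot> (y - z)" "(y - z) \<odot> z"]
        norm_choi_le[OF M(1) M(3)] norm_choi_le[OF M(3) M(2)] by simp
    also have "\<dots> \<le> q * norm (y - z) + norm (y - z) * q"
      by (intro add_mono mult_mono n) (use q in auto)
    finally have "norm (y \<odot> y - z \<odot> z) \<le> 2 * (q * norm (y - z))"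
      by simp
    moreover have "F y - F z = (1/2) *\<^sub>R (y \<odot> y - z \<odot> z)"
      by (simp add: F_def algebra_simps)
    ultimately show ?thesis
      by (simp add: dist_norm)
  qed
  have "0 \<in> S"
    using q by (simp add: S_def)
  then have "\<exists>!y. y \<in> S \<and> F y = y"
    using Banach_fix[of S q F] \<open>closed S\<close> maps contr q by (auto simp: complete_eq_closed)
  then obtain y where y: "y \<in> S" "F y = y"
    by blast
  then have yM: "y \<in> M" "id_blinfun - y \<in> M"
    by (auto simp: S_def)
  have "y + y = t + y \<odot> y"
    using arg_cong[OF y(2), of "\<lambda>x. 2 *\<^sub>R x"] by (simp add: F_def scaleR_2)
  moreover have "(id_blinfun - y) \<odot> (id_blinfun - y) + (id_blinfun - y) \<odot> y = id_blinfun - y"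
    using choi_add_right[OF yM(2) yM(1) yM(2)] choi_id_right[OF yM(2)] by simp
  moreover have "(id_blinfun - y) \<odot> y + y \<odot> y = y"
    using choi_add_left[OF yM(2) yM(1) yM(1)] choi_id_left[OF yM(1)] by simp
  ultimately have "(id_blinfun - y) \<odot> (id_blinfun - y) = id_blinfun - t"
    by (simp add: algebra_simps) (metis (no_types, lifting) add.assoc add_diff_cancel_left' diff_add_cancel)
  then show ?thesis
    using that[of "id_blinfun - y"] y yM by (auto simp: S_def)
qed

text \<open>
  Adding \<open>\<epsilon>\<close> keeps the rescaled operator \<open>(x + \<epsilon>) / C\<close> away from zero, as required for the contraction
  above; the constant \<open>C\<close> exceeds the norm of \<open>x + \<epsilon>\<close>.
\<close>

lemma positive_plus_scalar_is_square:
  assumes x: "x \<in> M" "pos_op x" and "0 < \<epsilon>"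
  obtains y where "y \<in> M" "x + \<epsilon> *\<^sub>R id_blinfun = adj y \<odot> y"
proof -
  define C where "C = norm x + 2 * \<epsilon>"
  define t where "t = id_blinfun - (1 / C) *\<^sub>R (x + \<epsilon> *\<^sub>R id_blinfun)"
  have "0 < C"
    using \<open>0 < \<epsilon>\<close> by (simp add: C_def add_nonneg_pos)
  have qt: "qform t f = (1 - \<epsilon> / C) * (norm f)\<^sup>2 - qform x f / C" for f
    by (simp add: t_def qform_diff qform_add qform_scaleR field_simps)
  have "0 \<le> qform t f" for f
  proof -
    have "qform x f + \<epsilon> * (norm f)\<^sup>2 \<le> C * (norm f)\<^sup>2"
      using abs_le_D1[OF abs_qform_le[of x f]] mult_nonneg_nonneg[OF less_imp_le[OF \<open>0 < \<epsilon>\<close>] zero_le_power2[of "norm f"]]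
      unfolding C_def distrib_right by linarith
    then have "(qform x f + \<epsilon> * (norm f)\<^sup>2) / C \<le> (norm f)\<^sup>2"
      using \<open>0 < C\<close> by (simp add: pos_divide_le_eq mult.commute)
    then show ?thesis
      by (simp add: qt add_divide_distrib left_diff_distrib)
  qed
  moreover have "selfadj t"
    unfolding t_def by (intro selfadj_diff selfadj_scaleR selfadj_add selfadj_id pos_opD(1)[OF x(2)])
  moreover have "t \<in> M"
    unfolding t_def by (intro M_diff M_scaleR M_add M_id x(1))
  moreover have "qform t f \<le> (1 - \<epsilon> / C) * (norm f)\<^sup>2" for f
    using pos_opD(2)[OF x(2), of f] \<open>0 < C\<close> by (simp add: qt)
  moreover have "0 \<le> 1 - \<epsilon> / C" "1 - \<epsilon> / C < 1"
    using \<open>0 < \<epsilon>\<close> \<open>0 < C\<close> by (simp_all add: C_def field_simps add_nonneg_pos)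
  ultimately obtain y where y: "y \<in> M" "selfadj y" "y \<odot> y = id_blinfun - t"
    using choi_square_root[of t "1 - \<epsilon> / C"] unfolding pos_op_def by metis
  define z where "z = sqrt C *\<^sub>R y"
  have "z \<in> M" "adj z = z"
    using y by (auto simp: z_def adj_scaleR selfadj_def)
  moreover have "z \<odot> z = C *\<^sub>R (y \<odot> y)"
    using y(1) \<open>0 < C\<close> unfolding z_def
    by (simp add: choi_scaleR_left choi_scaleR_right M_scaleR)
  ultimately show ?thesis
    using that[of z] y(3) \<open>0 < C\<close> by (simp add: t_def)
qed

end

section \<open>The vacuum norm and mean ergodicity\<close>

context fock_basis
begin

text \<open>
  For harmonic \<open>y\<close> these numbers increase to \<open>\<phi> (y\<^sup>* \<circ> y)\<close>, the square of the norm given by the vacuum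
  state \<open>\<phi>\<close>. Keeping the index \<open>j\<close> finite makes sense of them for operators that are only
  asymptotically harmonic, such as \<open>r\<^sub>a r\<^sub>b\<^sup>*\<close>.
\<close>

definition sqn :: "nat \<Rightarrow> ('n fock \<Rightarrow>\<^sub>L 'n fock) \<Rightarrow> real" where
  "sqn j y = qform ((avg L ^^ j) (adj y o\<^sub>L y)) \<Omega>"

lemma sqn_0: "y \<in> cbounded_ops \<Longrightarrow> sqn 0 y = (norm (y \<Omega>))\<^sup>2"
  by (simp add: sqn_def qform_square)

lemma avg_R_markov_pow: "avg R ((avg L ^^ j) z) = (avg L ^^ j) (avg R z)"
  by (induction j) (simp_all add: avg_LR_commute[symmetric])

lemma qform_vacuum: "qform x \<Omega> = Re (vac x)"
  by (simp add: qform_def inner_eq_Re_cinner)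

lemma qform_markov_pow_Suc: "qform ((avg L ^^ Suc j) z) \<Omega> = qform ((avg L ^^ j) (avg R z)) \<Omega>"
  by (simp add: qform_vacuum vac_avg[symmetric] avg_R_markov_pow)

text \<open>
  As \<open>\<phi> \<circ> P = \<phi> \<circ> E\<close>, one Markov step may be traded for one average over the right creation operators.
\<close>

lemma sqn_Suc:
  assumes "y \<in> cbounded_ops"
  shows "sqn (Suc j) y = (\<Sum>i\<in>UNIV. sqn j (y o\<^sub>L R i)) / real CARD('n)"
proof -
  have "avg R (adj y o\<^sub>L y) = (1 / real CARD('n)) *\<^sub>R (\<Sum>i\<in>UNIV. adj (y o\<^sub>L R i) o\<^sub>L (y o\<^sub>L R i))"
    unfolding avg_def using assms
    by (simp add: adj_compose cbounded_right_creation compose_assoc_blinfun)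
  then show ?thesis
    unfolding sqn_def qform_markov_pow_Suc
    by (simp add: avg_pow_scaleR[OF isometries_L] avg_pow_sum[OF isometries_L] qform_scaleR qform_sum)
qed

lemma sqn_add_le:
  "x \<in> cbounded_ops \<Longrightarrow> y \<in> cbounded_ops \<Longrightarrow> sqn j (x + y) \<le> 2 * sqn j x + 2 * sqn j y"
proof (induction j arbitrary: x y)
  case 0
  have "(norm (x \<Omega> + y \<Omega>))\<^sup>2 \<le> (norm (x \<Omega>) + norm (y \<Omega>))\<^sup>2"
    by (intro power_mono norm_triangle_ineq) simp
  also have "\<dots> \<le> 2 * (norm (x \<Omega>))\<^sup>2 + 2 * (norm (y \<Omega>))\<^sup>2"
    using sum_squares_bound[of "norm (x \<Omega>)" "norm (y \<Omega>)"] by (simp add: power2_sum)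
  finally show ?case
    using 0 by (simp add: sqn_0 cbounded_add blinfun.add_left)
next
  case (Suc j)
  have eq: "(x + y) o\<^sub>L R i = (x o\<^sub>L R i) + (y o\<^sub>L R i)" for i
    by (rule blinfun_eqI) (simp add: blinfun.add_left)
  have "(\<Sum>i\<in>UNIV. sqn j ((x + y) o\<^sub>L R i)) \<le> (\<Sum>i\<in>UNIV. 2 * sqn j (x o\<^sub>L R i) + 2 * sqn j (y o\<^sub>L R i))"
    unfolding eq using Suc by (intro sum_mono) (auto intro: Suc.IH)
  then have "(\<Sum>i\<in>UNIV. sqn j ((x + y) o\<^sub>L R i)) / real CARD('n)
      \<le> (2 * (\<Sum>i\<in>UNIV. sqn j (x o\<^sub>L R i)) + 2 * (\<Sum>i\<in>UNIV. sqn j (y o\<^sub>L R i))) / real CARD('n)"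
    by (intro divide_right_mono) (simp_all add: sum.distrib sum_distrib_left)
  then show ?case
    using Suc.prems by (simp add: sqn_Suc cbounded_add add_divide_distrib)
qed

lemma sqn_le_norm: "y \<in> cbounded_ops \<Longrightarrow> sqn j y \<le> (norm y)\<^sup>2"
proof -
  assume y: "y \<in> cbounded_ops"
  have "sqn j y \<le> norm ((avg L ^^ j) (adj y o\<^sub>L y))"
    using abs_le_D1[OF abs_qform_le[of "(avg L ^^ j) (adj y o\<^sub>L y)" \<Omega>]] by (simp add: sqn_def)
  also have "\<dots> \<le> norm (adj y) * norm y"
    using norm_avg_pow_le[OF isometries_L] norm_blinfun_compose order_trans by blast
  finally show ?thesis
    using y by (simp add: power2_eq_square)
qed

lemma sqn_mono: "x \<in> M \<Longrightarrow> i \<le> j \<Longrightarrow> sqn i x \<le> sqn j x"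
  by (rule lift_Suc_mono_le[of "\<lambda>j. sqn j x"]) (simp_all only: sqn_def markov_square_increasing)

text \<open>
  \<open>E\<close> is a contraction for the vacuum norm; again a Markov step pays for the application of \<open>E\<close>.
\<close>

lemma sqn_avg_R:
  assumes "y \<in> cbounded_ops"
  shows "sqn j (avg R y) \<le> sqn (Suc j) y"
proof -
  have "qform (adj (avg R y) o\<^sub>L avg R y) f \<le> qform (avg R (adj y o\<^sub>L y)) f" for f
    using avg_Schwarz[OF isometries_R, of y f]
    by (simp add: qform_square avg_cbounded[OF isometries_R] assms qform_avg[OF isometries_R])
  from avg_pow_mono[OF isometries_L this] show ?thesis
    unfolding sqn_def qform_markov_pow_Suc .
qed

lemma sqn_avg_R_pow: "y \<in> cbounded_ops \<Longrightarrow> sqn j ((avg R ^^ k) y) \<le> sqn (k + j) y"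
proof (induction k arbitrary: j)
  case (Suc k)
  have "sqn j (avg R ((avg R ^^ k) y)) \<le> sqn (Suc j) ((avg R ^^ k) y)"
    by (rule sqn_avg_R[OF avg_pow_cbounded[OF isometries_R Suc.prems]])
  also have "\<dots> \<le> sqn (Suc k + j) y"
    using Suc.IH[OF Suc.prems, of "Suc j"] by simp
  finally show ?case by simp
qed simp

lemma sqn_almost_sup:
  assumes "x \<in> M" "0 < \<epsilon>"
  obtains m where "\<And>j. sqn j x \<le> sqn m x + \<epsilon>"
proof -
  have bdd: "bdd_above (range (\<lambda>j. sqn j x))"
    by (rule bdd_aboveI2[where M = "(norm x)\<^sup>2"]) (rule sqn_le_norm[OF M_cbounded[OF assms(1)]])
  obtain m where "(SUP j. sqn j x) - \<epsilon> < sqn m x"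
    using less_cSUP_iff[OF _ bdd, of "(SUP j. sqn j x) - \<epsilon>"] assms(2) by auto
  moreover have "sqn j x \<le> (SUP j. sqn j x)" for j
    by (rule cSUP_upper[OF _ bdd]) simp
  ultimately show ?thesis
    using that[of m] by (smt (verit))
qed

lemma norm_vac_le_sqn:
  assumes "y \<in> M"
  shows "(cmod (vac y))\<^sup>2 \<le> sqn j y"
proof -
  have "cmod (vac y) \<le> norm (y \<Omega>)"
    using cinner_le_norm[of \<Omega> "y \<Omega>"] by simp
  then have "(cmod (vac y))\<^sup>2 \<le> sqn 0 y"
    using M_cbounded[OF assms] by (simp add: sqn_0 power_mono)
  then show ?thesis
    using sqn_mono[OF assms, of 0 j] by simp
qed

subsection \<open>Polynomials in the right creation operators\<close>

text \<open>On the vacuum, \<open>Rw w\<close> produces the reversed word; see \<open>Rw_vacuum\<close>.\<close>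

fun Rw :: "'n list \<Rightarrow> 'n fock \<Rightarrow>\<^sub>L 'n fock" where
  "Rw [] = id_blinfun"
| "Rw (i # w) = R i o\<^sub>L Rw w"

inductive_set words :: "('n fock \<Rightarrow>\<^sub>L 'n fock) set" where
  word: "Rw a o\<^sub>L adj (Rw b) \<in> words"
| add: "x \<in> words \<Longrightarrow> y \<in> words \<Longrightarrow> x + y \<in> words"
| scale: "x \<in> words \<Longrightarrow> op_scaleC c x \<in> words"

lemma cbounded_Rw [intro]: "Rw w \<in> cbounded_ops"
  by (induction w) auto

lemma norm_Rw_le: "norm (Rw w) \<le> 1"
proof -
  have "norm (Rw w f) = norm f" for f
    by (induction w) (auto simp: isometries_norm[OF isometries_R])
  then show ?thesis
    by (intro norm_blinfun_bound) auto
qed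

lemma Rw_snoc: "Rw (w @ [i]) = Rw w o\<^sub>L R i"
  by (induction w) (auto simp: compose_assoc_blinfun)

lemma M_compose_Rw: "x \<in> M \<Longrightarrow> x o\<^sub>L Rw w \<in> M"
  by (induction w arbitrary: x) (auto simp: compose_assoc_blinfun[symmetric])

lemma M_adj_Rw_compose: "x \<in> M \<Longrightarrow> adj (Rw w) o\<^sub>L x \<in> M"
  by (induction w arbitrary: x)
    (auto simp: adj_compose cbounded_right_creation cbounded_Rw compose_assoc_blinfun)

lemma cbounded_words: "S \<in> words \<Longrightarrow> S \<in> cbounded_ops"
  by (induction S rule: words.induct) (auto intro: cbounded_adj cbounded_Rw)

lemma words_zero: "0 \<in> words"
proof -
  have "op_scaleC 0 (Rw [] o\<^sub>L adj (Rw [])) = 0"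
    by (rule blinfun_eqI) simp
  then show ?thesis
    using words.scale[OF words.word, of 0 "[]" "[]"] by simp
qed

lemma words_sum: "(\<And>i. i \<in> A \<Longrightarrow> F i \<in> words) \<Longrightarrow> (\<Sum>i\<in>A. F i) \<in> words"
  by (induction A rule: infinite_finite_induct) (auto intro: words.add words_zero)

lemma words_compose_adj_R: "S \<in> words \<Longrightarrow> S o\<^sub>L adj (R i) \<in> words"
proof (induction S rule: words.induct)
  case (word a b)
  have "Rw a o\<^sub>L adj (Rw b) o\<^sub>L adj (R i) = Rw a o\<^sub>L adj (Rw (i # b))"
    by (simp add: adj_compose cbounded_right_creation cbounded_Rw compose_assoc_blinfun)
  then show ?case
    using words.word by metis
next
  case (add x y)
  have "(x + y) o\<^sub>L adj (R i) = (x o\<^sub>L adj (R i)) + (y o\<^sub>L adj (R i))"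
    by (rule blinfun_eqI) (simp add: blinfun.add_left)
  then show ?case
    using add words.add by metis
next
  case (scale x c)
  have "op_scaleC c x o\<^sub>L adj (R i) = op_scaleC c (x o\<^sub>L adj (R i))"
    by (rule blinfun_eqI) simp
  then show ?case
    using scale words.scale by metis
qed

text \<open>
  In \<open>E (r\<^sub>i x) = (1/n) (\<Sum>u. r\<^sub>u\<^sup>* r\<^sub>i x r\<^sub>u)\<close> only the term \<open>u = i\<close> survives. So \<open>E\<close> moves the first factor of a
  product \<open>r\<^sub>w\<close> to its end and divides by \<open>n\<close>. The powers of \<open>E\<close> rotate the word and tend to zero in norm.
\<close>

lemma avg_R_cons: "avg R (R i o\<^sub>L x) = (1 / real CARD('n)) *\<^sub>R (x o\<^sub>L R i)"
proof (rule blinfun_cinner_eqI)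
  fix f g
  have "cinner (R u f) (R i (x (R u g))) = (if u = i then cinner f (x (R i g)) else 0)" for u
    by (simp add: right_creation_apply cinner_tensor_right[OF onb] cinner_basis)
  then show "cinner f (avg R (R i o\<^sub>L x) g) = cinner f (((1 / real CARD('n)) *\<^sub>R (x o\<^sub>L R i)) g)"
    by (simp add: cinner_avg[OF isometries_R] blinfun.scaleR_left cinner.scaleR_right scaleR_conv_of_real)
qed

lemma adj_R_R: "adj (R j) (R i f) = (if i = j then f else 0)"
  by (simp add: adj_right_creation_right_creation cinner_basis)

lemma norm_avg_R_pow_Rw: "w \<noteq> [] \<Longrightarrow> norm ((avg R ^^ k) (Rw w)) \<le> (1 / real CARD('n)) ^ k"
proof (induction k arbitrary: w)
  case 0
  then show ?case
    using norm_Rw_le by simp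
next
  case (Suc k)
  then obtain i v where w: "w = i # v"
    by (cases w) auto
  have "(avg R ^^ Suc k) (Rw w) = (avg R ^^ k) (avg R (Rw w))"
    by (simp only: funpow_Suc_right comp_def)
  also have "avg R (Rw w) = (1 / real CARD('n)) *\<^sub>R Rw (v @ [i])"
    by (simp add: w avg_R_cons Rw_snoc)
  finally have "norm ((avg R ^^ Suc k) (Rw w)) = 1 / real CARD('n) * norm ((avg R ^^ k) (Rw (v @ [i])))"
    by (simp add: avg_pow_scaleR[OF isometries_R])
  also have "\<dots> \<le> 1 / real CARD('n) * (1 / real CARD('n)) ^ k"
    using Suc.IH[of "v @ [i]"] by (intro mult_left_mono) auto
  finally show ?case by simp
qed

lemma avg_R_pow_Rw_tendsto: "w \<noteq> [] \<Longrightarrow> (\<lambda>k. (avg R ^^ k) (Rw w)) \<longlonglongrightarrow> 0"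
proof (rule Lim_null_comparison)
  assume "w \<noteq> []"
  then show "\<forall>\<^sub>F k in sequentially. norm ((avg R ^^ k) (Rw w)) \<le> (1 / real CARD('n)) ^ k"
    using norm_avg_R_pow_Rw by simp
  show "(\<lambda>k. (1 / real CARD('n)) ^ k) \<longlonglongrightarrow> 0"
    using dim by (intro LIMSEQ_power_zero) simp
qed

text \<open>
  For \<open>r\<^sub>a r\<^sub>b\<^sup>*\<close> each application of \<open>E\<close> cancels the first letters of \<open>a\<close> and \<open>b\<close> against each other, or gives
  zero if they differ, until one of the words is used up and the remaining one rotates.
\<close>

lemma avg_R_pow_word: "\<exists>c. (\<lambda>k. (avg R ^^ k) (Rw a o\<^sub>L adj (Rw b))) \<longlonglongrightarrow> op_scaleC c id_blinfun"
proof (induction a arbitrary: b)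
  case Nil
  show ?case
  proof (cases "b = []")
    case True
    then show ?thesis
      by (intro exI[of _ 1]) (simp add: avg_pow_id[OF isometries_R])
  next
    case False
    have "(\<lambda>k. norm ((avg R ^^ k) (adj (Rw b)))) \<longlonglongrightarrow> 0"
      using tendsto_norm_zero[OF avg_R_pow_Rw_tendsto[OF False]]
      by (simp add: adj_avg_pow[OF isometries_R cbounded_Rw, symmetric] avg_pow_cbounded[OF isometries_R] cbounded_Rw)
    then show ?thesis
      by (intro exI[of _ 0]) (simp add: tendsto_norm_zero_iff)
  qed
next
  case (Cons i a)
  show ?case
  proof (cases b)
    case Nil
    then show ?thesis
      using avg_R_pow_Rw_tendsto[of "i # a"] by (intro exI[of _ 0]) simp
  next
    case (Cons j d)
    obtain c where c: "(\<lambda>k. (avg R ^^ k) (Rw a o\<^sub>L adj (Rw d))) \<longlonglongrightarrow> op_scaleC c id_blinfun"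
      using Cons.IH by blast
    define s where "s = (if i = j then 1 / real CARD('n) else 0)"
    have "avg R (Rw (i # a) o\<^sub>L adj (Rw b)) = s *\<^sub>R (Rw a o\<^sub>L adj (Rw d))"
    proof -
      have "Rw (i # a) o\<^sub>L adj (Rw b) = R i o\<^sub>L (Rw a o\<^sub>L adj (Rw d) o\<^sub>L adj (R j))"
        by (simp add: Cons adj_compose cbounded_right_creation cbounded_Rw compose_assoc_blinfun)
      then have "avg R (Rw (i # a) o\<^sub>L adj (Rw b))
          = (1 / real CARD('n)) *\<^sub>R ((Rw a o\<^sub>L adj (Rw d) o\<^sub>L adj (R j)) o\<^sub>L R i)"
        by (simp only: avg_R_cons)
      also have "\<dots> = s *\<^sub>R (Rw a o\<^sub>L adj (Rw d))"
        by (rule blinfun_eqI) (simp add: blinfun.scaleR_left adj_R_R s_def)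
      finally show ?thesis .
    qed
    then have step: "(avg R ^^ Suc k) (Rw (i # a) o\<^sub>L adj (Rw b)) = s *\<^sub>R (avg R ^^ k) (Rw a o\<^sub>L adj (Rw d))" for k
      by (simp only: funpow_Suc_right comp_def avg_pow_scaleR[OF isometries_R])
    have "(\<lambda>k. (avg R ^^ Suc k) (Rw (i # a) o\<^sub>L adj (Rw b))) \<longlonglongrightarrow> s *\<^sub>R op_scaleC c id_blinfun"
      unfolding step by (rule tendsto_scaleR[OF tendsto_const c])
    moreover have "s *\<^sub>R op_scaleC c id_blinfun = op_scaleC (complex_of_real s * c) (id_blinfun :: 'n fock \<Rightarrow>\<^sub>L 'n fock)"
      by (rule blinfun_eqI) (simp add: blinfun.scaleR_left scaleC_of_real[symmetric] scaleC_scaleC)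
    ultimately have "(\<lambda>k. (avg R ^^ Suc k) (Rw (i # a) o\<^sub>L adj (Rw b)))
        \<longlonglongrightarrow> op_scaleC (complex_of_real s * c) id_blinfun"
      by (simp only:)
    then show ?thesis
      by (intro exI) (rule LIMSEQ_imp_Suc)
  qed
qed

lemma avg_R_pow_words:
  "S \<in> words \<Longrightarrow> \<exists>c. (\<lambda>k. (avg R ^^ k) S) \<longlonglongrightarrow> op_scaleC c id_blinfun"
proof (induction S rule: words.induct)
  case (add x y)
  then obtain c d where "(\<lambda>k. (avg R ^^ k) x) \<longlonglongrightarrow> op_scaleC c id_blinfun"
    "(\<lambda>k. (avg R ^^ k) y) \<longlonglongrightarrow> op_scaleC d id_blinfun"
    by blast
  then have "(\<lambda>k. (avg R ^^ k) (x + y)) \<longlonglongrightarrow> op_scaleC c id_blinfun + op_scaleC d id_blinfun"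
    by (auto simp: avg_pow_add[OF isometries_R] intro: tendsto_add)
  moreover have "op_scaleC c id_blinfun + op_scaleC d id_blinfun = op_scaleC (c + d) (id_blinfun :: 'n fock \<Rightarrow>\<^sub>L 'n fock)"
    by (rule blinfun_eqI) (simp add: blinfun.add_left scaleC_add_left)
  ultimately show ?case
    by (intro exI[of _ "c + d"]) (simp only:)
next
  case (scale x c)
  then obtain d where "(\<lambda>k. (avg R ^^ k) x) \<longlonglongrightarrow> op_scaleC d id_blinfun"
    by blast
  then have "(\<lambda>k. (avg R ^^ k) (op_scaleC c x)) \<longlonglongrightarrow> op_scaleC c (op_scaleC d id_blinfun)"
    unfolding avg_pow_scaleC[OF isometries_R] by (rule tendsto_op_scaleC)
  moreover have "op_scaleC c (op_scaleC d id_blinfun) = op_scaleC (c * d) (id_blinfun :: 'n fock \<Rightarrow>\<^sub>L 'n fock)"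
    by (rule blinfun_eqI) (simp add: scaleC_scaleC)
  ultimately show ?case
    by (intro exI[of _ "c * d"]) (simp only:)
qed (rule avg_R_pow_word)

subsection \<open>Approximation in the vacuum norm\<close>

text \<open>
  These include the polynomials in the \<open>r\<^sub>i\<close> themselves, without adjoints. What matters of them is that
  multiplication by their adjoints from the left maps harmonic operators to harmonic ones.
\<close>

definition polys :: "('n fock \<Rightarrow>\<^sub>L 'n fock) set" where
  "polys = {c \<in> words. c \<in> M \<and> (\<forall>x\<in>M. adj c o\<^sub>L x \<in> M)}"

lemma Rw_in_polys: "Rw w \<in> polys"
  using words.word[of w "[]"] M_compose_Rw[OF M_id, of w] by (auto simp: polys_def M_adj_Rw_compose)

lemma polys_add: "c \<in> polys \<Longrightarrow> d \<in> polys \<Longrightarrow> c + d \<in> polys"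
proof -
  assume cd: "c \<in> polys" "d \<in> polys"
  have "adj (c + d) o\<^sub>L x = (adj c o\<^sub>L x) + (adj d o\<^sub>L x)" for x :: "'n fock \<Rightarrow>\<^sub>L 'n fock"
    using cd by (intro blinfun_eqI) (simp add: polys_def M_cbounded adj_add blinfun.add_left)
  then show ?thesis
    using cd by (auto simp: polys_def intro: words.add)
qed

lemma polys_scale: "c \<in> polys \<Longrightarrow> op_scaleC a c \<in> polys"
proof -
  assume c: "c \<in> polys"
  have "adj (op_scaleC a c) o\<^sub>L x = op_scaleC (cnj a) (adj c o\<^sub>L x)" for x :: "'n fock \<Rightarrow>\<^sub>L 'n fock"
    using c by (intro blinfun_eqI) (simp add: polys_def M_cbounded adj_scaleC)
  then show ?thesis
    using c by (auto simp: polys_def intro: words.scale)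
qed

lemma R_ket: "R i (ket v) = ket (v @ [i])"
proof (rule fock_eqI)
  show "coeff (R i (ket v)) w = coeff (ket (v @ [i])) w" for w
    by (cases w rule: rev_cases)
      (auto simp: right_creation_apply tensor_right.rep_eq coeff_ket cinner_basis)
qed

lemma Rw_vacuum: "Rw w \<Omega> = ket (rev w)"
  by (induction w) (simp_all add: ket_Nil R_ket)

lemma polys_vacuum_limit:
  "f \<in> closure ((\<lambda>c. blinfun_apply c \<Omega>) ` polys) \<longleftrightarrow>
    (\<exists>X. (\<forall>k. X k \<in> polys) \<and> (\<lambda>k. blinfun_apply (X k) \<Omega>) \<longlonglongrightarrow> f)"
proof
  assume "f \<in> closure ((\<lambda>c. blinfun_apply c \<Omega>) ` polys)"
  then obtain x where x: "\<forall>k. x k \<in> (\<lambda>c. blinfun_apply c \<Omega>) ` polys" "x \<longlonglongrightarrow> f"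
    unfolding closure_sequential by blast
  then have "\<forall>k. \<exists>c. c \<in> polys \<and> x k = c \<Omega>"
    by blast
  from choice[OF this] obtain X where X: "\<forall>k. X k \<in> polys \<and> x k = X k \<Omega>"
    by blast
  then have "x = (\<lambda>k. X k \<Omega>)"
    by blast
  with x X show "\<exists>X. (\<forall>k. X k \<in> polys) \<and> (\<lambda>k. blinfun_apply (X k) \<Omega>) \<longlonglongrightarrow> f"
    by blast
next
  assume "\<exists>X. (\<forall>k. X k \<in> polys) \<and> (\<lambda>k. blinfun_apply (X k) \<Omega>) \<longlonglongrightarrow> f"
  then obtain X where "\<forall>k. X k \<in> polys" "(\<lambda>k. blinfun_apply (X k) \<Omega>) \<longlonglongrightarrow> f"
    by blast
  then show "f \<in> closure ((\<lambda>c. blinfun_apply c \<Omega>) ` polys)"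
    unfolding closure_sequential by (intro exI[of _ "\<lambda>k. X k \<Omega>"]) auto
qed

lemma polys_vacuumI: "c \<in> polys \<Longrightarrow> c \<Omega> \<in> closure ((\<lambda>c. blinfun_apply c \<Omega>) ` polys)"
  by (rule closure_subset[THEN subsetD]) (rule imageI)

lemma polys_vacuum_dense: "f \<in> closure ((\<lambda>c. blinfun_apply c \<Omega>) ` polys)"
proof (induction f rule: fock_induct)
  case closed
  show ?case by simp
next
  case zero
  show ?case
    using polys_vacuumI[OF polys_scale[OF Rw_in_polys, of 0 "[]"]] by simp
next
  case (add f g)
  then obtain X Y where X: "\<forall>k. X k \<in> polys" "(\<lambda>k. blinfun_apply (X k) \<Omega>) \<longlonglongrightarrow> f"
    and Y: "\<forall>k. Y k \<in> polys" "(\<lambda>k. blinfun_apply (Y k) \<Omega>) \<longlonglongrightarrow> g"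
    unfolding polys_vacuum_limit by blast
  have "(\<lambda>k. (X k + Y k) \<Omega>) \<longlonglongrightarrow> f + g"
    unfolding blinfun.add_left by (intro tendsto_add X Y)
  then show ?case
    unfolding polys_vacuum_limit using X Y polys_add by (intro exI[of _ "\<lambda>k. X k + Y k"]) blast
next
  case (scale a f)
  then obtain X where X: "\<forall>k. X k \<in> polys" "(\<lambda>k. blinfun_apply (X k) \<Omega>) \<longlonglongrightarrow> f"
    unfolding polys_vacuum_limit by blast
  have "(\<lambda>k. op_scaleC a (X k) \<Omega>) \<longlonglongrightarrow> a *\<^sub>C f"
    unfolding op_scaleC_apply by (intro scaleC.tendsto tendsto_const X)
  then show ?case
    unfolding polys_vacuum_limit using X polys_scale by (intro exI[of _ "\<lambda>k. op_scaleC a (X k)"]) blast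
next
  case (ket w)
  show ?case
    using polys_vacuumI[OF Rw_in_polys[of "rev w"]] by (simp add: Rw_vacuum)
qed

text \<open>
  The cross terms of \<open>(x - c)\<^sup>* (x - c)\<close> are harmonic, and so is \<open>c\<^sup>* c\<close>. Only \<open>x\<^sup>* x\<close> changes under the
  Markov operator, and the change does not depend on \<open>c\<close>.
\<close>

lemma sqn_diff_poly:
  assumes x: "x \<in> M" and c: "c \<in> polys"
  shows "sqn j (x - c) = sqn j x - sqn 0 x + (norm (x \<Omega> - c \<Omega>))\<^sup>2"
proof -
  define W where "W = (adj x o\<^sub>L x) - (adj (x - c) o\<^sub>L (x - c))"
  have cM: "c \<in> M" and cb: "x \<in> cbounded_ops" "c \<in> cbounded_ops"
    using x c by (auto simp: polys_def M_cbounded)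
  have "W = adj (adj c o\<^sub>L x) + (adj c o\<^sub>L x) - (adj c o\<^sub>L c)"
    using cb unfolding W_def
    by (intro blinfun_eqI) (simp add: adj_diff adj_compose cbounded_adj blinfun.diff_left
        blinfun.diff_right blinfun.add_left)
  then have "W \<in> M"
    using x c cM by (auto simp: polys_def)
  then have "(avg L ^^ j) W = W"
    by (simp add: avg_pow_fixed[OF isometries_L] M_avg)
  moreover have "qform ((avg L ^^ j) W) \<Omega> = sqn j x - sqn j (x - c)"
    by (simp add: W_def sqn_def avg_pow_diff[OF isometries_L] qform_diff)
  ultimately have "sqn j x - sqn j (x - c) = qform W \<Omega>"
    by simp
  also have "\<dots> = sqn 0 x - (norm (x \<Omega> - c \<Omega>))\<^sup>2"
    using cb by (simp add: W_def qform_diff qform_square cbounded_diff sqn_0 blinfun.diff_left)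
  finally show ?thesis by simp
qed

text \<open>
  For \<open>m = 0\<close> approximate \<open>x \<Omega>\<close> by \<open>c \<Omega>\<close> with a polynomial \<open>c\<close>. In the induction step, \<open>x\<close> is recovered from
  the operators \<open>x r\<^sub>i\<close> as \<open>\<Sum>i. x r\<^sub>i r\<^sub>i\<^sup>*\<close> up to its value on the vacuum, and approximations \<open>S\<^sub>i\<close> of the \<open>x r\<^sub>i\<close>
  combine to the approximation \<open>\<Sum>i. S\<^sub>i r\<^sub>i\<^sup>*\<close> of \<open>x\<close>.
\<close>

lemma sqn_approximation:
  "x \<in> M \<Longrightarrow> 0 < \<epsilon> \<Longrightarrow> \<exists>S\<in>words. \<forall>j\<ge>m. sqn j (x - S) \<le> sqn j x - sqn m x + \<epsilon>"
proof (induction m arbitrary: x)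
  case 0
  have "0 < sqrt \<epsilon>"
    using 0 by simp
  then obtain c where c: "c \<in> polys" "dist (c \<Omega>) (x \<Omega>) < sqrt \<epsilon>"
    using polys_vacuum_dense[of "x \<Omega>"] unfolding closure_approachable by blast
  then have "(norm (x \<Omega> - c \<Omega>))\<^sup>2 \<le> \<epsilon>"
    using 0 power_mono[of "norm (x \<Omega> - c \<Omega>)" "sqrt \<epsilon>" 2] by (simp add: dist_norm norm_minus_commute)
  then show ?case
    using c sqn_diff_poly[OF 0(1) c(1)] by (intro bexI[of _ c]) (auto simp: polys_def)
next
  case (Suc m)
  have "x o\<^sub>L R i \<in> M" for i
    using Suc.prems by auto
  then have "\<forall>i. \<exists>S\<in>words. \<forall>j\<ge>m. sqn j ((x o\<^sub>L R i) - S) \<le> sqn j (x o\<^sub>L R i) - sqn m (x o\<^sub>L R i) + \<epsilon>"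
    using Suc.IH Suc.prems(2) by blast
  then obtain S where S: "\<And>i. S i \<in> words"
    and Sm: "\<And>i j. j \<ge> m \<Longrightarrow> sqn j ((x o\<^sub>L R i) - S i) \<le> sqn j (x o\<^sub>L R i) - sqn m (x o\<^sub>L R i) + \<epsilon>"
    by metis
  define T where "T = (\<Sum>i\<in>UNIV. S i o\<^sub>L adj (R i))"
  have T: "T \<in> words"
    unfolding T_def by (intro words_sum words_compose_adj_R S)
  have TR: "(x - T) o\<^sub>L R i = (x o\<^sub>L R i) - S i" for i
  proof (rule blinfun_eqI)
    fix f
    have "T (R i f) = (\<Sum>u\<in>UNIV. S u (if i = u then f else 0))"
      by (simp add: T_def blinfun.sum_left adj_R_R)
    also have "\<dots> = (\<Sum>u\<in>UNIV. if i = u then S u f else 0)"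
      by (rule sum.cong) auto
    finally show "((x - T) o\<^sub>L R i) f = ((x o\<^sub>L R i) - S i) f"
      by (simp add: blinfun.diff_left)
  qed
  show ?case
  proof (intro bexI[OF _ T] allI impI)
    fix j
    assume "Suc m \<le> j"
    then obtain l where j: "j = Suc l" "m \<le> l"
      by (cases j) auto
    have xT: "x \<in> cbounded_ops" "x - T \<in> cbounded_ops"
      using Suc.prems(1) T by (auto simp: M_cbounded cbounded_words)
    have "sqn j (x - T) = (\<Sum>i\<in>UNIV. sqn l ((x o\<^sub>L R i) - S i)) / real CARD('n)"
      unfolding j sqn_Suc[OF xT(2)] TR ..
    also have "\<dots> \<le> (\<Sum>i\<in>(UNIV :: 'n set). sqn l (x o\<^sub>L R i) - sqn m (x o\<^sub>L R i) + \<epsilon>) / real CARD('n)"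
      by (intro divide_right_mono sum_mono Sm j(2)) simp
    also have "\<dots> = sqn j x - sqn (Suc m) x + \<epsilon>"
      unfolding j sqn_Suc[OF xT(1)]
      by (simp add: sum.distrib sum_subtractf add_divide_distrib diff_divide_distrib)
    finally show "sqn j (x - T) \<le> sqn j x - sqn (Suc m) x + \<epsilon>" .
  qed
qed

text \<open>
  In the vacuum norm \<open>x\<close> is close to a combination \<open>S\<close> of words, for which \<open>E\<^sup>k S\<close> converges in norm to a
  scalar \<open>c\<close>; contractivity of \<open>E\<close> transfers this to \<open>x\<close>. Finally \<open>c\<close> is close to \<open>\<phi> x\<close> because \<open>\<phi>\<close> is
  invariant under \<open>E\<close>.
\<close>

lemma mean_ergodic:
  assumes x: "x \<in> M" and "0 < \<epsilon>"
  shows "\<exists>k. \<forall>j. sqn j ((avg R ^^ k) x - op_scaleC (vac x) id_blinfun) \<le> \<epsilon>"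
proof -
  \<comment> \<open>In the end there is twice the error \<open>6 * \<delta>\<close> of \<open>h\<close> and twice the error \<open>6 * \<delta>\<close> of the scalar.\<close>
  define \<delta> where "\<delta> = \<epsilon> / 24"
  have "0 < \<delta>"
    using assms by (simp add: \<delta>_def)
  obtain m where m: "\<And>j. sqn j x \<le> sqn m x + \<delta>"
    using sqn_almost_sup[OF x \<open>0 < \<delta>\<close>] by blast
  obtain S where S: "S \<in> words" "\<And>j. j \<ge> m \<Longrightarrow> sqn j (x - S) \<le> sqn j x - sqn m x + \<delta>"
    using sqn_approximation[OF x \<open>0 < \<delta>\<close>, of m] by blast
  have close: "sqn j (x - S) \<le> 2 * \<delta>" if "j \<ge> m" for j
    using S(2)[OF that] m[of j] by simp
  obtain c where c: "(\<lambda>k. (avg R ^^ k) S) \<longlonglongrightarrow> op_scaleC c id_blinfun"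
    using avg_R_pow_words[OF S(1)] by blast
  let ?c = "op_scaleC c (id_blinfun :: 'n fock \<Rightarrow>\<^sub>L 'n fock)"
  have "0 < sqrt \<delta>"
    using \<open>0 < \<delta>\<close> by simp
  then obtain k where k: "norm ((avg R ^^ k) S - ?c) < sqrt \<delta>"
    using LIMSEQ_D[OF c] by blast
  define h where "h = (avg R ^^ k) x - ?c"
  have hM: "h \<in> M"
    unfolding h_def using x by auto
  have cb: "x \<in> cbounded_ops" "S \<in> cbounded_ops"
    using x S by (auto simp: M_cbounded cbounded_words)
  have big: "sqn j h \<le> 6 * \<delta>" if "j \<ge> m" for j
  proof -
    have "h = (avg R ^^ k) (x - S) + ((avg R ^^ k) S - ?c)"
      by (simp add: h_def avg_pow_diff[OF isometries_R])
    then have "sqn j h \<le> 2 * sqn j ((avg R ^^ k) (x - S)) + 2 * sqn j ((avg R ^^ k) S - ?c)"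
      using cb by (auto intro!: sqn_add_le avg_pow_cbounded[OF isometries_R])
    moreover have "sqn j ((avg R ^^ k) (x - S)) \<le> 2 * \<delta>"
      using sqn_avg_R_pow[of "x - S" j k] close[of "k + j"] cb that by (auto intro: order_trans)
    moreover have "sqn j ((avg R ^^ k) S - ?c) \<le> (norm ((avg R ^^ k) S - ?c))\<^sup>2"
      using cb by (intro sqn_le_norm cbounded_diff avg_pow_cbounded[OF isometries_R]) auto
    moreover have "(norm ((avg R ^^ k) S - ?c))\<^sup>2 \<le> \<delta>"
      using power_mono[OF less_imp_le[OF k], of 2] \<open>0 < \<delta>\<close> by simp
    ultimately show ?thesis by simp
  qed
  \<comment> \<open>\<open>S\<close> is not harmonic, so the bound starts at \<open>m\<close>; but \<open>h\<close> is, and there the index is monotone.\<close>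
  have h: "sqn j h \<le> 6 * \<delta>" for j
    using sqn_mono[OF hM, of j "max j m"] big[of "max j m"] by simp
  have "vac h = vac x - c"
    unfolding h_def using x
    by (simp add: blinfun.diff_left cinner.diff_right vac_avg_R_pow cinner_scaleC_right cinner_self)
  then have d: "(cmod (c - vac x))\<^sup>2 \<le> 6 * \<delta>"
    using norm_vac_le_sqn[OF hM, of 0] h[of 0] by (simp add: norm_minus_commute)
  let ?d = "op_scaleC (c - vac x) (id_blinfun :: 'n fock \<Rightarrow>\<^sub>L 'n fock)"
  have "sqn j ((avg R ^^ k) x - op_scaleC (vac x) id_blinfun) \<le> \<epsilon>" for j
  proof -
    have "(avg R ^^ k) x - op_scaleC (vac x) id_blinfun = h + ?d"
      by (rule blinfun_eqI) (simp add: h_def blinfun.add_left blinfun.diff_left scaleC.diff_left)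
    then have "sqn j ((avg R ^^ k) x - op_scaleC (vac x) id_blinfun) \<le> 2 * sqn j h + 2 * sqn j ?d"
      using hM by (auto intro!: sqn_add_le simp: M_cbounded)
    moreover have "sqn j ?d \<le> (norm ?d)\<^sup>2"
      by (intro sqn_le_norm) auto
    moreover have "(norm ?d)\<^sup>2 \<le> (cmod (c - vac x))\<^sup>2"
    proof (rule power_mono)
      have "norm (id_blinfun :: 'n fock \<Rightarrow>\<^sub>L 'n fock) \<le> 1"
        by (rule norm_blinfun_bound) auto
      then show "norm ?d \<le> cmod (c - vac x)"
        using norm_op_scaleC[of "c - vac x" id_blinfun] mult_left_le[of "norm id_blinfun" "cmod (c - vac x)"]
        by (meson norm_ge_zero order_trans)
    qed simp
    ultimately show ?thesis
      using d h[of j] unfolding \<delta>_def by linarith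
  qed
  then show ?thesis
    by blast
qed

end

section \<open>Bounded majorants of summable sequences\<close>

text \<open>
  The characterisation says that the form of \<open>c\<close> is the infimal convolution of the forms of the
  identity and of \<open>s\<close>; explicitly \<open>c = s (1 + s)\<^sup>-\<^sup>1\<close>.
\<close>

definition is_cut :: "('n::finite fock \<Rightarrow>\<^sub>L 'n fock) \<Rightarrow> ('n fock \<Rightarrow>\<^sub>L 'n fock) \<Rightarrow> bool" where
  "is_cut s c \<longleftrightarrow> selfadj c \<and>
     (\<forall>f g. qform c f \<le> (norm (f - g))\<^sup>2 + qform s g) \<and>
     (\<forall>f. \<exists>g. qform c f = (norm (f - g))\<^sup>2 + qform s g)"

text \<open>
  The scaling turns \<open>1 + s\<close> into \<open>(1 + C) (1 - t)\<close> with \<open>0 \<le> t \<le> C / (1 + C) < 1\<close>, and the inverse of \<open>1 - t\<close> is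
  the fixed point of \<open>w \<mapsto> 1 + t w\<close>.
\<close>

lemma resolvent_exists:
  fixes s :: "'n::finite fock \<Rightarrow>\<^sub>L 'n fock"
  assumes s: "pos_op s"
  obtains u where "selfadj u" "\<And>f. blinfun_apply u f + s (u f) = f"
proof -
  define C where "C = norm s"
  define t where "t = (1 / (1 + C)) *\<^sub>R (C *\<^sub>R id_blinfun - s)"
  define F where "F w = id_blinfun + (t o\<^sub>L w)" for w :: "'n fock \<Rightarrow>\<^sub>L 'n fock"
  have "0 \<le> C"
    by (simp add: C_def)
  have tb: "t \<in> cbounded_ops"
    unfolding t_def using pos_opD(1)[OF s] by (intro cbounded_scaleR cbounded_diff) auto
  have "selfadj t"
    unfolding t_def by (intro selfadj_scaleR selfadj_diff selfadj_id pos_opD(1)[OF s])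
  have qt: "qform t f = (C * (norm f)\<^sup>2 - qform s f) / (1 + C)" for f
    by (simp add: t_def qform_scaleR qform_diff)
  have "pos_op t"
    unfolding pos_op_def using \<open>selfadj t\<close> abs_le_D1[OF abs_qform_le[of s]] \<open>0 \<le> C\<close>
    by (auto simp: qt C_def intro!: divide_nonneg_nonneg)
  moreover have "qform t f \<le> C / (1 + C) * (norm f)\<^sup>2" for f
    using pos_opD(2)[OF s, of f] \<open>0 \<le> C\<close> by (simp add: qt divide_right_mono)
  ultimately have nt: "norm t \<le> C / (1 + C)"
    by (rule pos_op_norm_le) (use \<open>0 \<le> C\<close> in simp)
  have "dist (F v) (F w) \<le> C / (1 + C) * dist v w" for v w
  proof -
    have "F v - F w = t o\<^sub>L (v - w)"
      by (rule blinfun_eqI) (simp add: F_def blinfun.diff_left blinfun.add_left blinfun.diff_right)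
    then have "norm (F v - F w) \<le> norm t * norm (v - w)"
      by (simp add: norm_blinfun_compose)
    also have "\<dots> \<le> C / (1 + C) * norm (v - w)"
      by (intro mult_right_mono nt) simp
    finally show ?thesis
      by (simp add: dist_norm)
  qed
  moreover have "F v \<in> cbounded_ops" if "v \<in> cbounded_ops" for v
    unfolding F_def using that tb by auto
  ultimately have "\<exists>!w. w \<in> cbounded_ops \<and> F w = w"
    using Banach_fix[of cbounded_ops "C / (1 + C)" F] closed_cbounded_ops cbounded_id \<open>0 \<le> C\<close>
    by (auto simp: complete_eq_closed)
  then obtain w where w: "w \<in> cbounded_ops" "F w = w"
    by blast
  define u where "u = (1 / (1 + C)) *\<^sub>R w"
  have inv: "u f + s (u f) = f" for f
  proof -
    have "w f = f + (1 / (1 + C)) *\<^sub>R (C *\<^sub>R w f - s (w f))"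
      using arg_cong[OF w(2), of "\<lambda>x. blinfun_apply x f"]
      by (simp add: F_def t_def blinfun.add_left blinfun.diff_left blinfun.scaleR_left)
    then have "w f - (C / (1 + C)) *\<^sub>R w f + (1 / (1 + C)) *\<^sub>R s (w f) = f"
      by (simp add: scaleR_diff_right algebra_simps)
    moreover have "w f - (C / (1 + C)) *\<^sub>R w f = (1 / (1 + C)) *\<^sub>R w f"
    proof -
      have "w f - (C / (1 + C)) *\<^sub>R w f = (1 - C / (1 + C)) *\<^sub>R w f"
        by (simp add: scaleR_diff_left)
      also have "1 - C / (1 + C) = 1 / (1 + C)"
        using \<open>0 \<le> C\<close> by (simp add: field_simps)
      finally show ?thesis .
    qed
    ultimately show ?thesis
      by (simp add: u_def blinfun.scaleR_left blinfun.scaleR_right)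
  qed
  have "selfadj u"
  proof (rule selfadjI)
    show "u \<in> cbounded_ops"
      unfolding u_def using w by auto
    fix f g
    have "cinner (u f) g = cinner (u f) (u g + s (u g))"
      by (simp add: inv)
    also have "\<dots> = cinner (u f + s (u f)) (u g)"
      by (simp add: cinner.add_left cinner.add_right selfadj_cinner[OF pos_opD(1)[OF s]])
    finally show "cinner (u f) g = cinner f (u g)"
      by (simp add: inv)
  qed
  with inv show ?thesis
    using that by blast
qed

lemma cut_exists:
  fixes s :: "'n::finite fock \<Rightarrow>\<^sub>L 'n fock"
  assumes s: "pos_op s"
  shows "\<exists>c. is_cut s c"
proof -
  obtain u where u: "selfadj u" "\<And>f. blinfun_apply u f + s (u f) = f"
    using resolvent_exists[OF s] by blast
  define c where "c = id_blinfun - u"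
  have eq: "(norm (f - g))\<^sup>2 + qform s g = qform c f + ((norm (g - u f))\<^sup>2 + qform s (g - u f))" for f g
  proof -
    have "inner g (s (u f)) = inner g f - inner g (u f)"
      using u(2)[of f] by (metis add_diff_cancel_left' inner_diff_right)
    moreover have "inner (u f) (s g) = inner (s (u f)) g"
      by (rule selfadj_inner[OF pos_opD(1)[OF s], symmetric])
    moreover have "inner (u f) (s (u f)) = inner (u f) f - inner (u f) (u f)"
      using u(2)[of f] by (metis add_diff_cancel_left' inner_diff_right)
    ultimately show ?thesis
      by (simp add: c_def qform_def power2_norm_eq_inner blinfun.diff_left blinfun.diff_right
          inner_diff_left inner_diff_right inner_commute)
  qed
  have "selfadj c"
    unfolding c_def by (intro selfadj_diff u selfadj_id)
  moreover have "qform c f \<le> (norm (f - g))\<^sup>2 + qform s g" for f g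
    unfolding eq using pos_opD(2)[OF s, of "g - u f"] by simp
  moreover have "qform c f = (norm (f - u f))\<^sup>2 + qform s (u f)" for f
    unfolding eq by (simp add: qform_def)
  ultimately show ?thesis
    unfolding is_cut_def by blast
qed

lemma cut_bounds:
  assumes "is_cut s c" and s: "pos_op s"
  shows "0 \<le> qform c f" "qform c f \<le> (norm f)\<^sup>2" "qform c f \<le> qform s f"
proof -
  obtain g where g: "qform c f = (norm (f - g))\<^sup>2 + qform s g"
    using assms(1) unfolding is_cut_def by blast
  then show "0 \<le> qform c f"
    using pos_opD(2)[OF s, of g] by simp
  have le: "qform c f \<le> (norm (f - g))\<^sup>2 + qform s g" for g
    using assms(1) unfolding is_cut_def by blast
  show "qform c f \<le> (norm f)\<^sup>2" "qform c f \<le> qform s f"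
    using le[of 0] le[of f] by (simp_all add: qform_def)
qed

text \<open>
  Both the monotonicity of cutting and, below, its compatibility with the Markov operator are read off
  from the variational formula.
\<close>

lemma cut_mono:
  assumes "is_cut s c" "is_cut s' c'" "\<And>g. qform s g \<le> qform s' g"
  shows "qform c f \<le> qform c' f"
proof -
  obtain g where "qform c' f = (norm (f - g))\<^sup>2 + qform s' g"
    using assms(2) unfolding is_cut_def by blast
  moreover have "qform c f \<le> (norm (f - g))\<^sup>2 + qform s g"
    using assms(1) unfolding is_cut_def by blast
  ultimately show ?thesis
    using assms(3)[of g] by linarith
qed

lemma qform_add_le:
  assumes y: "pos_op y"
  shows "qform y (f + g) \<le> 2 * qform y f + 2 * qform y g"
  using pos_opD(2)[OF y, of "f + (-1) *\<^sub>R g"] qform_plus_scaleR[OF pos_opD(1)[OF y], of f 1 g]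
    qform_plus_scaleR[OF pos_opD(1)[OF y], of f "-1" g]
  by simp

text \<open>
  What lies below both a multiple of the identity and \<open>s\<close> lies below a multiple of the cut of \<open>s\<close>: write
  \<open>f = (f - g) + g\<close> for a decomposition that is optimal for the cut, at the cost of the factor two.
\<close>

lemma le_cut:
  assumes c: "is_cut s c" and y: "pos_op y" "\<And>g. qform y g \<le> qform s g"
    and C: "\<And>g. qform y g \<le> C * (norm g)\<^sup>2" "1 \<le> C"
  shows "qform y f \<le> 2 * C * qform c f"
proof -
  obtain g where g: "qform c f = (norm (f - g))\<^sup>2 + qform s g"
    using c unfolding is_cut_def by blast
  have "qform y f \<le> 2 * qform y (f - g) + 2 * qform y g"
    using qform_add_le[OF y(1), of "f - g" g] by simp
  moreover have "qform y (f - g) \<le> C * (norm (f - g))\<^sup>2"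
    by (rule C(1))
  moreover have "qform y g \<le> C * qform s g"
    using y(2)[of g] mult_right_mono[OF C(2), of "qform s g"] pos_opD(2)[OF y(1), of g] by simp
  ultimately show ?thesis
    by (simp add: g algebra_simps)
qed

context fock_basis
begin

text \<open>
  Averaging the variational formula over the vectors \<open>L i f\<close> shows that the cut of a harmonic
  operator is superharmonic.
\<close>

lemma markov_cut_le:
  assumes c: "is_cut s c" and s: "s \<in> M"
  shows "qform (avg L c) f \<le> qform c f"
proof -
  obtain g where g: "qform c f = (norm (f - g))\<^sup>2 + qform s g"
    using c unfolding is_cut_def by blast
  have "qform c (L i f) \<le> (norm (f - g))\<^sup>2 + qform s (L i g)" for i
  proof -
    have "norm (L i f - L i g) = norm (f - g)"
      using isometries_norm[OF isometries_L, of i "f - g"] by (simp add: blinfun.diff_right)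
    then show ?thesis
      using c unfolding is_cut_def by metis
  qed
  then have "qform (avg L c) f \<le> (\<Sum>i\<in>(UNIV :: 'n set). (norm (f - g))\<^sup>2 + qform s (L i g)) / real CARD('n)"
    unfolding qform_avg[OF isometries_L] by (intro divide_right_mono sum_mono) auto
  also have "\<dots> = (norm (f - g))\<^sup>2 + qform (avg L s) g"
    by (simp add: qform_avg[OF isometries_L] sum.distrib add_divide_distrib)
  finally show ?thesis
    by (simp add: M_avg[OF s] g)
qed

lemma superharmonic_limit:
  assumes c: "pos_op c" and super: "\<And>f. qform (avg L c) f \<le> qform c f"
  obtains z where "z \<in> M" "pos_op z" "\<And>f. (\<lambda>k. (avg L ^^ k) c f) \<longlonglongrightarrow> blinfun_apply z f"
    "\<And>f. qform z f \<le> qform c f"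
proof -
  have sa: "selfadj ((avg L ^^ k) c)" for k
    by (rule avg_pow_selfadj[OF isometries_L pos_opD(1)[OF c]])
  have dec: "qform ((avg L ^^ Suc k) c) f \<le> qform ((avg L ^^ k) c) f" for k f
    using avg_pow_mono[OF isometries_L super] by (simp only: funpow_Suc_right comp_def)
  have nonneg: "0 \<le> qform ((avg L ^^ k) c) f" for k f
  proof (induction k arbitrary: f)
    case 0
    show ?case using pos_opD(2)[OF c] by simp
  next
    case (Suc k)
    then show ?case by (auto simp: qform_avg[OF isometries_L] intro!: divide_nonneg_nonneg sum_nonneg)
  qed
  obtain z where z: "pos_op z" "\<And>f. (\<lambda>k. (avg L ^^ k) c f) \<longlonglongrightarrow> blinfun_apply z f"
    "\<And>f k. qform z f \<le> qform ((avg L ^^ k) c) f"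
    using decseq_operators_converge[of "\<lambda>k. (avg L ^^ k) c", OF sa dec nonneg] by blast
  have "z \<in> M"
    by (rule markov_limit_in_M[OF _ z(2)]) (use pos_opD(1)[OF c] in auto)
  then show ?thesis
    using that[of z] z z(3)[of _ 0] by simp
qed

text \<open>
  A noncommutative substitute for the pointwise supremum of a bounded sequence whose vacuum
  expectations are summable. The partial sums of the tails are unbounded, so they are cut off;
  the cut partial sums increase to superharmonic operators, whose Markov iterates decrease to
  harmonic ones.
\<close>

lemma harmonic_majorants:
  assumes Y: "\<And>j. Y j \<in> M" "\<And>j. pos_op (Y j)" and C: "\<And>j f. qform (Y j) f \<le> C * (norm f)\<^sup>2" "1 \<le> C"
    and vac: "\<And>j. qform (Y j) \<Omega> \<le> (1/2) ^ j"
  obtains Z where "\<And>k. Z k \<in> M" "\<And>k. pos_op (Z k)" "\<And>k f. qform (Z (Suc k)) f \<le> qform (Z k) f"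
    "\<And>k f. qform (Y k) f \<le> 2 * C * qform (Z k) f" "\<And>k. qform (Z k) \<Omega> \<le> 2 * (1/2) ^ k"
proof -
  define s where "s k m = (\<Sum>j\<in>{k..<m}. Y j)" for k m
  have qs: "qform (s k m) f = (\<Sum>j\<in>{k..<m}. qform (Y j) f)" for k m f
    by (simp add: s_def qform_sum)
  have sM: "s k m \<in> M" for k m
    unfolding s_def by (intro M_sum Y)
  have sp: "pos_op (s k m)" for k m
    unfolding pos_op_def qs using pos_opD[OF Y(2)]
    by (auto simp: s_def intro!: sum_nonneg selfadj_sum)
  define c where "c k m = (SOME c. is_cut (s k m) c)" for k m
  have c: "is_cut (s k m) (c k m)" for k m
    unfolding c_def using someI_ex[OF cut_exists[OF sp]] .
  have sac: "selfadj (c k m)" for k m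
    using c by (simp add: is_cut_def)
  note bounds = cut_bounds[OF c sp]
  have inc: "qform (c k m) f \<le> qform (c k (Suc m)) f" for k m f
    by (rule cut_mono[OF c c]) (use pos_opD(2)[OF Y(2)] in \<open>auto simp: qs intro!: sum_mono2\<close>)
  have "\<exists>x. selfadj x \<and> (\<forall>f. (\<lambda>m. c k m f) \<longlonglongrightarrow> blinfun_apply x f) \<and> (\<forall>f m. qform (c k m) f \<le> qform x f)" for k
    using incseq_operators_converge[of "c k" 1, OF sac inc] bounds(2) by (metis mult_1)
  then obtain d where d: "\<And>k. selfadj (d k)" "\<And>k f. (\<lambda>m. c k m f) \<longlonglongrightarrow> blinfun_apply (d k) f"
    "\<And>k f m. qform (c k m) f \<le> qform (d k) f"
    by metis
  have dp: "pos_op (d k)" for k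
    unfolding pos_op_def using d(1) d(3)[of k 0] bounds(1) order_trans by blast
  have super: "qform (avg L (d k)) f \<le> qform (d k) f" for k f
  proof (rule tendsto_le[OF _ tendsto_qform[OF d(2)] tendsto_qform[OF tendsto_avg[OF isometries_L d(2)]]])
    show "\<forall>\<^sub>F m in sequentially. qform (avg L (c k m)) f \<le> qform (c k m) f"
      using markov_cut_le[OF c sM] by simp
  qed simp
  have "\<exists>z. z \<in> M \<and> pos_op z \<and> (\<forall>f. (\<lambda>i. (avg L ^^ i) (d k) f) \<longlonglongrightarrow> blinfun_apply z f)
      \<and> (\<forall>f. qform z f \<le> qform (d k) f)" for k
    using superharmonic_limit[OF dp super] by metis
  then obtain Z where Z: "\<And>k. Z k \<in> M" "\<And>k. pos_op (Z k)"
    "\<And>k f. (\<lambda>i. (avg L ^^ i) (d k) f) \<longlonglongrightarrow> blinfun_apply (Z k) f"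
    "\<And>k f. qform (Z k) f \<le> qform (d k) f"
    by metis
  have dec: "qform (d (Suc k)) f \<le> qform (d k) f" for k f
  proof (rule tendsto_upperbound[OF tendsto_qform[OF d(2)]])
    have "qform (c (Suc k) m) f \<le> qform (c k m) f" for m
      by (rule cut_mono[OF c c]) (use pos_opD(2)[OF Y(2)] in \<open>auto simp: qs intro!: sum_mono2\<close>)
    then show "\<forall>\<^sub>F m in sequentially. qform (c (Suc k) m) f \<le> qform (d k) f"
      using d(3) order_trans by (intro always_eventually allI) blast
  qed simp
  have lower: "qform (Y k) f \<le> 2 * C * qform (d k) f" for k f
  proof -
    have "qform (Y k) f \<le> 2 * C * qform (c k (Suc k)) f"
      by (rule le_cut[OF c Y(2) _ C]) (simp add: qs)
    also have "\<dots> \<le> 2 * C * qform (d k) f"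
      using d(3) C(2) by (intro mult_left_mono) auto
    finally show ?thesis .
  qed
  have vacd: "qform (d k) \<Omega> \<le> 2 * (1/2) ^ k" for k
  proof (rule tendsto_upperbound[OF tendsto_qform[OF d(2)]])
    have "qform (c k m) \<Omega> \<le> 2 * (1/2) ^ k" for m
    proof -
      have "qform (c k m) \<Omega> \<le> (\<Sum>j\<in>{k..<m}. (1/2) ^ j)"
        using bounds(3)[of k m \<Omega>] sum_mono[of "{k..<m}" "\<lambda>j. qform (Y j) \<Omega>" "\<lambda>j. (1/2) ^ j"] vac
        unfolding qs by fastforce
      also have "\<dots> \<le> 2 * (1/2) ^ k"
      proof (cases "k \<le> m")
        case True
        then have "(\<Sum>j\<in>{k..<m}. (1/2 :: real) ^ j) = 2 * (1/2) ^ k - 2 * (1/2) ^ m"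
          by (induction m rule: dec_induct) auto
        then show ?thesis by simp
      qed simp
      finally show ?thesis .
    qed
    then show "\<forall>\<^sub>F m in sequentially. qform (c k m) \<Omega> \<le> 2 * (1/2) ^ k"
      by simp
  qed simp
  show ?thesis
  proof (rule that[of Z])
    show "qform (Z (Suc k)) f \<le> qform (Z k) f" for k f
    proof (rule tendsto_le[OF _ tendsto_qform[OF Z(3)] tendsto_qform[OF Z(3)]])
      show "\<forall>\<^sub>F i in sequentially. qform ((avg L ^^ i) (d (Suc k))) f \<le> qform ((avg L ^^ i) (d k)) f"
        using avg_pow_mono[OF isometries_L dec] by simp
    qed simp
    show "qform (Y k) f \<le> 2 * C * qform (Z k) f" for k f
    proof (rule tendsto_lowerbound[OF tendsto_mult[OF tendsto_const tendsto_qform[OF Z(3)]]])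
      have "qform (Y k) f \<le> 2 * C * qform ((avg L ^^ i) (d k)) f" for i
        using avg_pow_mono[OF isometries_L, of "Y k" "(2 * C) *\<^sub>R d k" i f] lower
        by (simp add: qform_scaleR avg_pow_scaleR[OF isometries_L] avg_pow_fixed[OF isometries_L M_avg[OF Y(1)]])
      then show "\<forall>\<^sub>F i in sequentially. qform (Y k) f \<le> 2 * C * qform ((avg L ^^ i) (d k)) f"
        by simp
    qed simp
    show "qform (Z k) \<Omega> \<le> 2 * (1/2) ^ k" for k
      using Z(4)[of k \<Omega>] vacd[of k] by simp
  qed (use Z in auto)
qed

section \<open>Automorphisms\<close>

text \<open>
  By invariance under \<open>E\<close>, if \<open>\<phi>\<close> vanishes on a positive harmonic \<open>x\<close> then it vanishes on all \<open>r\<^sub>i\<^sup>* x r\<^sub>i\<close>. By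
  induction the form of \<open>x\<close> vanishes on all words.
\<close>

lemma vacuum_faithful:
  assumes "x \<in> M" "pos_op x" "qform x \<Omega> = 0"
  shows "x = 0"
proof (rule blinfun_eq_on_words)
  have words: "qform x (Rw w \<Omega>) = 0" if "x \<in> M" "pos_op x" "qform x \<Omega> = 0" for x w
    using that
  proof (induction w arbitrary: x)
    case (Cons i w)
    let ?y = "\<lambda>i. adj (R i) o\<^sub>L (x o\<^sub>L R i)"
    have qy: "qform (?y i) f = qform x (R i f)" for i f
      by (simp add: qform_def inner_eq_Re_cinner cinner_adj_right cbounded_right_creation)
    have nonneg: "0 \<le> qform x f" for f
      by (rule pos_opD(2)[OF Cons.prems(2)])
    have "(\<Sum>i\<in>UNIV. qform x (R i \<Omega>)) / real CARD('n) = 0"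
      using vac_avg_R[OF Cons.prems(1)] Cons.prems(3) by (simp add: qform_avg[OF isometries_R, symmetric] qform_vacuum)
    then have "qform (?y i) \<Omega> = 0"
      unfolding qy using nonneg by (simp add: sum_nonneg_eq_0_iff)
    moreover have "?y i \<in> M"
      using Cons.prems(1) by auto
    moreover have "pos_op (?y i)"
      unfolding pos_op_def selfadj_def qy using nonneg pos_opD(1)[OF Cons.prems(2)]
      by (auto simp: adj_compose cbounded_right_creation cbounded_adj cbounded_compose selfadj_def
          compose_assoc_blinfun)
    ultimately have "qform (?y i) (Rw w \<Omega>) = 0"
      by (intro Cons.IH)
    then show ?case
      by (simp add: qy)
  qed simp
  show "x (ket w) = blinfun_apply 0 (ket w)" for w
    using pos_op_eq_0[OF assms(2) words[OF assms, of "rev w"]] by (simp add: Rw_vacuum)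
qed (use assms in \<open>auto simp: M_cbounded\<close>)

context
  fixes \<theta>
  assumes \<theta>: "\<theta> \<in> H_infty_auto e"
begin

lemma auto_bij: "bij_betw \<theta> M M"
  using \<theta> by (simp add: H_infty_auto_def Bij_def)

lemma auto_mem [intro]: "x \<in> M \<Longrightarrow> \<theta> x \<in> M"
  using auto_bij bij_betwE by blast

lemma auto_surj: "y \<in> M \<Longrightarrow> \<exists>x\<in>M. \<theta> x = y"
  using auto_bij by (metis bij_betw_def imageE)

lemma auto_add: "x \<in> M \<Longrightarrow> y \<in> M \<Longrightarrow> \<theta> (x + y) = \<theta> x + \<theta> y"
  using \<theta> by (simp add: H_infty_auto_def)

lemma auto_scaleC: "x \<in> M \<Longrightarrow> \<theta> (op_scaleC c x) = op_scaleC c (\<theta> x)"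
  using \<theta> by (simp add: H_infty_auto_def)

lemma auto_choi: "x \<in> M \<Longrightarrow> y \<in> M \<Longrightarrow> \<theta> (x \<odot> y) = \<theta> x \<odot> \<theta> y"
  using \<theta> by (simp add: H_infty_auto_def)

lemma auto_adj: "x \<in> M \<Longrightarrow> \<theta> (adj x) = adj (\<theta> x)"
  using \<theta> by (simp add: H_infty_auto_def)

lemma auto_scaleR: "x \<in> M \<Longrightarrow> \<theta> (t *\<^sub>R x) = t *\<^sub>R \<theta> x"
  using auto_scaleC[of x "complex_of_real t"] by (simp add: op_scaleC_of_real)

lemma auto_diff: "x \<in> M \<Longrightarrow> y \<in> M \<Longrightarrow> \<theta> (x - y) = \<theta> x - \<theta> y"
  using auto_add[of x "(-1) *\<^sub>R y"] auto_scaleR[of y "-1"] M_scaleR[of y "-1"] by simp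

lemma auto_zero: "\<theta> 0 = 0"
  using auto_diff[of 0 0] by simp

lemma auto_sum: "(\<And>i. i \<in> A \<Longrightarrow> F i \<in> M) \<Longrightarrow> \<theta> (\<Sum>i\<in>A. F i) = (\<Sum>i\<in>A. \<theta> (F i))"
  by (induction A rule: infinite_finite_induct) (auto simp: auto_zero auto_add M_sum)

lemma auto_id: "\<theta> id_blinfun = id_blinfun"
proof -
  obtain u where u: "u \<in> M" "\<theta> u = id_blinfun"
    using auto_surj[OF M_id] by blast
  have "\<theta> id_blinfun = \<theta> id_blinfun \<odot> \<theta> u"
    unfolding u(2) by (rule choi_id_right[OF auto_mem[OF M_id], symmetric])
  also have "\<dots> = \<theta> u"
    using auto_choi[OF M_id u(1)] by (simp add: choi_id_left[OF u(1)])
  finally show ?thesis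
    by (simp add: u(2))
qed

text \<open>
  \<open>\<theta>\<close> maps squares \<open>y\<^sup>* \<circ> y\<close> to squares, and every \<open>x + \<epsilon>\<close> with \<open>x\<close> positive is one.
\<close>

lemma auto_pos:
  assumes x: "x \<in> M" "pos_op x"
  shows "pos_op (\<theta> x)"
  unfolding pos_op_def
proof (intro conjI allI)
  show "selfadj (\<theta> x)"
    using x auto_adj[OF x(1)] M_cbounded[OF auto_mem[OF x(1)]] by (auto simp: selfadj_def pos_op_def)
  fix f
  show "0 \<le> qform (\<theta> x) f"
  proof (rule field_le_epsilon)
    fix \<delta> :: real
    assume "0 < \<delta>"
    define \<epsilon> where "\<epsilon> = \<delta> / ((norm f)\<^sup>2 + 1)"
    have "0 < \<epsilon>"
      using \<open>0 < \<delta>\<close> by (simp add: \<epsilon>_def add_nonneg_pos)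
    then obtain y where y: "y \<in> M" "x + \<epsilon> *\<^sub>R id_blinfun = adj y \<odot> y"
      using positive_plus_scalar_is_square[OF x] by blast
    have "\<theta> x + \<epsilon> *\<^sub>R id_blinfun = \<theta> (x + \<epsilon> *\<^sub>R id_blinfun)"
      using x by (simp add: auto_add auto_scaleR auto_id M_scaleR)
    also have "\<dots> = adj (\<theta> y) \<odot> \<theta> y"
      using y by (simp add: auto_choi auto_adj M_adj)
    finally have "0 \<le> qform (\<theta> x + \<epsilon> *\<^sub>R id_blinfun) f"
      using pos_opD(2)[OF pos_op_choi_square[OF auto_mem[OF y(1)]]] by simp
    moreover have "\<epsilon> * (norm f)\<^sup>2 \<le> \<delta>"
    proof -
      have "\<epsilon> * (norm f)\<^sup>2 \<le> \<epsilon> * ((norm f)\<^sup>2 + 1)"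
        using \<open>0 < \<epsilon>\<close> by simp
      also have "\<dots> = \<delta>"
        using add_nonneg_pos[OF zero_le_power2[of "norm f"] zero_less_one] by (simp add: \<epsilon>_def)
      finally show ?thesis .
    qed
    ultimately show "0 \<le> qform (\<theta> x) f + \<delta>"
      by (simp add: qform_add qform_scaleR)
  qed
qed

lemma auto_mono:
  assumes "x \<in> M" "y \<in> M" "selfadj x" "selfadj y" "\<And>f. qform x f \<le> qform y f"
  shows "qform (\<theta> x) f \<le> qform (\<theta> y) f"
proof -
  have "pos_op (y - x)"
    using assms by (auto simp: pos_op_def qform_diff)
  then have "pos_op (\<theta> (y - x))"
    using assms by (intro auto_pos) auto
  then show ?thesis
    using pos_opD(2)[of "\<theta> (y - x)" f] assms by (simp add: auto_diff qform_diff)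
qed

lemma auto_inverse: "restrict (inv_into M \<theta>) M \<in> H_infty_auto e"
proof -
  let ?i = "inv_into M \<theta>"
  have bij: "\<theta> \<in> Bij M"
    using \<theta> by (simp add: H_infty_auto_def)
  have mem: "?i x \<in> M" if "x \<in> M" for x
    by (rule Bij_inv_into_mem[OF bij that])
  have ri: "\<theta> (?i x) = x" if "x \<in> M" for x
    using bij_betw_inv_into_right[OF auto_bij that] .
  have li: "?i (\<theta> x) = x" if "x \<in> M" for x
    using bij_betw_inv_into_left[OF auto_bij that] .
  have "?i (x + y) = ?i x + ?i y" if "x \<in> M" "y \<in> M" for x y
    using li[of "?i x + ?i y"] that mem by (simp add: auto_add ri M_add)
  moreover have "?i (op_scaleC c x) = op_scaleC c (?i x)" if "x \<in> M" for c x
    using li[of "op_scaleC c (?i x)"] that mem by (simp add: auto_scaleC ri M_scaleC)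
  moreover have "?i (x \<odot> y) = ?i x \<odot> ?i y" if "x \<in> M" "y \<in> M" for x y
    using li[of "?i x \<odot> ?i y"] that mem by (simp add: auto_choi ri choi_in_M)
  moreover have "?i (adj x) = adj (?i x)" if "x \<in> M" for x
    using li[of "adj (?i x)"] that mem by (simp add: auto_adj ri M_adj)
  ultimately show ?thesis
    using restrict_inv_into_Bij[OF bij]
    by (simp add: H_infty_auto_def M_add M_scaleC choi_in_M M_adj)
qed

end

text \<open>
  Automorphisms are normal, in the form needed: since they and their inverses preserve the order,
  they preserve the infimum of a decreasing sequence.
\<close>

lemma auto_preserves_null_sequences:
  assumes \<theta>: "\<theta> \<in> H_infty_auto e"
    and Z: "\<And>k. Z k \<in> M" "\<And>k. pos_op (Z k)" "\<And>k f. qform (Z (Suc k)) f \<le> qform (Z k) f"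
    and null: "(\<lambda>k. qform (Z k) \<Omega>) \<longlonglongrightarrow> 0"
  shows "(\<lambda>k. qform (\<theta> (Z k)) \<Omega>) \<longlonglongrightarrow> 0"
proof -
  note bij = auto_bij[OF \<theta>] and mem = auto_mem[OF \<theta>] and inv = auto_inverse[OF \<theta>]
  have pos: "pos_op (\<theta> (Z k))" for k
    by (rule auto_pos[OF \<theta> Z(1,2)])
  note sa = pos_opD(1)[OF pos]
  have dec: "qform (\<theta> (Z (Suc k))) f \<le> qform (\<theta> (Z k)) f" for k f
    by (rule auto_mono[OF \<theta> Z(1) Z(1) pos_opD(1)[OF Z(2)] pos_opD(1)[OF Z(2)] Z(3)])
  obtain w where w: "pos_op w" "\<And>f. (\<lambda>k. \<theta> (Z k) f) \<longlonglongrightarrow> blinfun_apply w f"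
    "\<And>f k. qform w f \<le> qform (\<theta> (Z k)) f"
    using decseq_operators_converge[of "\<lambda>k. \<theta> (Z k)", OF sa dec pos_opD(2)[OF pos]] by blast
  have "w \<in> M"
    by (rule M_limit[OF mem[OF Z(1)] w(2)])
  define v where "v = restrict (inv_into M \<theta>) M w"
  have "v \<in> M" "pos_op v"
    unfolding v_def by (rule auto_mem[OF inv \<open>w \<in> M\<close>], rule auto_pos[OF inv \<open>w \<in> M\<close> w(1)])
  have "\<theta> v = w"
    using bij_betw_inv_into_right[OF bij \<open>w \<in> M\<close>] \<open>w \<in> M\<close> by (simp add: v_def)
  have "qform v \<Omega> \<le> qform (restrict (inv_into M \<theta>) M (\<theta> (Z k))) \<Omega>" for k
    unfolding v_def by (rule auto_mono[OF inv \<open>w \<in> M\<close> mem[OF Z(1)] pos_opD(1)[OF w(1)] sa w(3)])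
  then have "qform v \<Omega> \<le> qform (Z k) \<Omega>" for k
    using bij_betw_inv_into_left[OF bij Z(1)] mem[OF Z(1)] by simp
  then have "qform v \<Omega> \<le> 0"
    by (intro LIMSEQ_le_const[OF null]) auto
  then have "v = 0"
    using vacuum_faithful[OF \<open>v \<in> M\<close> \<open>pos_op v\<close>] pos_opD(2)[OF \<open>pos_op v\<close>, of \<Omega>] by simp
  then have "w = 0"
    using \<open>\<theta> v = w\<close> auto_zero[OF \<theta>] by simp
  then show ?thesis
    using tendsto_qform[OF w(2), of \<Omega>] by simp
qed

section \<open>Rigidity\<close>

context
  fixes \<theta>
  assumes \<theta>: "\<theta> \<in> H_infty_auto e" and fixR: "\<And>\<xi>. \<theta> (right_creation e \<xi>) = right_creation e \<xi>"
begin

text \<open>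
  Multiplication by \<open>r\<^sub>\<xi>\<close> from the right and by \<open>r\<^sub>\<xi>\<^sup>*\<close> from the left stays inside the harmonic operators, so
  there the operator product is the Choi-Effros product, and \<open>\<theta>\<close> respects it.
\<close>

lemma fixed_compose_right: "x \<in> M \<Longrightarrow> \<theta> (x o\<^sub>L right_creation e \<xi>) = \<theta> x o\<^sub>L right_creation e \<xi>"
  using auto_choi[OF \<theta> _ right_creation_in_M, of x \<xi>]
  by (simp add: choi_eq_compose M_right_creation fixR auto_mem[OF \<theta>])

lemma fixed_compose_left:
  "x \<in> M \<Longrightarrow> \<theta> (adj (right_creation e \<xi>) o\<^sub>L x) = adj (right_creation e \<xi>) o\<^sub>L \<theta> x"
  using auto_choi[OF \<theta> M_adj[OF right_creation_in_M], of x \<xi>]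
  by (simp add: choi_eq_compose M_adj_right_creation fixR auto_mem[OF \<theta>] auto_adj[OF \<theta> right_creation_in_M])

lemma fixed_avg_R: "x \<in> M \<Longrightarrow> \<theta> (avg R x) = avg R (\<theta> x)"
  unfolding avg_def
  by (simp add: auto_scaleR[OF \<theta>] auto_sum[OF \<theta>] M_sum M_right_creation M_adj_right_creation
      fixed_compose_right fixed_compose_left)

lemma fixed_avg_R_pow: "x \<in> M \<Longrightarrow> \<theta> ((avg R ^^ k) x) = (avg R ^^ k) (\<theta> x)"
  by (induction k) (simp_all add: fixed_avg_R M_avg_R_pow)

text \<open>
  With \<open>D = \<phi> (\<theta> x) - \<phi> x\<close> one has \<open>\<phi> (\<theta> h\<^sub>j) = D\<close> for all \<open>h\<^sub>j = E\<^sup>k x - \<phi> x\<close>, where \<open>k\<close> is chosen such that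
  \<open>\<phi> (h\<^sub>j \<circ> h\<^sub>j) \<le> 2\<^sup>-\<^sup>j\<close>. If \<open>Z\<^sub>j\<close> are the decreasing majorants of the \<open>h\<^sub>j \<circ> h\<^sub>j\<close>, then \<open>\<bar>D\<bar>\<^sup>2\<close> is bounded by a
  multiple of \<open>\<phi> (\<theta> Z\<^sub>j)\<close>, which tends to zero.
\<close>

lemma vac_fixed_selfadj:
  assumes x: "x \<in> M" "selfadj x"
  shows "vac (\<theta> x) = vac x"
proof -
  have "\<exists>k. \<forall>i. sqn i ((avg R ^^ k) x - op_scaleC (vac x) id_blinfun) \<le> (1/2) ^ j" for j
    by (rule mean_ergodic[OF x(1)]) simp
  then obtain k where k: "\<And>j i. sqn i ((avg R ^^ k j) x - op_scaleC (vac x) id_blinfun) \<le> (1/2) ^ j"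
    by metis
  define h where "h j = (avg R ^^ k j) x - op_scaleC (vac x) id_blinfun" for j
  define Y where "Y j = h j \<odot> h j" for j
  have hM: "h j \<in> M" for j
    unfolding h_def using x by auto
  have "op_scaleC (vac x) id_blinfun = qform x \<Omega> *\<^sub>R (id_blinfun :: 'n fock \<Rightarrow>\<^sub>L 'n fock)"
    by (simp add: cinner_selfadj[OF x(2)] op_scaleC_of_real)
  then have "selfadj (h j)" for j
    unfolding h_def using x by (auto intro: avg_pow_selfadj[OF isometries_R])
  then have adjh: "adj (h j) = h j" for j
    by (simp add: selfadj_def)
  have YM: "Y j \<in> M" for j
    unfolding Y_def using hM by auto
  have Yp: "pos_op (Y j)" for j
    using pos_op_choi_square[OF hM[of j]] by (simp add: Y_def adjh)
  define C where "C = (2 * norm x)\<^sup>2 + 1"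
  have YC: "qform (Y j) f \<le> C * (norm f)\<^sup>2" for j f
  proof -
    have id1: "norm (id_blinfun :: 'n fock \<Rightarrow>\<^sub>L 'n fock) \<le> 1"
      by (rule norm_blinfun_bound) auto
    have "cmod (vac x) \<le> norm x"
      using cinner_le_norm[of \<Omega> "x \<Omega>"] norm_blinfun[of x \<Omega>] by simp
    then have "norm (op_scaleC (vac x) (id_blinfun :: 'n fock \<Rightarrow>\<^sub>L 'n fock)) \<le> norm x"
      using norm_op_scaleC[of "vac x" "id_blinfun :: 'n fock \<Rightarrow>\<^sub>L 'n fock"] mult_left_mono[OF id1, of "cmod (vac x)"] by simp
    then have "norm (h j) \<le> 2 * norm x"
      using norm_triangle_ineq4[of "(avg R ^^ k j) x" "op_scaleC (vac x) id_blinfun"]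
        norm_avg_pow_le[OF isometries_R, of "k j" x] unfolding h_def by linarith
    then have "norm (h j) * norm (h j) \<le> (2 * norm x)\<^sup>2"
      unfolding power2_eq_square by (intro mult_mono) auto
    then have "norm (Y j) \<le> C"
      using norm_choi_le[OF hM[of j] hM[of j]] unfolding Y_def C_def by linarith
    then show ?thesis
      using abs_le_D1[OF abs_qform_le[of "Y j" f]] mult_right_mono[of "norm (Y j)" C "(norm f)\<^sup>2"]
      by simp
  qed
  have "qform (Y j) \<Omega> \<le> (1/2) ^ j" for j
  proof (rule tendsto_upperbound)
    show "(\<lambda>i. sqn i (h j)) \<longlonglongrightarrow> qform (Y j) \<Omega>"
      unfolding sqn_def Y_def adjh by (rule tendsto_qform[OF choi_tendsto[OF hM hM]])
    show "\<forall>\<^sub>F i in sequentially. sqn i (h j) \<le> (1/2) ^ j"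
      using k by (simp add: h_def)
  qed simp
  then obtain Z where Z: "\<And>k. Z k \<in> M" "\<And>k. pos_op (Z k)" "\<And>k f. qform (Z (Suc k)) f \<le> qform (Z k) f"
    "\<And>k f. qform (Y k) f \<le> 2 * C * qform (Z k) f" "\<And>k. qform (Z k) \<Omega> \<le> 2 * (1/2) ^ k"
    using harmonic_majorants[of Y C, OF YM Yp YC] by (auto simp: C_def)
  have "(\<lambda>k. qform (Z k) \<Omega>) \<longlonglongrightarrow> 0"
  proof (rule real_tendsto_sandwich[of "\<lambda>_. 0" _ _ "\<lambda>k. 2 * (1/2) ^ k"])
    have "(\<lambda>k. 2 * (1/2 :: real) ^ k) \<longlonglongrightarrow> 2 * 0"
      by (intro tendsto_mult tendsto_const LIMSEQ_power_zero) simp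
    then show "(\<lambda>k. 2 * (1/2 :: real) ^ k) \<longlonglongrightarrow> 0"
      by simp
  qed (use Z(5) pos_opD(2)[OF Z(2)] in simp_all)
  from auto_preserves_null_sequences[OF \<theta> Z(1-3) this]
  have "(\<lambda>k. 2 * C * qform (\<theta> (Z k)) \<Omega>) \<longlonglongrightarrow> 2 * C * 0"
    by (intro tendsto_mult tendsto_const)
  then have lim: "(\<lambda>k. 2 * C * qform (\<theta> (Z k)) \<Omega>) \<longlonglongrightarrow> 0"
    by simp
  have le: "(cmod (vac (\<theta> x) - vac x))\<^sup>2 \<le> 2 * C * qform (\<theta> (Z j)) \<Omega>" for j
  proof -
    have "\<theta> (h j) = (avg R ^^ k j) (\<theta> x) - op_scaleC (vac x) id_blinfun"
      using x by (simp add: h_def auto_diff[OF \<theta>] M_avg_R_pow M_scaleC fixed_avg_R_pow auto_scaleC[OF \<theta>]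
          auto_id[OF \<theta>])
    then have "vac (\<theta> (h j)) = vac (\<theta> x) - vac x"
      using x by (simp add: blinfun.diff_left cinner.diff_right vac_avg_R_pow auto_mem[OF \<theta>]
          cinner_scaleC_right cinner_self)
    then have "cmod (vac (\<theta> x) - vac x) \<le> norm (\<theta> (h j) \<Omega>)"
      using cinner_le_norm[of \<Omega> "\<theta> (h j) \<Omega>"] by simp
    then have "(cmod (vac (\<theta> x) - vac x))\<^sup>2 \<le> (norm (\<theta> (h j) \<Omega>))\<^sup>2"
      by (rule power_mono) simp
    also have "\<dots> \<le> qform (adj (\<theta> (h j)) \<odot> \<theta> (h j)) \<Omega>"
      by (intro norm_square_le_choi auto_mem[OF \<theta>] hM)
    also have "adj (\<theta> (h j)) \<odot> \<theta> (h j) = \<theta> (Y j)"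
      using auto_adj[OF \<theta> hM, of j] by (simp add: Y_def adjh auto_choi[OF \<theta> hM hM])
    also have "qform (\<theta> (Y j)) \<Omega> \<le> qform (\<theta> ((2 * C) *\<^sub>R Z j)) \<Omega>"
      using Z YM Yp by (intro auto_mono[OF \<theta>]) (auto simp: qform_scaleR pos_opD(1) intro!: selfadj_scaleR)
    also have "\<dots> = 2 * C * qform (\<theta> (Z j)) \<Omega>"
      by (simp add: auto_scaleR[OF \<theta> Z(1)] qform_scaleR)
    finally show ?thesis .
  qed
  have "(cmod (vac (\<theta> x) - vac x))\<^sup>2 \<le> 0"
    by (rule LIMSEQ_le_const[OF lim]) (use le in auto)
  then show ?thesis
    by simp
qed

lemma vac_fixed:
  assumes x: "x \<in> M"
  shows "vac (\<theta> x) = vac x"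
proof -
  define a where "a = x + adj x"
  define b where "b = op_scaleC \<i> (x - adj x)"
  note xb = M_cbounded[OF x]
  have ab: "a \<in> M" "b \<in> M" "selfadj a" "selfadj b"
  proof -
    show "a \<in> M" "b \<in> M"
      using x by (auto simp: a_def b_def)
    show "selfadj a"
      using xb by (auto simp: a_def selfadj_def adj_add cbounded_adj add.commute)
    have "adj b = op_scaleC (- \<i>) (adj x - x)"
      using xb by (simp add: b_def adj_scaleC adj_diff cbounded_diff cbounded_adj)
    also have "\<dots> = b"
      by (rule blinfun_eqI) (simp add: b_def blinfun.diff_left scaleC.diff_right scaleC.minus_left)
    finally show "selfadj b"
      using \<open>b \<in> M\<close> by (simp add: selfadj_def M_cbounded)
  qed
  have eq: "x = op_scaleC (1/2) a + op_scaleC (- \<i> / 2) b"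
  proof (rule blinfun_cinner_eqI)
    show "cinner f (x g) = cinner f ((op_scaleC (1/2) a + op_scaleC (- \<i> / 2) b) g)" for f g
      by (simp add: a_def b_def blinfun.add_left blinfun.diff_left cinner.add_right cinner.diff_right
          cinner_scaleC_right algebra_simps)
  qed
  have "\<theta> x = op_scaleC (1/2) (\<theta> a) + op_scaleC (- \<i> / 2) (\<theta> b)"
    using ab by (subst eq) (simp add: auto_add[OF \<theta>] auto_scaleC[OF \<theta>] M_scaleC)
  then have "vac (\<theta> x) = 1/2 * vac (\<theta> a) + (- \<i> / 2) * vac (\<theta> b)"
    by (simp add: blinfun.add_left cinner.add_right cinner_scaleC_right)
  also have "\<dots> = 1/2 * vac a + (- \<i> / 2) * vac b"
    using ab by (simp add: vac_fixed_selfadj)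
  also have "\<dots> = vac x"
    using arg_cong[OF eq, of "\<lambda>z. cinner \<Omega> (blinfun_apply z \<Omega>)"]
    by (simp add: blinfun.add_left cinner.add_right cinner_scaleC_right)
  finally show ?thesis .
qed

lemma fixed_identity:
  assumes x: "x \<in> M"
  shows "\<theta> x = x"
proof -
  have "cinner (Rw a \<Omega>) (\<theta> x (Rw b \<Omega>)) = cinner (Rw a \<Omega>) (x (Rw b \<Omega>))" if "x \<in> M" for a b x
    using that
  proof (induction a arbitrary: x)
    case Nil
    then show ?case
    proof (induction b arbitrary: x)
      case (Cons i b)
      show ?case
        using Cons.IH[of "x o\<^sub>L R i"] Cons.prems by (simp add: fixed_compose_right M_right_creation)
    qed (simp add: vac_fixed)
  next
    case (Cons i a)
    show ?case
      using Cons.IH[of "adj (R i) o\<^sub>L x"] Cons.prems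
      by (simp add: fixed_compose_left M_adj_right_creation cinner_adj_right cbounded_right_creation)
  qed
  from this[OF x, of "rev _" "rev _"] have words: "cinner (ket v) (\<theta> x (ket w)) = cinner (ket v) (x (ket w))" for v w
    by (simp add: Rw_vacuum)
  show ?thesis
    by (rule blinfun_eq_on_words)
      (use words auto_mem[OF \<theta> x] x in \<open>auto simp: M_cbounded cinner_ket intro!: fock_eqI\<close>)
qed

end

end

section \<open>Second quantisation of unitaries\<close>

abbreviation uinv :: "('h \<Rightarrow> 'h) \<Rightarrow> 'h \<Rightarrow> 'h" where
  "uinv U \<equiv> inv_into UNIV U"

lemma unitary_inv:
  assumes "unitary U"
  shows "uinv U (U \<xi>) = \<xi>" "U (uinv U \<xi>) = \<xi>" "unitary (uinv U)"
proof -
  note U = assms[unfolded unitary_def]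
  have "inj U"
  proof (rule injI)
    fix \<xi> \<zeta>
    assume eq: "U \<xi> = U \<zeta>"
    show "\<xi> = \<zeta>"
      by (rule cinner_eqI) (metis U eq)
  qed
  then show l: "uinv U (U \<xi>) = \<xi>" for \<xi>
    by (rule inv_f_f)
  show r: "U (uinv U \<xi>) = \<xi>" for \<xi>
    using U by (simp add: surj_f_inv_f)
  show "unitary (uinv U)"
    unfolding unitary_def
  proof (intro conjI allI)
    show "uinv U (x + y) = uinv U x + uinv U y" for x y
      by (metis U l r)
    show "uinv U (c *\<^sub>C x) = c *\<^sub>C uinv U x" for c x
      by (metis U l r)
    show "cinner (uinv U x) (uinv U y) = cinner x y" for x y
      by (metis U r)
    show "surj (uinv U)"
      by (metis l surjI)
  qed
qed

lemma unitary_comp: "unitary U \<Longrightarrow> unitary V \<Longrightarrow> unitary (U \<circ> V)"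
  using comp_surj[of V U] by (simp add: unitary_def comp_def)

lemma unitary_id: "unitary id"
  by (simp add: unitary_def)

lemma unitary_adjoint: "unitary U \<Longrightarrow> cinner (U \<xi>) \<zeta> = cinner \<xi> (uinv U \<zeta>)"
  by (metis unitary_def unitary_inv(2))

lemma sum_lists_Suc:
  fixes F :: "'n::finite list \<Rightarrow> 'a::comm_monoid_add"
  shows "(\<Sum>w | length w = Suc k. F w) = (\<Sum>w | length w = k. \<Sum>i\<in>UNIV. F (i # w))"
proof -
  have "{w :: 'n list. length w = Suc k} = (\<lambda>(w, i). i # w) ` ({w. length w = k} \<times> UNIV)"
    by (auto simp: length_Suc_conv image_iff)
  moreover have "inj_on (\<lambda>(w, i :: 'n). i # w) ({w. length w = k} \<times> UNIV)"
    by (auto simp: inj_on_def)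
  ultimately have "(\<Sum>w | length w = Suc k. F w) = (\<Sum>(w, i)\<in>{w. length w = k} \<times> UNIV. F (i # w))"
    by (simp add: sum.reindex case_prod_unfold)
  then show ?thesis
    by (simp add: sum.cartesian_product)
qed

text \<open>
  The tensor powers of a matrix acting on coefficient families, by recursion on the word: the first
  tensor factor is transformed first. Each value is a finite sum over the words of the same length.
\<close>

fun tensor_powers :: "('n::finite \<Rightarrow> 'n \<Rightarrow> complex) \<Rightarrow> ('n list \<Rightarrow> complex) \<Rightarrow> 'n list \<Rightarrow> complex" where
  "tensor_powers u \<eta> [] = \<eta> []"
| "tensor_powers u \<eta> (i # w) = tensor_powers u (\<lambda>v. \<Sum>j\<in>UNIV. u i j * \<eta> (j # v)) w"

lemma tensor_powers_add:
  "tensor_powers u (\<lambda>v. \<eta> v + \<zeta> v) w = tensor_powers u \<eta> w + tensor_powers u \<zeta> w"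
  by (induction w arbitrary: \<eta> \<zeta>) (simp_all add: distrib_left sum.distrib)

lemma tensor_powers_scale: "tensor_powers u (\<lambda>v. c * \<eta> v) w = c * tensor_powers u \<eta> w"
proof (induction w arbitrary: \<eta>)
  case (Cons i w)
  have "(\<lambda>v. \<Sum>j\<in>UNIV. u i j * (c * \<eta> (j # v))) = (\<lambda>v. c * (\<Sum>j\<in>UNIV. u i j * \<eta> (j # v)))"
    by (simp add: sum_distrib_left mult.left_commute)
  then show ?case
    by (simp add: Cons.IH)
qed simp

lemma tensor_powers_snoc:
  assumes "\<eta> [] = 0" "\<And>v j. \<eta> (v @ [j]) = z j * \<zeta> v"
  shows "tensor_powers u \<eta> [] = 0"
    "tensor_powers u \<eta> (w @ [i]) = (\<Sum>j\<in>UNIV. u i j * z j) * tensor_powers u \<zeta> w"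
proof -
  show "tensor_powers u \<eta> (w @ [i]) = (\<Sum>j\<in>UNIV. u i j * z j) * tensor_powers u \<zeta> w"
    using assms(2)
  proof (induction w arbitrary: \<eta> \<zeta>)
    case Nil
    then have "\<eta> [j] = z j * \<zeta> []" for j
      by (metis append_Nil)
    then show ?case
      by (simp add: sum_distrib_right mult.assoc)
  next
    case (Cons k w)
    have "\<eta> (j # v @ [l]) = z l * \<zeta> (j # v)" for j v l
      using Cons.prems[of "j # v" l] by simp
    then show ?case
      by (simp, intro Cons.IH) (simp add: sum_distrib_left mult_ac)
  qed
qed (use assms in simp)

text \<open>
  The assumption, that the matrix is isometric, disposes of the first letter, once the induction
  hypothesis has been applied to the remaining word.
\<close>

lemma norm_tensor_powers_level:
  assumes "\<And>z. (\<Sum>i\<in>UNIV. (cmod (\<Sum>j\<in>UNIV. u i j * z j))\<^sup>2) = (\<Sum>j\<in>UNIV. (cmod (z j))\<^sup>2)"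
  shows "(\<Sum>w | length w = k. (cmod (tensor_powers u \<eta> w))\<^sup>2) = (\<Sum>w | length w = k. (cmod (\<eta> w))\<^sup>2)"
proof (induction k arbitrary: \<eta>)
  case (Suc k)
  have "(\<Sum>w | length w = Suc k. (cmod (tensor_powers u \<eta> w))\<^sup>2)
      = (\<Sum>i\<in>UNIV. \<Sum>w | length w = k. (cmod (tensor_powers u \<eta> (i # w)))\<^sup>2)"
    unfolding sum_lists_Suc by (rule sum.swap)
  also have "\<dots> = (\<Sum>i\<in>UNIV. \<Sum>w | length w = k. (cmod (\<Sum>j\<in>UNIV. u i j * \<eta> (j # w)))\<^sup>2)"
    by (simp add: Suc.IH)
  also have "\<dots> = (\<Sum>w | length w = k. \<Sum>i\<in>UNIV. (cmod (\<Sum>j\<in>UNIV. u i j * \<eta> (j # w)))\<^sup>2)"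
    by (rule sum.swap)
  also have "\<dots> = (\<Sum>w | length w = Suc k. (cmod (\<eta> w))\<^sup>2)"
    unfolding sum_lists_Suc assms ..
  finally show ?case .
qed simp

context fock_basis
begin

lemma cinner_basis_sum: "cinner (e i) (\<Sum>j\<in>UNIV. z j *\<^sub>C e j) = z i"
  by (simp add: cinner.sum_right cinner_scaleC_right cinner_basis if_distrib[of "\<lambda>x. _ * x"] cong: if_cong)

lemma sum_norm_coordinates: "(\<Sum>i\<in>UNIV. (cmod (cinner (e i) \<xi>))\<^sup>2) = (norm \<xi>)\<^sup>2"
proof -
  have "complex_of_real ((norm \<xi>)\<^sup>2) = complex_of_real (\<Sum>i\<in>UNIV. (cmod (cinner (e i) \<xi>))\<^sup>2)"
    unfolding cinner_self[symmetric] cinner_expansion[OF onb, of \<xi> \<xi>] of_real_sum complex_norm_square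
    by (simp add: mult.commute)
  then show ?thesis
    by (simp only: of_real_eq_iff)
qed

lemma basis_eqI: "(\<And>i. cinner (e i) \<xi> = cinner (e i) \<zeta>) \<Longrightarrow> \<xi> = \<zeta>"
proof (rule cinner_eqI)
  fix \<eta>
  assume "\<And>i. cinner (e i) \<xi> = cinner (e i) \<zeta>"
  then show "cinner \<eta> \<xi> = cinner \<eta> \<zeta>"
    using cinner_expansion[OF onb, of \<eta> \<xi>] cinner_expansion[OF onb, of \<eta> \<zeta>] by simp
qed

lemma right_creation_inject: "right_creation e \<xi> = right_creation e \<zeta> \<Longrightarrow> \<xi> = \<zeta>"
proof (rule basis_eqI)
  fix i
  assume eq: "right_creation e \<xi> = right_creation e \<zeta>"
  have "coeff (right_creation e \<xi> \<Omega>) [i] = cinner (e i) \<xi>" for \<xi>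
    by (simp add: right_creation_apply tensor_right.rep_eq vacuum.rep_eq)
  then show "cinner (e i) \<xi> = cinner (e i) \<zeta>"
    using eq by metis
qed

lemma left_creation_expansion: "left_creation e \<xi> f = (\<Sum>j\<in>UNIV. cinner (e j) \<xi> *\<^sub>C L j f)"
proof (rule fock_eqI)
  fix w
  show "coeff (left_creation e \<xi> f) w = coeff (\<Sum>j\<in>UNIV. cinner (e j) \<xi> *\<^sub>C L j f) w"
    by (cases w) (simp_all add: coeff_sum left_creation_apply tensor_left.rep_eq scaleC_fock.rep_eq
        cinner_basis if_distrib[of "\<lambda>x. x * _"] if_distrib[of "\<lambda>x. _ * x"] cong: if_cong)
qed

definition unitary_matrix :: "('h \<Rightarrow> 'h) \<Rightarrow> 'n \<Rightarrow> 'n \<Rightarrow> complex" where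
  "unitary_matrix U i j = cinner (e i) (U (e j))"

text \<open>The second quantisation of \<open>U\<close>.\<close>

definition Gam :: "('h \<Rightarrow> 'h) \<Rightarrow> 'n fock \<Rightarrow>\<^sub>L 'n fock" where
  "Gam U = Blinfun (\<lambda>f. Abs_fock (tensor_powers (unitary_matrix U) (coeff f)))"

context
  fixes U :: "'h \<Rightarrow> 'h"
  assumes U: "unitary U"
begin

lemma unitary_matrix_apply: "(\<Sum>j\<in>UNIV. unitary_matrix U i j * cinner (e j) \<xi>) = cinner (e i) (U \<xi>)"
proof -
  have "cinner (e i) (U \<xi>) = cinner (uinv U (e i)) \<xi>"
    using unitary_adjoint[OF U, of \<xi> "e i"] cinner_commute by metis
  also have "\<dots> = (\<Sum>j\<in>UNIV. cnj (cinner (e j) (uinv U (e i))) * cinner (e j) \<xi>)"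
    by (rule cinner_expansion[OF onb])
  also have "\<dots> = (\<Sum>j\<in>UNIV. unitary_matrix U i j * cinner (e j) \<xi>)"
    unfolding unitary_matrix_def unitary_adjoint[OF U, symmetric] by (simp add: cinner_commute[symmetric])
  finally show ?thesis ..
qed

lemma unitary_matrix_isometry:
  "(\<Sum>i\<in>UNIV. (cmod (\<Sum>j\<in>UNIV. unitary_matrix U i j * z j))\<^sup>2) = (\<Sum>j\<in>UNIV. (cmod (z j))\<^sup>2)"
proof -
  define \<xi> where "\<xi> = (\<Sum>j\<in>UNIV. z j *\<^sub>C e j)"
  have "complex_of_real ((norm (U \<xi>))\<^sup>2) = complex_of_real ((norm \<xi>)\<^sup>2)"
    using U unfolding cinner_self[symmetric] unitary_def by blast
  then have "(\<Sum>i\<in>UNIV. (cmod (cinner (e i) (U \<xi>)))\<^sup>2) = (\<Sum>i\<in>UNIV. (cmod (cinner (e i) \<xi>))\<^sup>2)"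
    unfolding sum_norm_coordinates by (simp only: of_real_eq_iff)
  then show ?thesis
    unfolding unitary_matrix_apply[symmetric] by (simp add: \<xi>_def cinner_basis_sum)
qed

lemma sum_tensor_powers_le:
  assumes "finite W"
  shows "(\<Sum>w\<in>W. (cmod (tensor_powers (unitary_matrix U) (coeff f) w))\<^sup>2) \<le> (norm f)\<^sup>2"
proof -
  define K where "K = Max (insert 0 (length ` W))"
  define B where "B = {w :: 'n list. length w \<le> K}"
  have "finite B"
    unfolding B_def using finite_lists_length_le[of "UNIV :: 'n set" K] by simp
  have lev: "(\<Sum>k\<le>K. \<Sum>w | length w = k. F w) = (\<Sum>w\<in>B. F w)" for F :: "'n list \<Rightarrow> real"
  proof -
    have "{w \<in> B. length w = k} = {w. length w = k}" if "k \<le> K" for k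
      using that by (auto simp: B_def)
    then have "(\<Sum>k\<le>K. \<Sum>w | length w = k. F w) = (\<Sum>k\<le>K. \<Sum>w\<in>{w \<in> B. length w = k}. F w)"
      by simp
    also have "\<dots> = (\<Sum>w\<in>B. F w)"
      by (rule sum.group[OF \<open>finite B\<close>]) (auto simp: B_def)
    finally show ?thesis .
  qed
  have "W \<subseteq> B"
    using assms by (auto simp: B_def K_def intro: Max_ge)
  then have "(\<Sum>w\<in>W. (cmod (tensor_powers (unitary_matrix U) (coeff f) w))\<^sup>2)
      \<le> (\<Sum>w\<in>B. (cmod (tensor_powers (unitary_matrix U) (coeff f) w))\<^sup>2)"
    using \<open>finite B\<close> by (intro sum_mono2) auto
  also have "\<dots> = (\<Sum>w\<in>B. (cmod (coeff f w))\<^sup>2)"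
    unfolding lev[symmetric] norm_tensor_powers_level[OF unitary_matrix_isometry] ..
  also have "\<dots> \<le> (norm f)\<^sup>2"
    by (rule finite_sums_le_norm[OF \<open>finite B\<close>])
  finally show ?thesis .
qed

lemma coeff_Gam: "coeff (Gam U f) w = tensor_powers (unitary_matrix U) (coeff f) w"
proof -
  define G where "G f = Abs_fock (tensor_powers (unitary_matrix U) (coeff f))" for f
  have cG: "coeff (G f) w = tensor_powers (unitary_matrix U) (coeff f) w" for f w
    using coeff_Abs_fock[of "tensor_powers (unitary_matrix U) (coeff f)" "norm f"] sum_tensor_powers_le
    by (simp add: G_def)
  have "bounded_linear G"
  proof (rule bounded_linear_intro[where K = 1])
    show "norm (G f) \<le> norm f * 1" for f
      by (rule norm_fock_leI) (simp_all add: cG sum_tensor_powers_le)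
    show "G (f + g) = G f + G g" for f g
      by (rule fock_eqI) (simp add: cG plus_fock.rep_eq tensor_powers_add)
    show "G (a *\<^sub>R f) = a *\<^sub>R G f" for a f
      by (rule fock_eqI) (simp add: cG scaleR_fock_def scaleC_fock.rep_eq tensor_powers_scale)
  qed
  then have "blinfun_apply (Blinfun G) = G"
    by (rule bounded_linear_Blinfun_apply)
  moreover have "Gam U = Blinfun G"
    by (simp add: Gam_def G_def[abs_def])
  ultimately show ?thesis
    by (simp add: cG)
qed

lemma norm_Gam_le: "norm (Gam U f) \<le> norm f"
  by (rule norm_fock_leI) (simp_all add: coeff_Gam sum_tensor_powers_le)

lemma cbounded_Gam: "Gam U \<in> cbounded_ops"
  by (auto simp: cbounded_ops_def intro!: fock_eqI simp: coeff_Gam scaleC_fock.rep_eq tensor_powers_scale)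

lemma Gam_vacuum: "Gam U \<Omega> = \<Omega>"
proof (rule fock_eqI)
  have zero: "tensor_powers (unitary_matrix U) (\<lambda>_. 0) w = 0" for w
    by (induction w) auto
  show "coeff (Gam U \<Omega>) w = coeff \<Omega> w" for w
    by (cases w) (simp_all add: coeff_Gam vacuum.rep_eq zero)
qed

lemma Gam_left_creation: "Gam U (left_creation e \<xi> f) = left_creation e (U \<xi>) (Gam U f)"
proof (rule fock_eqI)
  fix w
  show "coeff (Gam U (left_creation e \<xi> f)) w = coeff (left_creation e (U \<xi>) (Gam U f)) w"
  proof (cases w)
    case (Cons i v)
    have "(\<lambda>v. \<Sum>j\<in>UNIV. unitary_matrix U i j * (cinner (e j) \<xi> * coeff f v)) = (\<lambda>v. cinner (e i) (U \<xi>) * coeff f v)"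
      unfolding unitary_matrix_apply[symmetric] by (simp add: sum_distrib_right mult.assoc)
    then show ?thesis
      by (simp add: Cons coeff_Gam left_creation_apply tensor_left.rep_eq tensor_powers_scale)
  qed (simp add: coeff_Gam left_creation_apply tensor_left.rep_eq)
qed

lemma Gam_right_creation: "Gam U (right_creation e \<xi> f) = right_creation e (U \<xi>) (Gam U f)"
proof (rule fock_eqI)
  fix w
  have nil: "coeff (right_creation e \<xi> f) [] = 0"
    and snoc: "coeff (right_creation e \<xi> f) (v @ [j]) = cinner (e j) \<xi> * coeff f v" for v j f \<xi>
    by (simp_all add: right_creation_apply tensor_right.rep_eq)
  show "coeff (Gam U (right_creation e \<xi> f)) w = coeff (right_creation e (U \<xi>) (Gam U f)) w"
  proof (cases w rule: rev_cases)
    case Nil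
    then show ?thesis
      by (simp add: coeff_Gam nil)
  next
    case w: (snoc v i)
    show ?thesis
      unfolding w coeff_Gam tensor_powers_snoc(2)[OF nil snoc] unitary_matrix_apply snoc ..
  qed
qed

end

text \<open>
  The composites commute with right creation and fix the vacuum. As words are obtained from the vacuum
  by right creation, they are the identity.
\<close>

lemma Gam_inverse:
  assumes U: "unitary U"
  shows "Gam U (Gam (uinv U) f) = f" "Gam (uinv U) (Gam U f) = f"
proof -
  note V = unitary_inv(3)[OF U]
  have "Gam U (Gam (uinv U) (Rw w \<Omega>)) = Rw w \<Omega>" "Gam (uinv U) (Gam U (Rw w \<Omega>)) = Rw w \<Omega>" for w
    by (induction w) (simp_all add: Gam_vacuum[OF U] Gam_vacuum[OF V] Gam_right_creation[OF U]
        Gam_right_creation[OF V] unitary_inv(1,2)[OF U])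
  from this[of "rev _"] have "Gam U o\<^sub>L Gam (uinv U) = id_blinfun" "Gam (uinv U) o\<^sub>L Gam U = id_blinfun"
    using cbounded_Gam[OF U] cbounded_Gam[OF V]
    by (auto intro!: blinfun_eq_on_words simp: Rw_vacuum)
  then show "Gam U (Gam (uinv U) f) = f" "Gam (uinv U) (Gam U f) = f"
    by (metis blinfun_apply_blinfun_compose blinfun_apply_id_blinfun)+
qed

text \<open>
  The second quantisations of \<open>U\<close> and of its inverse are contractions and inverse to each other, so
  they are isometric.
\<close>

lemma cinner_Gam:
  assumes U: "unitary U"
  shows "cinner (Gam U f) (Gam U g) = cinner f g"
proof (rule cinner_eq_of_inner)
  have norm: "norm (Gam U f) = norm f" for f
    using norm_Gam_le[OF U, of f] norm_Gam_le[OF unitary_inv(3)[OF U], of "Gam U f"]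
    by (simp add: Gam_inverse[OF U])
  have polar: "inner f g = ((norm (f + g))\<^sup>2 - (norm f)\<^sup>2 - (norm g)\<^sup>2) / 2" for f g :: "'n fock"
    by (simp add: power2_norm_eq_inner inner_add_left inner_add_right inner_commute)
  fix c
  have "inner (Gam U f) (Gam U (c *\<^sub>C g)) = inner f (c *\<^sub>C g)"
    unfolding polar by (simp add: norm blinfun.add_right[symmetric])
  then show "inner (Gam U f) (c *\<^sub>C Gam U g) = inner f (c *\<^sub>C g)"
    by (simp add: cbounded_opsD[OF cbounded_Gam[OF U]])
qed

lemma cinner_Gam_left: "unitary U \<Longrightarrow> cinner (Gam U f) g = cinner f (Gam (uinv U) g)"
  by (metis cinner_Gam Gam_inverse(1))

lemma cinner_Gam_right: "unitary U \<Longrightarrow> cinner f (Gam U g) = cinner (Gam (uinv U) f) g"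
  by (metis cinner_Gam Gam_inverse(1))

section \<open>Existence of the automorphisms\<close>

text \<open>
  The average defining the Markov operator is the same for all orthonormal bases, because the
  coefficients of a change of basis are orthonormal in the index that is summed over.
\<close>

lemma sum_left_creation_unitary:
  assumes U: "unitary U" and x: "x \<in> cbounded_ops"
  shows "(\<Sum>i\<in>UNIV. cinner (left_creation e (U (e i)) f) (x (left_creation e (U (e i)) g)))
    = (\<Sum>i\<in>UNIV. cinner (L i f) (x (L i g)))"
proof -
  let ?u = "\<lambda>j i. cinner (e j) (U (e i))"
  have orth: "(\<Sum>i\<in>UNIV. cnj (?u j i) * ?u k i) = (if j = k then 1 else 0)" for j k
  proof -
    have "(\<Sum>i\<in>UNIV. cnj (?u j i) * ?u k i)
        = (\<Sum>i\<in>UNIV. cnj (cinner (e i) (uinv U (e k))) * cinner (e i) (uinv U (e j)))"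
      unfolding unitary_adjoint[OF U, symmetric] by (simp add: cinner_commute[symmetric] mult.commute)
    also have "\<dots> = cinner (uinv U (e k)) (uinv U (e j))"
      by (rule cinner_expansion[OF onb, symmetric])
    also have "\<dots> = cinner (e k) (e j)"
      using unitary_inv(3)[OF U] by (simp add: unitary_def)
    finally show ?thesis
      by (simp add: cinner_basis)
  qed
  have "cinner (left_creation e (U (e i)) f) (x (left_creation e (U (e i)) g))
      = (\<Sum>j\<in>UNIV. \<Sum>k\<in>UNIV. cnj (?u j i) * ?u k i * cinner (L j f) (x (L k g)))" for i
    unfolding left_creation_expansion[of "U (e i)"]
    by (simp add: blinfun.sum_right cbounded_opsD[OF x] cinner.sum_left cinner.sum_right
        cinner_scaleC_left cinner_scaleC_right sum_distrib_left mult_ac) (rule sum.swap)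
  then have "(\<Sum>i\<in>UNIV. cinner (left_creation e (U (e i)) f) (x (left_creation e (U (e i)) g)))
      = (\<Sum>i\<in>UNIV. \<Sum>j\<in>UNIV. \<Sum>k\<in>UNIV. cnj (?u j i) * ?u k i * cinner (L j f) (x (L k g)))"
    by simp
  also have "\<dots> = (\<Sum>j\<in>UNIV. \<Sum>i\<in>UNIV. \<Sum>k\<in>UNIV. cnj (?u j i) * ?u k i * cinner (L j f) (x (L k g)))"
    by (rule sum.swap)
  also have "\<dots> = (\<Sum>j\<in>UNIV. \<Sum>k\<in>UNIV. \<Sum>i\<in>UNIV. cnj (?u j i) * ?u k i * cinner (L j f) (x (L k g)))"
    by (intro sum.cong refl sum.swap)
  also have "\<dots> = (\<Sum>j\<in>UNIV. \<Sum>k\<in>UNIV. (if j = k then 1 else 0) * cinner (L j f) (x (L k g)))"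
    unfolding sum_distrib_right[symmetric] orth ..
  also have "\<dots> = (\<Sum>j\<in>UNIV. cinner (L j f) (x (L j g)))"
    by (simp add: if_distrib[of "\<lambda>x. x * _"] cong: if_cong)
  finally show ?thesis .
qed

definition Ad :: "('h \<Rightarrow> 'h) \<Rightarrow> ('n fock \<Rightarrow>\<^sub>L 'n fock) \<Rightarrow> 'n fock \<Rightarrow>\<^sub>L 'n fock" where
  "Ad U x = Gam U o\<^sub>L x o\<^sub>L Gam (uinv U)"

context
  fixes U :: "'h \<Rightarrow> 'h"
  assumes U: "unitary U"
begin

lemma Ad_apply: "Ad U x f = Gam U (x (Gam (uinv U) f))"
  by (simp add: Ad_def)

lemma Ad_cbounded: "x \<in> cbounded_ops \<Longrightarrow> Ad U x \<in> cbounded_ops"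
  unfolding Ad_def by (intro cbounded_compose cbounded_Gam U unitary_inv(3)[OF U])

lemma avg_Ad:
  assumes x: "x \<in> cbounded_ops"
  shows "avg L (Ad U x) = Ad U (avg L x)"
proof (rule blinfun_cinner_eqI)
  fix f g
  note V = unitary_inv(3)[OF U]
  have "(\<Sum>i\<in>UNIV. cinner (L i f) (Ad U x (L i g)))
    = (\<Sum>i\<in>UNIV. cinner (left_creation e (uinv U (e i)) (Gam (uinv U) f)) (x (left_creation e (uinv U (e i)) (Gam (uinv U) g))))"
    by (simp add: Ad_apply cinner_Gam_right[OF U] Gam_left_creation[OF V])
  also have "\<dots> = (\<Sum>i\<in>UNIV. cinner (L i (Gam (uinv U) f)) (x (L i (Gam (uinv U) g))))"
    by (rule sum_left_creation_unitary[OF V x])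
  finally show "cinner f (avg L (Ad U x) g) = cinner f (Ad U (avg L x) g)"
    by (simp add: cinner_avg[OF isometries_L] Ad_apply cinner_Gam_right[OF U])
qed

lemma Ad_in_M: "x \<in> M \<Longrightarrow> Ad U x \<in> M"
  by (simp add: M_iff Ad_cbounded avg_Ad)

lemma avg_pow_Ad: "x \<in> cbounded_ops \<Longrightarrow> (avg L ^^ k) (Ad U x) = Ad U ((avg L ^^ k) x)"
  by (induction k) (simp_all add: avg_Ad avg_pow_cbounded[OF isometries_L])

lemma Ad_compose: "Ad U (x o\<^sub>L y) = Ad U x o\<^sub>L Ad U y"
  by (rule blinfun_eqI) (simp add: Ad_apply Gam_inverse[OF U])

lemma Ad_choi:
  assumes "x \<in> M" "y \<in> M"
  shows "Ad U (x \<odot> y) = Ad U x \<odot> Ad U y"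
proof (rule choi_eqI[symmetric])
  fix f
  have "(\<lambda>k. Gam U ((avg L ^^ k) (x o\<^sub>L y) (Gam (uinv U) f))) \<longlonglongrightarrow> Gam U ((x \<odot> y) (Gam (uinv U) f))"
    by (intro blinfun.tendsto tendsto_const choi_tendsto assms)
  then show "(\<lambda>k. (avg L ^^ k) (Ad U x o\<^sub>L Ad U y) f) \<longlonglongrightarrow> Ad U (x \<odot> y) f"
    using assms by (simp add: Ad_compose[symmetric] avg_pow_Ad cbounded_compose M_cbounded Ad_apply)
qed

lemma adj_Ad: "x \<in> cbounded_ops \<Longrightarrow> adj (Ad U x) = Ad U (adj x)"
  by (rule adj_eqI)
    (simp add: Ad_apply cinner_Gam_left[OF U] cinner_Gam_right[OF U] cinner_adj_left)

lemma Ad_right_creation: "Ad U (right_creation e \<xi>) = right_creation e (U \<xi>)"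
  by (rule blinfun_eqI) (simp add: Ad_apply Gam_right_creation[OF U] Gam_inverse[OF U])

end

lemma inv_inv_unitary:
  assumes U: "unitary U"
  shows "uinv (uinv U) = U"
proof (rule ext)
  show "uinv (uinv U) \<xi> = U \<xi>" for \<xi>
    using unitary_inv(1)[OF unitary_inv(3)[OF U], of "U \<xi>"] unfolding unitary_inv(1)[OF U] .
qed

lemma Ad_automorphism:
  assumes U: "unitary U"
  shows "restrict (Ad U) M \<in> H_infty_auto e"
proof -
  note V = unitary_inv(3)[OF U]
  have "bij_betw (Ad U) M M"
    by (rule bij_betw_byWitness[where f' = "Ad (uinv U)"])
      (auto simp: Ad_in_M[OF U] Ad_in_M[OF V] Ad_apply[OF U] Ad_apply[OF V] Gam_inverse[OF U]
        inv_inv_unitary[OF U] intro!: blinfun_eqI)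
  then have "restrict (Ad U) M \<in> Bij M"
    by (auto simp: Bij_def cong: bij_betw_cong)
  moreover have "Ad U (x + y) = Ad U x + Ad U y" for x y
    by (rule blinfun_eqI) (simp add: Ad_apply[OF U] blinfun.add_left blinfun.add_right)
  moreover have "Ad U (op_scaleC c x) = op_scaleC c (Ad U x)" for c x
    by (rule blinfun_eqI) (simp add: Ad_apply[OF U] cbounded_opsD[OF cbounded_Gam[OF U]])
  ultimately show ?thesis
    by (simp add: H_infty_auto_def M_add M_scaleC choi_in_M M_adj Ad_choi[OF U] adj_Ad[OF U] M_cbounded)
qed

section \<open>The automorphism group\<close>

lemma H_infty_auto_Bij: "\<theta> \<in> H_infty_auto e \<Longrightarrow> \<theta> \<in> Bij M"
  by (simp add: H_infty_auto_def)

lemma compose_auto: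
  assumes "\<theta> \<in> H_infty_auto e" "\<phi> \<in> H_infty_auto e"
  shows "compose M \<theta> \<phi> \<in> H_infty_auto e"
  using compose_Bij[OF assms[THEN H_infty_auto_Bij]] assms auto_mem[OF assms(2)]
  by (simp add: H_infty_auto_def compose_eq M_add M_scaleC choi_in_M M_adj)

lemma subgroup_H_infty_auto: "subgroup (H_infty_auto e) (BijGroup M)"
proof (rule subgroup.intro)
  show "H_infty_auto e \<subseteq> carrier (BijGroup M)"
    by (auto simp: BijGroup_def H_infty_auto_Bij)
  show "\<theta> \<otimes>\<^bsub>BijGroup M\<^esub> \<phi> \<in> H_infty_auto e" if "\<theta> \<in> H_infty_auto e" "\<phi> \<in> H_infty_auto e" for \<theta> \<phi>
    using that compose_auto by (simp add: BijGroup_def H_infty_auto_Bij)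
  show "\<one>\<^bsub>BijGroup M\<^esub> \<in> H_infty_auto e"
    using id_Bij[of M] by (simp add: BijGroup_def H_infty_auto_def M_add M_scaleC choi_in_M M_adj)
  show "inv\<^bsub>BijGroup M\<^esub> \<theta> \<in> H_infty_auto e" if "\<theta> \<in> H_infty_auto e" for \<theta>
    using that auto_inverse by (simp add: inv_BijGroup H_infty_auto_Bij)
qed

lemma group_H_infty_Aut: "group (H_infty_Aut e)"
  unfolding H_infty_Aut_def by (rule subgroup.subgroup_is_group[OF subgroup_H_infty_auto group_BijGroup])

lemma carrier_H_infty_Aut [simp]: "carrier (H_infty_Aut e) = H_infty_auto e"
  by (simp add: H_infty_Aut_def)

lemma mult_H_infty_Aut:
  "\<theta> \<in> H_infty_auto e \<Longrightarrow> \<phi> \<in> H_infty_auto e \<Longrightarrow> \<theta> \<otimes>\<^bsub>H_infty_Aut e\<^esub> \<phi> = compose M \<theta> \<phi>"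
  by (simp add: H_infty_Aut_def BijGroup_def H_infty_auto_Bij)

text \<open>
  Rigidity is applied to \<open>\<phi>\<^sup>-\<^sup>1 \<circ> \<theta>\<close>, which fixes the right creation operators.
\<close>

lemma automorphism_unique:
  assumes \<theta>: "\<theta> \<in> H_infty_auto e" and \<phi>: "\<phi> \<in> H_infty_auto e"
    and eq: "\<And>\<xi>. \<theta> (right_creation e \<xi>) = \<phi> (right_creation e \<xi>)"
  shows "\<theta> = \<phi>"
proof (rule extensionalityI[OF Bij_imp_extensional Bij_imp_extensional])
  let ?i = "restrict (inv_into M \<phi>) M"
  let ?c = "compose M ?i \<theta>"
  have c: "?c \<in> H_infty_auto e"
    by (rule compose_auto[OF auto_inverse[OF \<phi>] \<theta>])
  have fix_right: "?c (right_creation e \<xi>) = right_creation e \<xi>" for \<xi>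
    using bij_betw_inv_into_left[OF auto_bij[OF \<phi>] right_creation_in_M] auto_mem[OF \<phi> right_creation_in_M]
    by (simp add: compose_eq right_creation_in_M eq)
  have "inv_into M \<phi> (\<theta> x) = x" if "x \<in> M" for x
    using fixed_identity[OF c fix_right that] that auto_mem[OF \<theta> that] by (simp add: compose_eq)
  then show "\<theta> x = \<phi> x" if "x \<in> M" for x
    using that bij_betw_inv_into_right[OF auto_bij[OF \<phi>] auto_mem[OF \<theta> that]] by simp
qed (use \<theta> \<phi> in \<open>auto simp: H_infty_auto_Bij\<close>)

lemma unique_automorphism:
  assumes U: "unitary U"
  shows "\<exists>!\<theta>. \<theta> \<in> H_infty_auto e \<and> (\<forall>\<xi>. \<theta> (right_creation e \<xi>) = right_creation e (U \<xi>))"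
proof (rule ex1I[of _ "restrict (Ad U) M"])
  show "restrict (Ad U) M \<in> H_infty_auto e \<and>
      (\<forall>\<xi>. restrict (Ad U) M (right_creation e \<xi>) = right_creation e (U \<xi>))"
    by (simp add: Ad_automorphism[OF U] right_creation_in_M Ad_right_creation[OF U])
  then show "\<theta> = restrict (Ad U) M"
    if "\<theta> \<in> H_infty_auto e \<and> (\<forall>\<xi>. \<theta> (right_creation e \<xi>) = right_creation e (U \<xi>))" for \<theta>
    using that by (intro automorphism_unique) auto
qed

lemma Psi_automorphism:
  assumes "unitary U"
  shows "Psi e U \<in> H_infty_auto e" "Psi e U (right_creation e \<xi>) = right_creation e (U \<xi>)"
  using theI'[OF unique_automorphism[OF assms]] by (simp_all add: Psi_def)

lemma group_unitary_group: "group (unitary_group :: ('h \<Rightarrow> 'h) monoid)"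
proof (rule groupI)
  show "\<exists>V\<in>carrier unitary_group. V \<otimes>\<^bsub>unitary_group\<^esub> U = \<one>\<^bsub>unitary_group\<^esub>"
    if "U \<in> carrier unitary_group" for U :: "'h \<Rightarrow> 'h"
    using that unitary_inv[of U] by (intro bexI[of _ "uinv U"]) (auto simp: unitary_group_def)
qed (auto simp: unitary_group_def unitary_comp unitary_id)

lemma group_hom_Psi: "group_hom unitary_group (H_infty_Aut e) (Psi e)"
proof (intro group_hom.intro group_hom_axioms.intro homI)
  show "Psi e (U \<otimes>\<^bsub>unitary_group\<^esub> V) = Psi e U \<otimes>\<^bsub>H_infty_Aut e\<^esub> Psi e V"
    if "U \<in> carrier unitary_group" "V \<in> carrier unitary_group" for U V
  proof -
    have UV: "unitary U" "unitary V"
      using that by (auto simp: unitary_group_def)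
    have "Psi e (U \<circ> V) = compose M (Psi e U) (Psi e V)"
      using UV by (intro automorphism_unique compose_auto)
        (simp_all add: Psi_automorphism unitary_comp[OF UV] compose_eq right_creation_in_M)
    then show ?thesis
      using UV by (simp add: mult_H_infty_Aut Psi_automorphism unitary_group_def)
  qed
qed (use group_unitary_group in \<open>auto simp: group_H_infty_Aut Psi_automorphism unitary_group_def\<close>)

lemma inj_on_Psi: "inj_on (Psi e) (carrier unitary_group)"
proof (rule inj_onI)
  fix U V :: "'h \<Rightarrow> 'h"
  assume UV: "U \<in> carrier unitary_group" "V \<in> carrier unitary_group" and eq: "Psi e U = Psi e V"
  then have "right_creation e (U \<xi>) = right_creation e (V \<xi>)" for \<xi>
    by (metis Psi_automorphism(2) mem_Collect_eq unitary_group_def partial_object.select_convs(1))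
  then show "U = V"
    by (intro ext right_creation_inject)
qed

end

theorem theoremC:
  fixes e :: "'n::finite \<Rightarrow> 'h::complex_inner"
  assumes "orthonormal_basis e" and "CARD('n) > 1"
  shows "(\<forall>U. unitary U \<longrightarrow>
            (\<exists>!\<theta>. \<theta> \<in> carrier (H_infty_Aut e) \<and>
                  (\<forall>\<xi>. \<theta> (right_creation e \<xi>) = right_creation e (U \<xi>)))) \<and>
         group_hom unitary_group (H_infty_Aut e) (Psi e) \<and>
         inj_on (Psi e) (carrier unitary_group)"
proof -
  interpret fock_basis e
    by unfold_locales (fact assms)+
  show ?thesis
    using unique_automorphism group_hom_Psi inj_on_Psi by simp
qed

end
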